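(* For all $k,h,\delta,\beta>0$ there exists a unique solution $(u_h,\boldsymbol{\sigma}_h)\in V_h\times\boldsymbol{\Sigma}_h$ to the problem $$A_h(u_h,\boldsymbol{\sigma}_h;v_h,\boldsymbol{\tau}_h)=(f,v_h)_\Omega+\langle g,v_h\rangle_\Gamma\qquad\forall (v_h,\boldsymbol{\tau}_h)\in V_h\times\boldsymbol{\Sigma}_h.$$
   Context: Let $\Omega\subset\mathbb{R}^d$ ($d=2,3$) be a bounded domain with boundary $\Gamma=\partial\Omega$ and outward unit normal $\mathbf{n}_\Omega$, strictly star-shaped with respect to a point $x_\Omega\in\Omega$, i.e. there is $c_\Omega>0$ with $(x-x_\Omega)\cdot\mathbf{n}_\Omega\ge c_\Omega$ for all $x\in\partial\Omega$. $\mathcal{T}_h$ is a family of partitions of $\Omega$ into triangles/tetrahedra, parameterized by the mesh size $h=\max_{K\in\mathcal{T}_h}\operatorname{diam}(K)>0$ and satisfying the minimal angle condition; $\mathcal{E}_h^I$ is the set of interior edges/faces. $k$ is the wave number, $\beta,\delta$ are penalty parameters, $f\in L^2(\Omega)$, $g\in L^2(\Gamma)$. All functions are complex-valued. $(u,v)_\Omega=\int_\Omega u\bar v\,dx$, $\langle u,v\rangle_e=\int_e u\bar v\,ds$, $\langle u,v\rangle_\Gamma=\int_\Gamma u\bar v\,ds$ (with dot products for vector functions); $\mathbf{i}=\sqrt{-1}$. $\nabla_h$ is the piecewise gradient, $\nabla_h|_K=\nabla|_K$ for $K\in\mathcal{T}_h$. On an interior edge/face $e$ shared by $K_1,K_2$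 with outward unit normals $\mathbf{n}_1,\mathbf{n}_2$: $\{v\}=\frac12(v_1+v_2)$ and $[[v]]=v_1\mathbf{n}_1+v_2\mathbf{n}_2$ for scalar $v$; $\{\mathbf{v}\}=\frac12(\mathbf{v}_1+\mathbf{v}_2)$ and $[[\mathbf{v}]]=\mathbf{v}_1\cdot\mathbf{n}_1+\mathbf{v}_2\cdot\mathbf{n}_2$ for vector $\mathbf{v}$. $V_h$ is the space of (discontinuous) functions in $L^2(\Omega)$ whose real and imaginary parts restricted to each $K\in\mathcal{T}_h$ are polynomials of degree $\le 1$; $\boldsymbol{\Sigma}_h$ is the space of vector fields in $(L^2(\Omega))^d$ whose real and imaginary parts restricted to each $K$ lie in $(P_1(K))^d$. The sesquilinear form (LDG method #1) is $$A_h(w_h,\boldsymbol{\chi}_h;v_h,\boldsymbol{\tau}_h)=(\boldsymbol{\chi}_h,\nabla_h v_h)_\Omega-k^2(w_h,v_h)_\Omega+\mathbf{i}k\langle w_h,v_h\rangle_\Gamma-\sum_{e\in\mathcal{E}_h^I}\langle\{\nabla_h w_h\}-\mathbf{i}\beta[[w_h]],[[v_h]]\rangle_e$$ $$-\sum_{e\in\mathcal{E}_h^I}\Bigl(\mathbf{i}\delta\langle[[\nabla_h w_h]],[[\boldsymbol{\tau}_h]]\rangle_e-\langle[[w_h]],\{\boldsymbol{\tau}_h\}\rangle_e\Bigr)+(\boldsymbol{\chi}_h,\boldsymbol{\tau}_h)_\Omega-(\nabla_h w_h,\boldsymbol{\tau}_h)_\Omega.$$ *)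

theory Defs
  imports "HOL-Analysis.Analysis"
begin

section \<open>Surface measure\<close>

text \<open>The Hausdorff outer measure of dimension \<open>s > 0\<close>, normalised so that it is the usual
  surface area (length for \<open>s = 1\<close>). The empty set has diameter 0, so that countable covers
  include the finite ones; for \<open>s = 0\<close> this convention would not give the counting measure.\<close>

definition hausdorff_outer :: "real \<Rightarrow> 'a::metric_space set \<Rightarrow> ennreal" where
  "hausdorff_outer s A =
    (SUP \<epsilon>\<in>{0<..}. INF C\<in>{C :: nat \<Rightarrow> 'a set.
        (\<forall>i. bounded (C i) \<and> diameter (C i) \<le> \<epsilon>) \<and> A \<subseteq> (\<Union>i. C i)}.
      (\<Sum>i. ennreal (unit_ball_vol s * (diameter (C i) / 2) powr s)))"

definition hausdorff_measure :: "real \<Rightarrow> 'a::metric_space measure" where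
  "hausdorff_measure s = measure_of UNIV (sets borel) (hausdorff_outer s)"

definition surface_on :: "(real^'d) set \<Rightarrow> (real^'d) measure" where
  "surface_on S = restrict_space (hausdorff_measure (real CARD('d) - 1)) S"


section \<open>Complex inner products\<close>

text \<open>The library's inner product on \<open>complex^'d\<close> is the real one, hence this Hermitian version,
  linear in the first argument.\<close>

definition cdot :: "complex^'d \<Rightarrow> complex^'d \<Rightarrow> complex" where
  "cdot a b = (\<Sum>i\<in>UNIV. a $ i * cnj (b $ i))"

definition cvec :: "real^'d \<Rightarrow> complex^'d" where
  "cvec a = (\<chi> i. complex_of_real (a $ i))"

definition ip :: "'a measure \<Rightarrow> ('a \<Rightarrow> complex) \<Rightarrow> ('a \<Rightarrow> complex) \<Rightarrow> complex" where
  "ip M u v = (LINT x|M. u x * cnj (v x))"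

definition ipv :: "'a measure \<Rightarrow> ('a \<Rightarrow> complex^'d) \<Rightarrow> ('a \<Rightarrow> complex^'d) \<Rightarrow> complex" where
  "ipv M u v = (LINT x|M. cdot (u x) (v x))"

definition square_integrable :: "'a measure \<Rightarrow> ('a \<Rightarrow> complex) \<Rightarrow> bool" where
  "square_integrable M f \<longleftrightarrow> f \<in> borel_measurable M \<and> integrable M (\<lambda>x. (cmod (f x))\<^sup>2)"


section \<open>Domains\<close>

text \<open>\<open>\<nu>\<close> is the outward unit normal to \<open>S\<close> at \<open>x\<close>: seen from \<open>x\<close> at small scale, \<open>S\<close> is the
  half-space \<open>(y - x) \<bullet> \<nu> < 0\<close>. At most one \<open>\<nu>\<close> qualifies, and none at a corner or where \<open>S\<close>
  lies on both sides of its boundary.\<close>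

definition outward_unit_normal_at :: "'a::euclidean_space set \<Rightarrow> 'a \<Rightarrow> 'a \<Rightarrow> bool" where
  "outward_unit_normal_at S x \<nu> \<longleftrightarrow> norm \<nu> = 1 \<and>
    (\<forall>\<epsilon>>0. \<exists>r>0. \<forall>y\<in>ball x r.
       ((y - x) \<bullet> \<nu> < - \<epsilon> * norm (y - x) \<longrightarrow> y \<in> S) \<and>
       ((y - x) \<bullet> \<nu> > \<epsilon> * norm (y - x) \<longrightarrow> y \<notin> S))"

text \<open>A polyhedral boundary has no normal along its corners and edges, so the condition is imposed
  almost everywhere on the boundary.\<close>

definition strictly_star_shaped :: "(real^'d) set \<Rightarrow> real^'d \<Rightarrow> real \<Rightarrow> bool" where
  "strictly_star_shaped \<Omega> x0 c \<longleftrightarrow> x0 \<in> \<Omega> \<and> c > 0 \<and>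
    (AE x in surface_on (frontier \<Omega>). \<exists>\<nu>. outward_unit_normal_at \<Omega> x \<nu> \<and> c \<le> (x - x0) \<bullet> \<nu>)"


section \<open>Meshes\<close>

text \<open>The elements are closed simplices. Hanging nodes are not excluded.\<close>

definition simplicial_partition :: "(real^'d) set \<Rightarrow> (real^'d) set set \<Rightarrow> bool" where
  "simplicial_partition \<Omega> T \<longleftrightarrow> finite T \<and> (\<forall>K\<in>T. int CARD('d) simplex K) \<and>
    (\<forall>K\<in>T. \<forall>L\<in>T. K \<noteq> L \<longrightarrow> interior K \<inter> interior L = {}) \<and> \<Union>T = closure \<Omega>"

definition mesh_size :: "'a::metric_space set set \<Rightarrow> real" where
  "mesh_size T = Max (diameter ` T)"

text \<open>An interior face is the common part of two elements, provided it has dimension \<open>d - 1\<close>;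
  in a conforming mesh these are exactly the common edges (triangles) or faces (tetrahedra).\<close>

definition interior_faces :: "(real^'d) set set \<Rightarrow> (real^'d) set set" where
  "interior_faces T = {K \<inter> L |K L. K \<in> T \<and> L \<in> T \<and> K \<noteq> L \<and> aff_dim (K \<inter> L) = int CARD('d) - 1}"

text \<open>The outward unit normal of a convex body \<open>K\<close> on a \<open>(d - 1)\<close>-dimensional part \<open>e\<close> of one of
  its facets.\<close>

definition face_normal :: "'a::euclidean_space set \<Rightarrow> 'a set \<Rightarrow> 'a" where
  "face_normal K e = (THE \<nu>. norm \<nu> = 1 \<and> (\<forall>x\<in>e. \<forall>y\<in>K. \<nu> \<bullet> (y - x) \<le> 0))"

text \<open>All angles of \<open>K\<close> are at least \<open>\<theta>\<close>: the angles between edges meeting at a vertex, and the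
  dihedral angles between facets. For a triangle the two kinds coincide; for a tetrahedron the
  dihedral angles are needed to exclude slivers.\<close>

definition min_angle_ge :: "real \<Rightarrow> 'a::euclidean_space set \<Rightarrow> bool" where
  "min_angle_ge \<theta> K \<longleftrightarrow>
    (\<forall>a b c. a extreme_point_of K \<and> b extreme_point_of K \<and> c extreme_point_of K \<and>
        a \<noteq> b \<and> a \<noteq> c \<and> b \<noteq> c \<longrightarrow>
        \<theta> \<le> arccos (((b - a) \<bullet> (c - a)) / (norm (b - a) * norm (c - a)))) \<and>
    (\<forall>F G. F facet_of K \<and> G facet_of K \<and> F \<noteq> G \<longrightarrow>
        \<theta> \<le> arccos (- (face_normal K F \<bullet> face_normal K G)))"


section \<open>Piecewise linear functions\<close>

definition P1_on :: "(real^'d) set \<Rightarrow> (real^'d \<Rightarrow> real) \<Rightarrow> bool" where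
  "P1_on S p \<longleftrightarrow> (\<exists>a b. \<forall>x\<in>S. p x = a + b \<bullet> x)"

text \<open>An element of \<open>L\<^sup>2(\<Omega>)\<close> that is a polynomial on each element of the mesh has exactly one
  representative that is a polynomial at every point of the interior of each element and vanishes
  elsewhere (on the skeleton, a null set, and outside the domain). The discrete spaces consist of
  these representatives, so that equality of functions is equality in \<open>L\<^sup>2(\<Omega>)\<close>.\<close>

definition V_h :: "(real^'d) set set \<Rightarrow> (real^'d \<Rightarrow> complex) set" where
  "V_h T = {v. (\<forall>K\<in>T. P1_on (interior K) (\<lambda>x. Re (v x)) \<and> P1_on (interior K) (\<lambda>x. Im (v x))) \<and>
    (\<forall>x. x \<notin> (\<Union>K\<in>T. interior K) \<longrightarrow> v x = 0)}"

definition Sigma_h :: "(real^'d) set set \<Rightarrow> (real^'d \<Rightarrow> complex^'d) set" where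
  "Sigma_h T = {\<tau>. \<forall>i. (\<lambda>x. \<tau> x $ i) \<in> V_h T}"

definition grad_h :: "(real^'d) set set \<Rightarrow> (real^'d \<Rightarrow> complex) \<Rightarrow> real^'d \<Rightarrow> complex^'d" where
  "grad_h T v x =
    (if x \<in> (\<Union>K\<in>T. interior K) then \<chi> i. frechet_derivative v (at x) (axis i 1) else 0)"

definition trace_from :: "'a::topological_space set \<Rightarrow> ('a \<Rightarrow> 'b::t2_space) \<Rightarrow> 'a \<Rightarrow> 'b" where
  "trace_from K v x = Lim (at x within interior K) v"

text \<open>Averages and jumps on an interior face \<open>e\<close>. Exactly two elements contain \<open>e\<close>, so the sums
  are the two-term expressions of the usual definition.\<close>

definition avg :: "(real^'d) set set \<Rightarrow> (real^'d) set \<Rightarrow> (real^'d \<Rightarrow> complex^'d) \<Rightarrow> real^'d \<Rightarrow> complex^'d"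
  where "avg T e \<tau> x = (1/2) *\<^sub>R (\<Sum>K\<in>{K\<in>T. e \<subseteq> K}. trace_from K \<tau> x)"

definition jump :: "(real^'d) set set \<Rightarrow> (real^'d) set \<Rightarrow> (real^'d \<Rightarrow> complex) \<Rightarrow> real^'d \<Rightarrow> complex^'d"
  where "jump T e v x = (\<Sum>K\<in>{K\<in>T. e \<subseteq> K}. trace_from K v x *s cvec (face_normal K e))"

definition jumpv :: "(real^'d) set set \<Rightarrow> (real^'d) set \<Rightarrow> (real^'d \<Rightarrow> complex^'d) \<Rightarrow> real^'d \<Rightarrow> complex"
  where "jumpv T e \<tau> x = (\<Sum>K\<in>{K\<in>T. e \<subseteq> K}. cdot (trace_from K \<tau> x) (cvec (face_normal K e)))"


section \<open>The LDG method\<close>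

text \<open>The integrals over the boundary are split according to the element from which the trace of a
  piecewise polynomial is taken; almost every boundary point lies in exactly one element.\<close>

definition bdry_ip :: "(real^'d) set \<Rightarrow> (real^'d) set set \<Rightarrow>
    (real^'d \<Rightarrow> complex) \<Rightarrow> (real^'d \<Rightarrow> complex) \<Rightarrow> complex" where
  "bdry_ip \<Omega> T w v =
    (\<Sum>K\<in>T. ip (surface_on (K \<inter> frontier \<Omega>)) (trace_from K w) (trace_from K v))"

definition A_h :: "(real^'d) set \<Rightarrow> (real^'d) set set \<Rightarrow> real \<Rightarrow> real \<Rightarrow> real \<Rightarrow>
    (real^'d \<Rightarrow> complex) \<Rightarrow> (real^'d \<Rightarrow> complex^'d) \<Rightarrow>
    (real^'d \<Rightarrow> complex) \<Rightarrow> (real^'d \<Rightarrow> complex^'d) \<Rightarrow> complex" where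
  "A_h \<Omega> T k \<beta> \<delta> w s v \<tau> =
     ipv (lebesgue_on \<Omega>) s (grad_h T v)
   - of_real (k\<^sup>2) * ip (lebesgue_on \<Omega>) w v
   + \<i> * of_real k * bdry_ip \<Omega> T w v
   - (\<Sum>e\<in>interior_faces T.
        ipv (surface_on e) (\<lambda>x. avg T e (grad_h T w) x - (\<i> * of_real \<beta>) *s jump T e w x) (jump T e v))
   - (\<Sum>e\<in>interior_faces T.
        \<i> * of_real \<delta> * ip (surface_on e) (jumpv T e (grad_h T w)) (jumpv T e \<tau>)
        - ipv (surface_on e) (jump T e w) (avg T e \<tau>))
   + ipv (lebesgue_on \<Omega>) s \<tau>
   - ipv (lebesgue_on \<Omega>) (grad_h T w) \<tau>"

definition load :: "(real^'d) set \<Rightarrow> (real^'d) set set \<Rightarrow>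
    (real^'d \<Rightarrow> complex) \<Rightarrow> (real^'d \<Rightarrow> complex) \<Rightarrow> (real^'d \<Rightarrow> complex) \<Rightarrow> complex" where
  "load \<Omega> T f g v = ip (lebesgue_on \<Omega>) f v
    + (\<Sum>K\<in>T. ip (surface_on (K \<inter> frontier \<Omega>)) g (trace_from K v))"

end

theory Submission
  imports Defs "HOL-Library.Function_Algebras"
begin

text \<open>
The discrete problem is linear, on a finite-dimensional space, with test space equal to trial
space. So it suffices that the homogeneous problem has only the trivial solution
(\<open>nondegenerate_sesquilinear_unique_solution\<close>).

Let \<open>(u, \<sigma>)\<close> solve it. Subtract the equation tested with \<open>(0, grad u)\<close> from that tested with \<open>(u, 0)\<close>;
the gradient of a piecewise affine function is piecewise constant and so is an admissible test
function. The imaginary part of the result is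
\<open>k \<parallel>u\<parallel>\<^sup>2 + \<beta> \<parallel>[u]\<parallel>\<^sup>2 + \<delta> \<parallel>[grad u]\<parallel>\<^sup>2 = 0\<close>, where the norms are over the boundary, the interior
faces and again the interior faces (\<open>energy_identity\<close>). All three terms vanish. Two affine functions
that agree on a hyperplane and have the same normal derivative there are equal, so \<open>u\<close> is given by
the same affine function on any two elements that share a face (\<open>pieces_agree_across_face\<close>). As a
connected open set remains connected when parts of codimension 2 are removed, any two elements are
joined by a chain through faces, and \<open>u\<close> is a single affine function (\<open>face_connected\<close>). It vanishes
on the boundary of a bounded domain, hence everywhere (\<open>affine_zero_AE_on_frontier\<close>). The equation
then reduces to orthogonality of \<open>\<sigma>\<close> to all test functions, and \<open>\<sigma> = 0\<close>.

The rest is measure theory. The integrals over faces and over the boundary are with respect to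
Hausdorff measure. For them to be sesquilinear and definite, three facts are needed: the Hausdorff
outer measure is a measure on the Borel sets (\<open>hausdorff_outer_measure_space\<close>, by Caratheodory's
criterion), bounded parts of hyperplanes have finite measure
(\<open>hausdorff_outer_bounded_hyperplane_finite\<close>), and null sets are small enough for a function that
vanishes almost everywhere on a face, or on the boundary, to be controlled. For the last, the
cylinder over a null set in a coordinate direction is Lebesgue negligible (\<open>negligible_cylinder\<close>),
whereas the cylinder over a face transversal to that direction is not, nor is any nonempty open set.
Outward normals almost everywhere, part of the assumption on the star shape, ensure that the boundary
has finite surface measure.
\<close>

section \<open>Hausdorff measure\<close>

definition diameter_cost :: "real \<Rightarrow> 'a::metric_space set \<Rightarrow> ennreal" where
  "diameter_cost s C = ennreal (unit_ball_vol s * (diameter C / 2) powr s)"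

definition fine_covers :: "real \<Rightarrow> 'a::metric_space set \<Rightarrow> (nat \<Rightarrow> 'a set) set" where
  "fine_covers \<epsilon> A = {C. (\<forall>i. bounded (C i) \<and> diameter (C i) \<le> \<epsilon>) \<and> A \<subseteq> (\<Union>i. C i)}"

text \<open>The size \<open>\<epsilon>\<close> approximation of the Hausdorff outer measure, which is its supremum over
  \<open>\<epsilon> > 0\<close>.\<close>

definition hausdorff_content :: "real \<Rightarrow> real \<Rightarrow> 'a::metric_space set \<Rightarrow> ennreal" where
  "hausdorff_content s \<epsilon> A = (INF C\<in>fine_covers \<epsilon> A. \<Sum>i. diameter_cost s (C i))"

lemma hausdorff_outer_eq_SUP_content:
  "hausdorff_outer s A = (SUP \<epsilon>\<in>{0<..}. hausdorff_content s \<epsilon> A)"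
  unfolding hausdorff_outer_def hausdorff_content_def fine_covers_def diameter_cost_def ..

lemma diameter_cost_empty [simp]: "diameter_cost s {} = 0"
  by (simp add: diameter_cost_def)

lemma diameter_cost_mono:
  assumes "A \<subseteq> B" "bounded B" "0 \<le> s"
  shows "diameter_cost s A \<le> diameter_cost s B"
  unfolding diameter_cost_def
  using assms diameter_subset[of A B] diameter_ge_0[of A] bounded_subset[of B A]
  by (intro ennreal_leI mult_left_mono powr_mono2) auto

lemma hausdorff_content_le:
  "C \<in> fine_covers \<epsilon> A \<Longrightarrow> hausdorff_content s \<epsilon> A \<le> (\<Sum>i. diameter_cost s (C i))"
  unfolding hausdorff_content_def by (rule INF_lower)

lemma hausdorff_content_near_cover:
  assumes "hausdorff_content s \<epsilon> A < b"
  shows "\<exists>C\<in>fine_covers \<epsilon> A. (\<Sum>i. diameter_cost s (C i)) < b"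
  using assms unfolding hausdorff_content_def INF_less_iff by auto

lemma hausdorff_content_le_outer:
  "\<epsilon> > 0 \<Longrightarrow> hausdorff_content s \<epsilon> A \<le> hausdorff_outer s A"
  unfolding hausdorff_outer_eq_SUP_content by (rule SUP_upper) simp

lemma hausdorff_content_antimono:
  "\<epsilon> \<le> \<epsilon>' \<Longrightarrow> hausdorff_content s \<epsilon>' A \<le> hausdorff_content s \<epsilon> A"
  unfolding hausdorff_content_def fine_covers_def
  by (rule INF_superset_mono) (auto intro: order_trans)

lemma hausdorff_outer_mono:
  "A \<subseteq> B \<Longrightarrow> hausdorff_outer s A \<le> hausdorff_outer s B"
  unfolding hausdorff_outer_eq_SUP_content hausdorff_content_def fine_covers_def
  by (rule SUP_mono, rule bexI, rule INF_superset_mono) auto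

lemma hausdorff_outer_empty [simp]: "hausdorff_outer s {} = 0"
proof -
  have "hausdorff_content s \<epsilon> {} \<le> 0" if "\<epsilon> > 0" for \<epsilon> :: real
    using hausdorff_content_le[of "\<lambda>_. {}" \<epsilon> "{}" s] that by (auto simp: fine_covers_def)
  then show ?thesis
    unfolding hausdorff_outer_eq_SUP_content
    by (intro antisym SUP_least) auto
qed

text \<open>Covers of the sets \<open>A n\<close> that are optimal up to \<open>e / 2 ^ (n + 1)\<close> combine to a cover of the
  union that is optimal up to \<open>e\<close>.\<close>

lemma hausdorff_content_subadditive:
  "hausdorff_content s \<epsilon> (\<Union>n::nat. A n) \<le> (\<Sum>n. hausdorff_content s \<epsilon> (A n))"
proof (rule ennreal_le_epsilon)
  fix e :: real assume fin: "(\<Sum>n. hausdorff_content s \<epsilon> (A n)) < top" and e: "0 < e"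
  have "\<exists>C\<in>fine_covers \<epsilon> (A n). (\<Sum>i. diameter_cost s (C i))
      < hausdorff_content s \<epsilon> (A n) + ennreal (e * (1/2) ^ Suc n)" for n
  proof (rule hausdorff_content_near_cover)
    have "hausdorff_content s \<epsilon> (A n) < top"
      using fin by (rule ennreal_suminf_lessD)
    moreover have "0 < ennreal (e * (1/2) ^ Suc n)" using e by simp
    ultimately show "hausdorff_content s \<epsilon> (A n)
        < hausdorff_content s \<epsilon> (A n) + ennreal (e * (1/2) ^ Suc n)"
      by (cases "hausdorff_content s \<epsilon> (A n)")
        (use e in \<open>auto simp flip: ennreal_plus intro!: ennreal_lessI add_nonneg_pos\<close>)
  qed
  then obtain C where C: "\<And>n. C n \<in> fine_covers \<epsilon> (A n)"
    and le: "\<And>n. (\<Sum>i. diameter_cost s (C n i))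
      < hausdorff_content s \<epsilon> (A n) + ennreal (e * (1/2) ^ Suc n)"
    by metis
  have cover: "(\<lambda>i. case prod_decode i of (n, m) \<Rightarrow> C n m) \<in> fine_covers \<epsilon> (\<Union>n. A n)"
    unfolding fine_covers_def
  proof (intro CollectI conjI allI subsetI)
    fix x assume "x \<in> (\<Union>n. A n)"
    then obtain n m where "x \<in> C n m" using C unfolding fine_covers_def by blast
    then show "x \<in> (\<Union>i. case prod_decode i of (n, m) \<Rightarrow> C n m)"
      by (intro UN_I[of "prod_encode (n, m)"]) auto
  qed (use C in \<open>auto simp: fine_covers_def split: prod.split\<close>)
  have "hausdorff_content s \<epsilon> (\<Union>n. A n)
      \<le> (\<Sum>i. diameter_cost s (case prod_decode i of (n, m) \<Rightarrow> C n m))"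
    by (rule hausdorff_content_le[OF cover])
  also have "\<dots> = (\<Sum>i. (\<lambda>(n, m). diameter_cost s (C n m)) (prod_decode i))"
    by (intro suminf_cong) (auto split: prod.split)
  also have "\<dots> = (\<Sum>n. \<Sum>m. diameter_cost s (C n m))"
    by (rule suminf_ennreal_2dimen) simp
  also have "\<dots> \<le> (\<Sum>n. hausdorff_content s \<epsilon> (A n) + ennreal (e * (1/2) ^ Suc n))"
    using le by (intro suminf_le) (auto intro: less_imp_le)
  also have "\<dots> = (\<Sum>n. hausdorff_content s \<epsilon> (A n)) + (\<Sum>n. ennreal (e * (1/2) ^ Suc n))"
    by (rule suminf_add[symmetric]) auto
  also have "(\<Sum>n. ennreal (e * (1/2) ^ Suc n)) = ennreal e"
    using sums_mult[OF power_half_series, of e] e by (intro suminf_ennreal_eq) auto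
  finally show "hausdorff_content s \<epsilon> (\<Union>n. A n) \<le> (\<Sum>n. hausdorff_content s \<epsilon> (A n)) + ennreal e" .
qed

lemma hausdorff_outer_subadditive:
  "hausdorff_outer s (\<Union>n::nat. A n) \<le> (\<Sum>n. hausdorff_outer s (A n))"
proof -
  have "hausdorff_content s \<epsilon> (\<Union>n. A n) \<le> (\<Sum>n. hausdorff_outer s (A n))" if "\<epsilon> > 0" for \<epsilon>
    using that
    by (intro order_trans[OF hausdorff_content_subadditive] suminf_le hausdorff_content_le_outer) auto
  then show ?thesis
    unfolding hausdorff_outer_eq_SUP_content[of s "\<Union>n. A n"] by (intro SUP_least) auto
qed

text \<open>A set of diameter less than the distance of two sets cannot meet both, so a fine cover of the
  union splits into a cover of each.\<close>

lemma hausdorff_outer_separated: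
  assumes s: "0 \<le> s" and r: "0 < r" and sep: "\<And>x y. x \<in> A \<Longrightarrow> y \<in> B \<Longrightarrow> r \<le> dist x y"
  shows "hausdorff_outer s A + hausdorff_outer s B \<le> hausdorff_outer s (A \<union> B)"
proof -
  have split: "hausdorff_content s \<epsilon> A + hausdorff_content s \<epsilon> B \<le> hausdorff_content s \<epsilon> (A \<union> B)"
    if "\<epsilon> < r" for \<epsilon>
    unfolding hausdorff_content_def[of s \<epsilon> "A \<union> B"]
  proof (rule INF_greatest)
    fix C assume C: "C \<in> fine_covers \<epsilon> (A \<union> B)"
    then have bdd: "bounded (C i)" and diam: "diameter (C i) \<le> \<epsilon>" for i
      by (auto simp: fine_covers_def)
    have part: "(\<lambda>i. C i \<inter> X) \<in> fine_covers \<epsilon> X" if "X \<subseteq> A \<union> B" for X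
      unfolding fine_covers_def
    proof (intro CollectI conjI allI)
      show "bounded (C i \<inter> X)" for i using bdd by blast
      show "diameter (C i \<inter> X) \<le> \<epsilon>" for i
        using diameter_subset[of "C i \<inter> X" "C i"] bdd[of i] diam[of i] by auto
      show "X \<subseteq> (\<Union>i. C i \<inter> X)" using C that unfolding fine_covers_def by blast
    qed
    have "diameter_cost s (C i \<inter> A) + diameter_cost s (C i \<inter> B) \<le> diameter_cost s (C i)" for i
    proof -
      have "C i \<inter> A = {} \<or> C i \<inter> B = {}"
      proof (rule ccontr)
        assume "\<not> ?thesis"
        then obtain x y where "x \<in> C i \<inter> A" "y \<in> C i \<inter> B" by auto
        then have "r \<le> dist x y" "dist x y \<le> diameter (C i)"
          using sep diameter_bounded_bound[OF bdd] by auto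
        then show False using diam[of i] \<open>\<epsilon> < r\<close> by linarith
      qed
      then show ?thesis
        using diameter_cost_mono[OF _ bdd s, of "C i \<inter> A" i]
          diameter_cost_mono[OF _ bdd s, of "C i \<inter> B" i] by auto
    qed
    then have "(\<Sum>i. diameter_cost s (C i \<inter> A)) + (\<Sum>i. diameter_cost s (C i \<inter> B))
        \<le> (\<Sum>i. diameter_cost s (C i))"
      by (subst suminf_add) (auto intro!: suminf_le)
    moreover have "hausdorff_content s \<epsilon> A \<le> (\<Sum>i. diameter_cost s (C i \<inter> A))"
      and "hausdorff_content s \<epsilon> B \<le> (\<Sum>i. diameter_cost s (C i \<inter> B))"
      by (intro hausdorff_content_le part; blast)+
    ultimately show "hausdorff_content s \<epsilon> A + hausdorff_content s \<epsilon> B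
        \<le> (\<Sum>i. diameter_cost s (C i))"
      by (meson add_mono order_trans)
  qed
  have le: "hausdorff_content s \<epsilon> A + hausdorff_content s \<epsilon>' B \<le> hausdorff_outer s (A \<union> B)"
    if "\<epsilon> > 0" "\<epsilon>' > 0" for \<epsilon> \<epsilon>'
  proof -
    define \<eta> where "\<eta> = min (r / 2) (min \<epsilon> \<epsilon>')"
    have \<eta>: "0 < \<eta>" "\<eta> < r" "\<eta> \<le> \<epsilon>" "\<eta> \<le> \<epsilon>'" using that r by (auto simp: \<eta>_def)
    have "hausdorff_content s \<epsilon> A + hausdorff_content s \<epsilon>' B
        \<le> hausdorff_content s \<eta> A + hausdorff_content s \<eta> B"
      using \<eta> by (intro add_mono hausdorff_content_antimono) auto
    also have "\<dots> \<le> hausdorff_content s \<eta> (A \<union> B)" by (rule split) (rule \<eta>)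
    also have "\<dots> \<le> hausdorff_outer s (A \<union> B)" using \<eta> by (intro hausdorff_content_le_outer)
    finally show ?thesis .
  qed
  have "hausdorff_content s \<epsilon> A + hausdorff_outer s B \<le> hausdorff_outer s (A \<union> B)"
    if "\<epsilon> > 0" for \<epsilon>
    unfolding hausdorff_outer_eq_SUP_content[of s B]
    using le[OF that] by (subst ennreal_SUP_add_right) (auto intro!: SUP_least)
  then show ?thesis
    unfolding hausdorff_outer_eq_SUP_content[of s A]
    by (subst ennreal_SUP_add_left[symmetric]) (auto intro!: SUP_least)
qed

text \<open>Caratheodory's criterion. The set \<open>A - F\<close> is exhausted by the sets \<open>G n\<close> of its points at
  distance at least \<open>1 / (n + 1)\<close> from \<open>F\<close>; these are separated from \<open>F\<close>, and what they miss is made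
  of the shells \<open>R k\<close> with \<open>k \<ge> n\<close>. Shells whose indices differ by at least 2 are separated,
  so the measures of the shells form a convergent series, the tails of which tend to 0.\<close>

lemma metric_outer_measure_splits_along_closed:
  fixes \<mu> :: "'a::metric_space set \<Rightarrow> ennreal"
  assumes empty: "\<mu> {} = 0"
    and mono: "\<And>A B. A \<subseteq> B \<Longrightarrow> \<mu> A \<le> \<mu> B"
    and csub: "\<And>A. \<mu> (\<Union>n::nat. A n) \<le> (\<Sum>n. \<mu> (A n))"
    and separated: "\<And>A B r. 0 < r \<Longrightarrow> (\<And>x y. x \<in> A \<Longrightarrow> y \<in> B \<Longrightarrow> r \<le> dist x y) \<Longrightarrow>
      \<mu> A + \<mu> B \<le> \<mu> (A \<union> B)"
    and F: "closed F"
  shows "\<mu> (A \<inter> F) + \<mu> (A - F) \<le> \<mu> A"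
proof (cases "F = {} \<or> \<mu> A = top")
  case True
  then show ?thesis by (auto simp: empty top_unique)
next
  case False
  then have F0: "F \<noteq> {}" and fin: "\<mu> A \<noteq> top" by auto
  define a where "a n = 1 / (real n + 1)" for n
  define G where "G n = {x\<in>A. a n \<le> infdist x F}" for n
  define R where "R n = {x\<in>A. a (Suc n) \<le> infdist x F \<and> infdist x F < a n}" for n
  have a_anti: "a n \<le> a m" if "m \<le> n" for m n
    using that by (auto simp: a_def field_simps)
  have a_pos: "0 < a n" for n by (simp add: a_def)
  have a_less: "a (Suc n) < a n" for n by (auto simp: a_def field_simps)
  have far: "infdist x F - infdist y F \<le> dist x y" for x y :: 'a
    using infdist_triangle[of x F y] by linarith
  have shells: "(\<Sum>k<n. \<mu> (R (2 * k + p))) \<le> \<mu> (A \<inter> (\<Union>k<n. R (2 * k + p)))" for n p :: nat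
  proof (induction n)
    case 0
    then show ?case by (simp add: empty)
  next
    case (Suc n)
    let ?U = "A \<inter> (\<Union>k<n. R (2 * k + p))"
    have "\<mu> ?U + \<mu> (R (2 * n + p)) \<le> \<mu> (?U \<union> R (2 * n + p))"
    proof (cases n)
      case 0
      then show ?thesis by (simp add: empty)
    next
      case (Suc m)
      show ?thesis
      proof (rule separated)
        show "0 < a (2 * m + p + 1) - a (2 * n + p)"
          using a_less[of "2 * m + p + 1"] by (simp add: Suc)
        fix x y assume x: "x \<in> ?U" and y: "y \<in> R (2 * n + p)"
        from x obtain k where k: "k < n" "x \<in> R (2 * k + p)" by auto
        then have "a (2 * m + p + 1) \<le> infdist x F"
          using a_anti[of "Suc (2 * k + p)" "2 * m + p + 1"] by (auto simp: R_def Suc)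
        moreover have "infdist y F < a (2 * n + p)" using y by (auto simp: R_def)
        ultimately show "a (2 * m + p + 1) - a (2 * n + p) \<le> dist x y" using far[of x y] by linarith
      qed
    qed
    also have "?U \<union> R (2 * n + p) \<subseteq> A \<inter> (\<Union>k<Suc n. R (2 * k + p))"
      by (auto simp: R_def less_Suc_eq)
    then have "\<mu> (?U \<union> R (2 * n + p)) \<le> \<mu> (A \<inter> (\<Union>k<Suc n. R (2 * k + p)))" by (rule mono)
    finally show ?case using Suc by (auto intro: order_trans add_mono)
  qed
  have shells_A: "(\<Sum>k<n. \<mu> (R (2 * k + p))) \<le> \<mu> A" for n p
    using shells[of p n] mono[of "A \<inter> (\<Union>k<n. R (2 * k + p))" A] by (auto intro: order_trans)
  have even_odd: "(\<Sum>k<2 * n. \<mu> (R k)) = (\<Sum>k<n. \<mu> (R (2 * k + 0))) + (\<Sum>k<n. \<mu> (R (2 * k + 1)))" for n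
    by (induction n) (auto simp: algebra_simps)
  have partial: "(\<Sum>k<n. \<mu> (R k)) \<le> \<mu> A + \<mu> A" for n
  proof -
    have "(\<Sum>k<n. \<mu> (R k)) \<le> (\<Sum>k<2 * n. \<mu> (R k))" by (rule sum_mono2) auto
    also have "\<dots> \<le> \<mu> A + \<mu> A" unfolding even_odd by (intro add_mono shells_A)
    finally show ?thesis .
  qed
  define S where "S = (\<Sum>k. \<mu> (R k))"
  have "S \<le> \<mu> A + \<mu> A" unfolding S_def by (rule suminf_le_const) (auto intro: partial)
  then have S_fin: "S \<noteq> top" using fin by (auto simp: top_unique)
  have tail: "(\<Sum>k. \<mu> (R (k + n))) = S - (\<Sum>k<n. \<mu> (R k))" for n
  proof -
    have "S = (\<Sum>k. \<mu> (R (k + n))) + (\<Sum>k<n. \<mu> (R k))"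
      unfolding S_def by (rule suminf_offset) simp
    moreover have "(\<Sum>k<n. \<mu> (R k)) \<noteq> top"
      using partial[of n] fin by (metis ennreal_add_eq_top top_unique)
    ultimately show ?thesis by simp
  qed
  have "(\<lambda>n. S - (\<Sum>k<n. \<mu> (R k))) \<longlonglongrightarrow> S - S"
    using S_fin unfolding S_def by (intro tendsto_diff_ennreal tendsto_const summable_LIMSEQ) auto
  then have tail_0: "(\<lambda>n. \<Sum>k. \<mu> (R (k + n))) \<longlonglongrightarrow> 0"
    using S_fin by (simp add: tail)
  have bound: "\<mu> (A \<inter> F) + \<mu> (A - F) \<le> \<mu> A + (\<Sum>k. \<mu> (R (k + n)))" for n
  proof -
    define D where "D i = (case i of 0 \<Rightarrow> G n | Suc k \<Rightarrow> R (k + n))" for i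
    have "A - F \<subseteq> (\<Union>i. D i)"
    proof
      fix x assume x: "x \<in> A - F"
      then have pos: "0 < infdist x F"
        using in_closed_iff_infdist_zero[OF F F0, of x] infdist_nonneg[of x F] by force
      show "x \<in> (\<Union>i. D i)"
      proof (cases "a n \<le> infdist x F")
        case True
        then show ?thesis using x by (intro UN_I[of 0]) (auto simp: D_def G_def)
      next
        case False
        obtain N where N: "inverse (real (Suc N)) < infdist x F" using reals_Archimedean[OF pos] by blast
        then have "a N \<le> infdist x F" by (simp add: a_def field_simps)
        define m where "m = (LEAST m. a m \<le> infdist x F)"
        have m: "a m \<le> infdist x F" unfolding m_def by (rule LeastI[of _ N]) fact
        have "n < m" using False m a_anti[of m n] by (meson leI order_trans)
        then obtain k where k: "m = Suc (k + n)"
          by (metis add.commute less_imp_Suc_add)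
        have "\<not> a (k + n) \<le> infdist x F"
          using not_less_Least[of "k + n" "\<lambda>m. a m \<le> infdist x F"] k m_def by auto
        then have "x \<in> R (k + n)" using x m k by (auto simp: R_def)
        then show ?thesis by (intro UN_I[of "Suc k"]) (auto simp: D_def)
      qed
    qed
    then have "\<mu> (A - F) \<le> (\<Sum>i. \<mu> (D i))" using mono csub by (meson order_trans)
    also have "\<dots> = (\<Sum>k. \<mu> (D (k + 1))) + (\<Sum>k<1. \<mu> (D k))" by (rule suminf_offset) simp
    also have "\<dots> = \<mu> (G n) + (\<Sum>k. \<mu> (R (k + n)))" by (simp add: D_def add.commute)
    finally have "\<mu> (A \<inter> F) + \<mu> (A - F) \<le> (\<mu> (A \<inter> F) + \<mu> (G n)) + (\<Sum>k. \<mu> (R (k + n)))"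
      by (simp add: add.assoc add_left_mono)
    also have "\<mu> (A \<inter> F) + \<mu> (G n) \<le> \<mu> (A \<inter> F \<union> G n)"
    proof (rule separated[OF a_pos[of n]])
      fix x y assume "x \<in> A \<inter> F" "y \<in> G n"
      then show "a n \<le> dist x y" using infdist_le[of x F y] by (auto simp: G_def dist_commute)
    qed
    also have "\<mu> (A \<inter> F \<union> G n) \<le> \<mu> A" by (rule mono) (auto simp: G_def)
    finally show ?thesis by (meson add_right_mono order_trans)
  qed
  have "(\<lambda>n. \<mu> A + (\<Sum>k. \<mu> (R (k + n)))) \<longlonglongrightarrow> \<mu> A + 0"
    by (intro tendsto_add tendsto_const tail_0)
  then show ?thesis using bound by (auto intro: LIMSEQ_le_const)
qed

text \<open>Countable additivity matters beyond its own sake: the measure generated by a set function that is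
  not a measure is the zero measure by convention, so this is what ties the values of
  \<open>hausdorff_measure\<close> to covers.\<close>

lemma hausdorff_outer_measure_space:
  assumes s: "0 \<le> s"
  shows "measure_space UNIV (sets borel) (hausdorff_outer s :: 'a::metric_space set \<Rightarrow> ennreal)"
proof -
  let ?h = "hausdorff_outer s :: 'a set \<Rightarrow> ennreal"
  interpret P: sigma_algebra "UNIV :: 'a set" "Pow UNIV" by (rule sigma_algebra_Pow)
  have oms: "outer_measure_space (Pow UNIV) ?h"
    unfolding outer_measure_space_def positive_def increasing_def countably_subadditive_def
    by (auto intro: hausdorff_outer_mono hausdorff_outer_subadditive)
  have L: "measure_space UNIV (lambda_system UNIV (Pow UNIV) ?h) ?h"
    using oms by (rule P.caratheodory_lemma)
  then interpret L: sigma_algebra UNIV "lambda_system UNIV (Pow UNIV) ?h"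
    by (simp add: measure_space_def)
  have closed: "F \<in> lambda_system UNIV (Pow UNIV) ?h" if "closed F" for F
  proof -
    have "?h (A \<inter> F) + ?h (A - F) = ?h A" for A
    proof (rule antisym)
      show "?h (A \<inter> F) + ?h (A - F) \<le> ?h A"
        by (rule metric_outer_measure_splits_along_closed[OF hausdorff_outer_empty
              hausdorff_outer_mono hausdorff_outer_subadditive hausdorff_outer_separated[OF s] that])
      define D where "D n = (if n = 0 then A \<inter> F else if n = 1 then A - F else {})" for n :: nat
      have "?h A \<le> ?h (\<Union>n. D n)"
        by (rule hausdorff_outer_mono) (auto simp: D_def split: if_splits)
      also have "\<dots> \<le> (\<Sum>n. ?h (D n))" by (rule hausdorff_outer_subadditive)
      also have "\<dots> = (\<Sum>n\<in>{0,1}. ?h (D n))"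
        by (rule suminf_finite) (auto simp: D_def)
      also have "\<dots> = ?h (A \<inter> F) + ?h (A - F)" by (simp add: D_def)
      finally show "?h A \<le> ?h (A \<inter> F) + ?h (A - F)" .
    qed
    then show ?thesis unfolding P.lambda_system_eq by blast
  qed
  have "sigma_sets UNIV (Collect closed) \<subseteq> lambda_system UNIV (Pow UNIV) ?h"
    by (rule L.sigma_sets_subset) (use closed in blast)
  then have "sets borel \<subseteq> lambda_system UNIV (Pow UNIV) ?h"
    unfolding borel_eq_closed by (subst sets_measure_of) auto
  then show ?thesis
    using L sets.sigma_algebra_axioms[of "borel :: 'a measure"]
    unfolding measure_space_def countably_additive_def positive_def by auto
qed

lemma sets_hausdorff_measure [simp, measurable_cong]: "sets (hausdorff_measure s :: 'a::metric_space measure) = sets borel"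
  unfolding hausdorff_measure_def
  using sets.sigma_sets_eq[of "borel :: 'a measure"] by (simp add: sets_measure_of)

lemma space_hausdorff_measure [simp]: "space (hausdorff_measure s) = UNIV"
  by (simp add: hausdorff_measure_def)

lemma emeasure_hausdorff_measure:
  assumes "0 \<le> s" "A \<in> sets borel"
  shows "emeasure (hausdorff_measure s) A = hausdorff_outer s A"
  unfolding hausdorff_measure_def using hausdorff_outer_measure_space[OF assms(1)] assms(2)
  by (intro emeasure_measure_of_sigma) (auto simp: measure_space_def)

section \<open>Surface measure and Lebesgue measure\<close>

lemma hausdorff_content_le_finite_cover:
  assumes I: "finite I" and S: "S \<subseteq> (\<Union>k\<in>I. C k)" and \<epsilon>: "0 \<le> \<epsilon>"
    and C: "\<And>k. k \<in> I \<Longrightarrow> bounded (C k) \<and> diameter (C k) \<le> \<epsilon>"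
  shows "hausdorff_content s \<epsilon> S \<le> (\<Sum>k\<in>I. diameter_cost s (C k))"
proof -
  obtain h where h: "bij_betw h {0..<card I} I" using ex_bij_betw_nat_finite[OF I] by blast
  define D where "D i = (if i < card I then C (h i) else {})" for i
  have D_I: "h i \<in> I" if "i < card I" for i using h that by (auto simp: bij_betw_def)
  have "D \<in> fine_covers \<epsilon> S"
    unfolding fine_covers_def
  proof (intro CollectI conjI allI subsetI)
    fix x assume "x \<in> S"
    then obtain k where k: "k \<in> I" "x \<in> C k" using S by blast
    then have "k \<in> h ` {0..<card I}" using h by (simp add: bij_betw_def)
    then obtain i where "i < card I" "h i = k" by auto
    then show "x \<in> (\<Union>i. D i)" using k by (auto simp: D_def)
  qed (use C D_I \<epsilon> in \<open>auto simp: D_def\<close>)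
  then have "hausdorff_content s \<epsilon> S \<le> (\<Sum>i. diameter_cost s (D i))"
    by (rule hausdorff_content_le)
  also have "\<dots> = (\<Sum>i\<in>{0..<card I}. diameter_cost s (D i))"
    by (rule suminf_finite) (auto simp: D_def)
  also have "\<dots> = (\<Sum>i\<in>{0..<card I}. diameter_cost s (C (h i)))"
    by (rule sum.cong) (auto simp: D_def)
  also have "\<dots> = (\<Sum>k\<in>I. diameter_cost s (C k))"
    by (rule sum.reindex_bij_betw[OF h])
  finally show ?thesis .
qed

lemma diameter_cost_codim1:
  assumes "2 \<le> CARD('d)" "bounded C"
  shows "diameter_cost (real CARD('d::finite) - 1) C
    = ennreal (unit_ball_vol (real CARD('d) - 1) * (diameter C / 2) ^ (CARD('d) - 1))"
proof -
  have "real CARD('d) - 1 = real (CARD('d) - 1)" using assms by (simp add: of_nat_diff)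
  then have "(diameter C / 2) powr (real CARD('d) - 1) = (diameter C / 2) ^ (CARD('d) - 1)"
    using assms diameter_ge_0[of C] powr_realpow'[of "diameter C / 2" "CARD('d) - 1"] by simp
  then show ?thesis by (simp add: diameter_cost_def)
qed

text \<open>The union of the lines parallel to the axis \<open>j\<close> through \<open>N\<close>. Its Lebesgue measure in full
  dimension stands in for that of the projection of \<open>N\<close> along this axis, which would live in a
  space of lower dimension.\<close>

definition cylinder :: "'d \<Rightarrow> (real^'d) set \<Rightarrow> (real^'d) set" where
  "cylinder j N = {x. \<exists>y\<in>N. \<forall>i. i \<noteq> j \<longrightarrow> x $ i = y $ i}"

text \<open>In the slab \<open>\<bar>x $ j\<bar> \<le> m\<close>, the cylinder over a set of diameter \<open>D\<close> is covered by a box of volume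
  \<open>(2 * D) ^ (d - 1) * 2 * m\<close>, a fixed multiple of the cost of the set.\<close>

lemma negligible_cylinder:
  fixes N :: "(real^'d) set"
  assumes d: "2 \<le> CARD('d)" and N: "hausdorff_outer (real CARD('d) - 1) N = 0"
  shows "negligible (cylinder j N)"
proof -
  let ?s = "real CARD('d) - 1" and ?n = "CARD('d) - 1"
  have \<omega>: "0 < unit_ball_vol ?s" using d by (intro unit_ball_vol_pos) auto
  have slab: "negligible (cylinder j N \<inter> {x. \<bar>x $ j\<bar> \<le> real m})" for m :: nat
    unfolding negligible_outer_le
  proof (intro allI impI)
    fix e :: real assume e: "0 < e"
    define K where "K = 4 ^ ?n * (2 * real m) / unit_ball_vol ?s"
    have K: "0 \<le> K" using \<omega> by (simp add: K_def)
    define \<eta> where "\<eta> = e / (K + 1)"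
    have \<eta>: "0 < \<eta>" using K e by (simp add: \<eta>_def)
    have "hausdorff_content ?s 1 N < ennreal \<eta>"
      using hausdorff_content_le_outer[of 1 ?s N] N \<eta> by simp
    then obtain C where C: "C \<in> fine_covers 1 N"
      and cost: "(\<Sum>i. diameter_cost ?s (C i)) < ennreal \<eta>"
      using hausdorff_content_near_cover by blast
    define z where "z i = (SOME z. z \<in> C i)" for i
    define R where "R i = (\<chi> a. if a = j then real m else diameter (C i))" for i
    define p where "p i = (\<chi> a. if a = j then 0 else z i $ a)" for i
    define B where "B i = (if C i = {} then {} else cbox (p i - R i) (p i + R i))" for i
    have diam: "0 \<le> diameter (C i)" for i using C by (auto simp: fine_covers_def intro: diameter_ge_0)
    have z: "z i \<in> C i" if "C i \<noteq> {}" for i unfolding z_def using that by (simp add: some_in_eq)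
    have "cylinder j N \<inter> {x. \<bar>x $ j\<bar> \<le> real m} \<subseteq> (\<Union>i. B i)"
    proof
      fix x assume "x \<in> cylinder j N \<inter> {x. \<bar>x $ j\<bar> \<le> real m}"
      then obtain y where y: "y \<in> N" "\<And>i. i \<noteq> j \<Longrightarrow> x $ i = y $ i" and xj: "\<bar>x $ j\<bar> \<le> real m"
        by (auto simp: cylinder_def)
      from y(1) C obtain i where i: "y \<in> C i" by (auto simp: fine_covers_def)
      have "\<bar>y $ a - z i $ a\<bar> \<le> diameter (C i)" for a
      proof -
        have "\<bar>y $ a - z i $ a\<bar> \<le> norm (y - z i)" using component_le_norm_cart[of "y - z i" a] by simp
        also have "\<dots> \<le> diameter (C i)"
          using diameter_bounded_bound[of "C i" y "z i"] C i z[of i]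
          by (auto simp: fine_covers_def dist_norm)
        finally show ?thesis .
      qed
      then have "\<bar>x $ a - p i $ a\<bar> \<le> R i $ a" for a
        using xj y(2)[of a] by (cases "a = j") (simp_all add: p_def R_def)
      then have "x \<in> B i"
        using i unfolding B_def by (auto simp: mem_box_cart abs_le_iff algebra_simps)
      then show "x \<in> (\<Union>i. B i)" by blast
    qed
    moreover have B_meas: "B i \<in> sets lborel" for i by (simp add: B_def)
    have B_vol: "emeasure lborel (B i) \<le> ennreal K * diameter_cost ?s (C i)" for i
    proof (cases "C i = {}")
      case True
      then show ?thesis by (simp add: B_def)
    next
      case False
      have ne: "cbox (p i - R i) (p i + R i) \<noteq> {}"
        using diam[of i] by (intro ex_in_conv[THEN iffD1] exI[of _ "p i"]) (auto simp: mem_box_cart R_def)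
      have "measure lborel (cbox (p i - R i) (p i + R i)) = (\<Prod>a\<in>UNIV. 2 * R i $ a)"
        unfolding content_cbox_cart[OF ne] by (intro prod.cong) auto
      also have "\<dots> = 2 * R i $ j * (\<Prod>a\<in>UNIV-{j}. 2 * R i $ a)"
        by (rule prod.remove) auto
      also have "(\<Prod>a\<in>UNIV-{j}. 2 * R i $ a) = (\<Prod>a\<in>UNIV-{j}. 2 * diameter (C i))"
        by (rule prod.cong) (auto simp: R_def)
      also have "\<dots> = (2 * diameter (C i)) ^ ?n" by (simp add: card_Diff_singleton)
      also have "2 * R i $ j * (2 * diameter (C i)) ^ ?n
          = K * (unit_ball_vol ?s * (diameter (C i) / 2) ^ ?n)"
        using less_imp_neq[OF \<omega>] power_mult_distrib[of 4 "diameter (C i) / 2" ?n] by (simp add: K_def R_def)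
      finally have "emeasure lborel (B i) = ennreal (K * (unit_ball_vol ?s * (diameter (C i) / 2) ^ ?n))"
        using False emeasure_eq_ennreal_measure[of lborel "cbox (p i - R i) (p i + R i)"]
          emeasure_lborel_cbox_finite[of "p i - R i" "p i + R i"]
        by (simp add: B_def)
      then show ?thesis
        using K C by (subst diameter_cost_codim1[OF d]) (auto simp: fine_covers_def ennreal_mult')
    qed
    define T where "T = (\<Union>i. B i)"
    have T: "emeasure lborel T \<le> ennreal e"
    proof -
      have "emeasure lborel T \<le> (\<Sum>i. emeasure lborel (B i))"
        unfolding T_def using B_meas by (intro emeasure_subadditive_countably) auto
      also have "\<dots> \<le> (\<Sum>i. ennreal K * diameter_cost ?s (C i))"
        by (intro suminf_le B_vol) auto
      also have "\<dots> = ennreal K * (\<Sum>i. diameter_cost ?s (C i))" by simp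
      also have "\<dots> \<le> ennreal K * ennreal \<eta>" using cost by (intro mult_left_mono) auto
      also have "\<dots> = ennreal (K * \<eta>)" using K \<eta> by (simp add: ennreal_mult')
      also have "\<dots> \<le> ennreal e" using K e by (intro ennreal_leI) (simp add: \<eta>_def field_simps)
      finally show ?thesis .
    qed
    have T_sets: "T \<in> sets lborel" using B_meas unfolding T_def by blast
    have "T \<in> lmeasurable"
      using T T_sets unfolding fmeasurable_def
      by (auto simp: le_less_trans[OF _ ennreal_less_top])
    moreover have "measure lebesgue T \<le> e"
      using T T_sets e unfolding measure_def by (simp add: enn2real_leI)
    ultimately show "\<exists>T. cylinder j N \<inter> {x. \<bar>x $ j\<bar> \<le> real m} \<subseteq> T \<and> T \<in> lmeasurable \<and> measure lebesgue T \<le> e"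
      unfolding T_def by blast
  qed
  have "negligible (\<Union>m::nat. cylinder j N \<inter> {x. \<bar>x $ j\<bar> \<le> real m})"
    by (rule negligible_countable_Union) (use slab in auto)
  moreover have "cylinder j N \<subseteq> (\<Union>m::nat. cylinder j N \<inter> {x. \<bar>x $ j\<bar> \<le> real m})"
    using real_arch_simple by fastforce
  ultimately show ?thesis by (rule negligible_subset)
qed

text \<open>A hyperplane is the graph of a Lipschitz function of all coordinates but one. A grid of width
  \<open>1 / N\<close> in those \<open>d - 1\<close> coordinates cuts the set into at most a multiple of \<open>N ^ (d - 1)\<close> cells of
  diameter at most a multiple of \<open>1 / N\<close>, so that the cost of this cover is bounded
  independently of \<open>N\<close>.\<close>

lemma hausdorff_outer_bounded_hyperplane_finite:
  fixes S :: "(real^'d) set"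
  assumes d: "2 \<le> CARD('d)" and S: "bounded S" and hyp: "\<And>x. x \<in> S \<Longrightarrow> \<nu> \<bullet> x = c" and \<nu>: "\<nu> \<noteq> 0"
  shows "hausdorff_outer (real CARD('d) - 1) S < top"
proof -
  let ?s = "real CARD('d) - 1" and ?n = "CARD('d) - 1"
  obtain j where j: "\<nu> $ j \<noteq> 0" using \<nu> by (auto simp: vec_eq_iff)
  have \<omega>: "0 < unit_ball_vol ?s" using d by (intro unit_ball_vol_pos) auto
  define L where "L = real CARD('d) + (\<Sum>i\<in>UNIV. \<bar>\<nu> $ i\<bar>) / \<bar>\<nu> $ j\<bar>"
  have L: "0 < L" using d by (auto simp: L_def intro!: add_pos_nonneg divide_nonneg_nonneg sum_nonneg)
  have lip: "norm (x - y) \<le> L * r"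
    if x: "x \<in> S" and y: "y \<in> S" and r: "0 \<le> r" and near: "\<And>i. i \<noteq> j \<Longrightarrow> \<bar>x $ i - y $ i\<bar> \<le> r" for x y r
  proof -
    have "\<nu> \<bullet> (x - y) = 0" using hyp[OF x] hyp[OF y] by (simp add: inner_diff_right)
    then have "\<nu> $ j * (x $ j - y $ j) + (\<Sum>i\<in>UNIV-{j}. \<nu> $ i * (x $ i - y $ i)) = 0"
      unfolding inner_vec_def by (subst (asm) sum.remove[of _ j]) auto
    then have "\<bar>\<nu> $ j\<bar> * \<bar>x $ j - y $ j\<bar> = \<bar>\<Sum>i\<in>UNIV-{j}. \<nu> $ i * (x $ i - y $ i)\<bar>"
      by (metis abs_minus_cancel abs_mult add_eq_0_iff)
    also have "\<dots> \<le> (\<Sum>i\<in>UNIV-{j}. \<bar>\<nu> $ i\<bar> * r)"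
      by (rule order_trans[OF sum_abs]) (use near in \<open>auto simp: abs_mult intro!: sum_mono mult_left_mono\<close>)
    also have "\<dots> \<le> (\<Sum>i\<in>UNIV. \<bar>\<nu> $ i\<bar> * r)" using r by (intro sum_mono2) auto
    also have "\<dots> = (\<Sum>i\<in>UNIV. \<bar>\<nu> $ i\<bar>) * r" by (simp add: sum_distrib_right)
    finally have xj: "\<bar>x $ j - y $ j\<bar> \<le> (\<Sum>i\<in>UNIV. \<bar>\<nu> $ i\<bar>) / \<bar>\<nu> $ j\<bar> * r"
      using j by (simp add: field_simps)
    have "norm (x - y) \<le> (\<Sum>i\<in>UNIV. \<bar>x $ i - y $ i\<bar>)" using norm_le_l1_cart[of "x - y"] by simp
    also have "\<dots> = \<bar>x $ j - y $ j\<bar> + (\<Sum>i\<in>UNIV-{j}. \<bar>x $ i - y $ i\<bar>)" by (rule sum.remove) auto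
    also have "(\<Sum>i\<in>UNIV-{j}. \<bar>x $ i - y $ i\<bar>) \<le> (\<Sum>i\<in>UNIV-{j}. r)" by (intro sum_mono near) auto
    also have "\<dots> \<le> real CARD('d) * r" using r by (simp add: card_Diff_singleton mult_right_mono)
    finally show ?thesis using xj by (simp add: L_def distrib_right)
  qed
  obtain b where b: "\<And>x. x \<in> S \<Longrightarrow> norm x \<le> b" using S by (auto simp: bounded_iff)
  obtain M :: nat where M: "max 1 b \<le> real M" using real_arch_simple by blast
  then have M1: "1 \<le> M" and bM: "b \<le> real M" by auto
  have comp: "\<bar>x $ i\<bar> \<le> real M" if "x \<in> S" for x i
    using component_le_norm_cart[of x i] b[OF that] bM by linarith
  define B where "B = unit_ball_vol ?s * (3 * real M * L / 2) ^ ?n"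
  have "hausdorff_content ?s \<epsilon> S \<le> ennreal B" if \<epsilon>: "0 < \<epsilon>" for \<epsilon>
  proof -
    obtain N :: nat where N: "max 1 (L / \<epsilon>) \<le> real N" using real_arch_simple by blast
    then have N1: "1 \<le> N" and LN: "L / real N \<le> \<epsilon>"
      using \<epsilon> by (auto simp: field_simps)
    define I where "I = PiE (UNIV - {j}) (\<lambda>_. {- int (M * N)..int (M * N)})"
    define cell where "cell k = {x\<in>S. \<forall>i. i \<noteq> j \<longrightarrow> \<lfloor>x $ i * real N\<rfloor> = k i}" for k :: "'d \<Rightarrow> int"
    have I: "finite I" unfolding I_def by (intro finite_PiE) auto
    have "card I = (2 * M * N + 1) ^ ?n"
    proof -
      have "card {- int (M * N)..int (M * N)} = 2 * M * N + 1" by (simp add: nat_eq_iff)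
      then show ?thesis unfolding I_def by (simp add: card_PiE card_Diff_singleton)
    qed
    also have "2 * M * N + 1 \<le> 3 * M * N" using mult_le_mono[OF M1 N1] by simp
    then have "(2 * M * N + 1) ^ ?n \<le> (3 * M * N) ^ ?n" by (rule power_mono) simp
    finally have card_I: "card I \<le> (3 * M * N) ^ ?n" .
    have cell_diam: "diameter (cell k) \<le> L / real N" for k
    proof (rule diameter_le)
      show "cell k \<noteq> {} \<or> 0 \<le> L / real N" using L by simp
      fix x y assume x: "x \<in> cell k" and y: "y \<in> cell k"
      have "norm (x - y) \<le> L * (1 / real N)"
      proof (rule lip)
        fix i assume "i \<noteq> j"
        then have "\<lfloor>x $ i * real N\<rfloor> = \<lfloor>y $ i * real N\<rfloor>" using x y by (auto simp: cell_def)
        then have "\<bar>x $ i * real N - y $ i * real N\<bar> < 1" by linarith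
        then have "\<bar>x $ i - y $ i\<bar> * real N < 1"
          by (metis abs_mult abs_of_nat left_diff_distrib)
        then show "\<bar>x $ i - y $ i\<bar> \<le> 1 / real N" using N1 by (simp add: field_simps)
      qed (use x y in \<open>auto simp: cell_def\<close>)
      then show "norm (x - y) \<le> L / real N" by simp
    qed
    have cell_bdd: "bounded (cell k)" for k
      by (rule bounded_subset[OF S]) (auto simp: cell_def)
    have "S \<subseteq> (\<Union>k\<in>I. cell k)"
    proof
      fix x assume x: "x \<in> S"
      let ?k = "restrict (\<lambda>i. \<lfloor>x $ i * real N\<rfloor>) (UNIV - {j})"
      have "\<lfloor>x $ i * real N\<rfloor> \<in> {- int (M * N)..int (M * N)}" for i
      proof -
        have "\<bar>x $ i * real N\<bar> \<le> real M * real N"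
          using comp[OF x, of i] by (simp add: abs_mult mult_right_mono)
        then have "\<bar>x $ i * real N\<bar> \<le> real_of_int (int (M * N))" by simp
        then show ?thesis unfolding atLeastAtMost_iff by linarith
      qed
      then have "?k \<in> I" by (auto simp: I_def)
      moreover have "x \<in> cell ?k" using x by (simp add: cell_def)
      ultimately show "x \<in> (\<Union>k\<in>I. cell k)" by blast
    qed
    then have "hausdorff_content ?s \<epsilon> S \<le> (\<Sum>k\<in>I. diameter_cost ?s (cell k))"
      using I \<epsilon> cell_bdd cell_diam LN
      by (intro hausdorff_content_le_finite_cover) (auto intro: order_trans)
    also have "\<dots> \<le> (\<Sum>k\<in>I. ennreal (unit_ball_vol ?s * (L / real N / 2) ^ ?n))"
      unfolding diameter_cost_codim1[OF d cell_bdd] using cell_diam \<omega>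
      by (intro sum_mono ennreal_leI mult_left_mono power_mono divide_right_mono)
        (auto intro: diameter_ge_0 cell_bdd)
    also have "\<dots> = ennreal (real (card I) * (unit_ball_vol ?s * (L / real N / 2) ^ ?n))"
      using \<omega> L by (simp add: ennreal_mult ennreal_of_nat_eq_real_of_nat)
    also have "\<dots> \<le> ennreal (real ((3 * M * N) ^ ?n) * (unit_ball_vol ?s * (L / real N / 2) ^ ?n))"
      using card_I \<omega> L by (intro ennreal_leI mult_right_mono) (simp_all only: of_nat_le_iff, simp)
    also have "real ((3 * M * N) ^ ?n) * (unit_ball_vol ?s * (L / real N / 2) ^ ?n)
        = unit_ball_vol ?s * ((3 * real M * real N) * (L / real N / 2)) ^ ?n"
      by (simp only: of_nat_power of_nat_mult of_nat_numeral power_mult_distrib mult_ac)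
    also have "(3 * real M * real N) * (L / real N / 2) = 3 * real M * L / 2"
      using N1 by simp
    finally show ?thesis by (simp add: B_def)
  qed
  then have "hausdorff_outer ?s S \<le> ennreal B"
    unfolding hausdorff_outer_eq_SUP_content by (intro SUP_least) auto
  then show ?thesis by (simp add: le_less_trans)
qed

section \<open>Elements and faces\<close>

lemma hyperplane_inclusion_parallel:
  fixes \<nu> \<nu>' :: "'a::euclidean_space"
  assumes sub: "{x. \<nu> \<bullet> x = c} \<subseteq> {x. \<nu>' \<bullet> x = c'}" and \<nu>: "norm \<nu> = 1"
  shows "\<nu>' = (\<nu>' \<bullet> \<nu>) *\<^sub>R \<nu>"
proof -
  have \<nu>\<nu>: "\<nu> \<bullet> \<nu> = 1" using \<nu> by (simp add: dot_square_norm)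
  \<comment> \<open>The part of \<open>\<nu>'\<close> orthogonal to \<open>\<nu>\<close> is a direction of the smaller hyperplane.\<close>
  define w where "w = \<nu>' - (\<nu>' \<bullet> \<nu>) *\<^sub>R \<nu>"
  have w: "\<nu> \<bullet> w = 0" by (simp add: w_def inner_diff_right \<nu>\<nu> inner_commute)
  have "\<nu>' \<bullet> (c *\<^sub>R \<nu>) = c'" "\<nu>' \<bullet> (c *\<^sub>R \<nu> + w) = c'"
    using subsetD[OF sub, of "c *\<^sub>R \<nu>"] subsetD[OF sub, of "c *\<^sub>R \<nu> + w"]
    by (auto simp: \<nu>\<nu> w inner_add_right)
  then have "\<nu>' \<bullet> w = 0" by (simp add: inner_add_right)
  then have "w \<bullet> w = 0" using w by (simp add: w_def inner_diff_left)
  then show ?thesis by (simp add: w_def)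
qed

lemma affine_hull_codim1_eq_hyperplane:
  fixes e :: "(real^'d) set"
  assumes "aff_dim e = int CARD('d) - 1" "e \<subseteq> {x. \<nu> \<bullet> x = c}" "\<nu> \<noteq> 0"
  shows "affine hull e = {x. \<nu> \<bullet> x = c}"
proof (rule affine_dim_equal)
  show "affine hull e \<noteq> {}" using assms(1) by (auto simp: )
  show "affine hull e \<subseteq> {x. \<nu> \<bullet> x = c}"
    using assms(2) by (simp add: affine_hyperplane hull_minimal)
  show "aff_dim (affine hull e) = aff_dim {x. \<nu> \<bullet> x = c}"
    using assms by (simp add: aff_dim_hyperplane)
qed (auto simp: affine_hyperplane)

text \<open>A set of dimension \<open>d - 1\<close> determines its normal up to sign, and the body, having interior points,
  lies on one side only.\<close>

lemma face_normal_unique: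
  fixes e :: "(real^'d) set"
  assumes e: "aff_dim e = int CARD('d) - 1" "e \<subseteq> K" and K: "interior K \<noteq> {}"
    and \<nu>: "norm \<nu> = 1" "\<forall>x\<in>e. \<forall>y\<in>K. \<nu> \<bullet> (y - x) \<le> 0"
    and \<nu>': "norm \<nu>' = 1" "\<forall>x\<in>e. \<forall>y\<in>K. \<nu>' \<bullet> (y - x) \<le> 0"
  shows "\<nu>' = \<nu>"
proof -
  have "e \<noteq> {}" using e by auto
  then obtain x where x: "x \<in> e" by blast
  have const: "n \<bullet> z = n \<bullet> x" if "\<forall>x\<in>e. \<forall>y\<in>K. n \<bullet> (y - x) \<le> 0" "z \<in> e" for n z
  proof -
    have "n \<bullet> (z - x) \<le> 0" "n \<bullet> (x - z) \<le> 0" using that x e(2) by blast+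
    then show ?thesis by (simp add: inner_diff_right)
  qed
  have hull: "affine hull e = {z. n \<bullet> z = n \<bullet> x}"
    if "norm n = 1" "\<forall>x\<in>e. \<forall>y\<in>K. n \<bullet> (y - x) \<le> 0" for n
  proof (rule affine_hull_codim1_eq_hyperplane[OF e(1)])
    show "e \<subseteq> {z. n \<bullet> z = n \<bullet> x}" using const[OF that(2)] by blast
    show "n \<noteq> 0" using that(1) by auto
  qed
  have "affine hull e = {z. \<nu> \<bullet> z = \<nu> \<bullet> x}" "affine hull e = {z. \<nu>' \<bullet> z = \<nu>' \<bullet> x}"
    by (rule hull[OF \<nu>] hull[OF \<nu>'])+
  then have "{z. \<nu> \<bullet> z = \<nu> \<bullet> x} \<subseteq> {z. \<nu>' \<bullet> z = \<nu>' \<bullet> x}" by simp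
  from hyperplane_inclusion_parallel[OF this \<nu>(1)] obtain t where t: "\<nu>' = t *\<^sub>R \<nu>" by blast
  then have "\<bar>t\<bar> = 1" using \<nu>(1) \<nu>'(1) by simp
  moreover have "t \<noteq> -1"
  proof
    assume "t = -1"
    have "K \<subseteq> {y. \<nu> \<bullet> y = \<nu> \<bullet> x}"
    proof
      fix y assume "y \<in> K"
      then have "\<nu> \<bullet> (y - x) \<le> 0" "\<nu>' \<bullet> (y - x) \<le> 0" using \<nu>(2) \<nu>'(2) x by blast+
      then show "y \<in> {y. \<nu> \<bullet> y = \<nu> \<bullet> x}" using t \<open>t = -1\<close> by (simp add: inner_diff_right)
    qed
    then have "interior K \<subseteq> interior {y. \<nu> \<bullet> y = \<nu> \<bullet> x}" by (rule interior_mono)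
    moreover have "\<nu> \<noteq> 0" using \<nu>(1) by auto
    ultimately show False using K by simp
  qed
  ultimately have "t = 1" by linarith
  then show ?thesis using t by simp
qed

lemma face_normal_eqI:
  fixes e :: "(real^'d) set"
  assumes "aff_dim e = int CARD('d) - 1" "e \<subseteq> K" "interior K \<noteq> {}"
    and "norm \<nu> = 1" "\<forall>x\<in>e. \<forall>y\<in>K. \<nu> \<bullet> (y - x) \<le> 0"
  shows "face_normal K e = \<nu>"
  unfolding face_normal_def
proof (rule the_equality)
  show "norm \<nu> = 1 \<and> (\<forall>x\<in>e. \<forall>y\<in>K. \<nu> \<bullet> (y - x) \<le> 0)" using assms(4,5) by blast
  show "n = \<nu>" if "norm n = 1 \<and> (\<forall>x\<in>e. \<forall>y\<in>K. n \<bullet> (y - x) \<le> 0)" for n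
    using that by (intro face_normal_unique[OF assms]) (elim conjE, assumption)+
qed

text \<open>Convex bodies with disjoint interiors are separated by a hyperplane, which contains every
  common part \<open>e\<close>; its normal is normal to both on \<open>e\<close>, with opposite orientations.\<close>

lemma face_normals_opposite:
  fixes e :: "(real^'d) set"
  assumes e: "aff_dim e = int CARD('d) - 1" "e \<subseteq> K" "e \<subseteq> L"
    and K: "convex K" "closed K" "interior K \<noteq> {}"
    and L: "convex L" "closed L" "interior L \<noteq> {}"
    and disj: "interior K \<inter> interior L = {}"
  obtains \<nu> c where "norm \<nu> = 1" "face_normal K e = \<nu>" "face_normal L e = - \<nu>"
    "\<And>x. x \<in> e \<Longrightarrow> \<nu> \<bullet> x = c"
proof -
  obtain a b where a: "a \<noteq> 0" and Ka: "\<forall>x\<in>interior K. a \<bullet> x \<le> b" and La: "\<forall>x\<in>interior L. b \<le> a \<bullet> x"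
    using separating_hyperplane_sets[OF convex_interior[OF K(1)] convex_interior[OF L(1)] K(3) L(3) disj]
    by blast
  have "closure (interior K) \<subseteq> {x. a \<bullet> x \<le> b}" "closure (interior L) \<subseteq> {x. a \<bullet> x \<ge> b}"
    using Ka La by (intro closure_minimal; auto simp: closed_halfspace_le closed_halfspace_ge)+
  moreover have "closure (interior K) = K" "closure (interior L) = L"
    using convex_closure_interior[of K] convex_closure_interior[of L] K L by simp_all
  ultimately have Kb: "\<And>x. x \<in> K \<Longrightarrow> a \<bullet> x \<le> b" and Lb: "\<And>x. x \<in> L \<Longrightarrow> b \<le> a \<bullet> x"
    by blast+
  define \<nu> where "\<nu> = (1 / norm a) *\<^sub>R a"
  have \<nu>: "norm \<nu> = 1" using a by (simp add: \<nu>_def)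
  have eb: "a \<bullet> x = b" if "x \<in> e" for x using that e Kb[of x] Lb[of x] by (intro antisym) auto
  have \<nu>_diff: "\<nu> \<bullet> (y - x) = (a \<bullet> y - b) / norm a" if "x \<in> e" for x y
    using eb[OF that] by (simp add: \<nu>_def inner_diff_right diff_divide_distrib)
  have K\<nu>: "face_normal K e = \<nu>"
  proof (rule face_normal_eqI[OF e(1,2) K(3) \<nu>], intro ballI)
    show "\<nu> \<bullet> (y - x) \<le> 0" if "x \<in> e" "y \<in> K" for x y
      unfolding \<nu>_diff[OF that(1)] using Kb[OF that(2)] a by (simp add: divide_le_0_iff)
  qed
  have L\<nu>: "face_normal L e = - \<nu>"
  proof (rule face_normal_eqI[OF e(1,3) L(3)], simp add: \<nu>, intro ballI)
    show "- \<nu> \<bullet> (y - x) \<le> 0" if "x \<in> e" "y \<in> L" for x y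
      unfolding inner_minus_left \<nu>_diff[OF that(1)] using Lb[OF that(2)] a by simp
  qed
  have "\<nu> \<bullet> x = b / norm a" if "x \<in> e" for x using eb[OF that] by (simp add: \<nu>_def)
  then show ?thesis by (rule that[OF \<nu> K\<nu> L\<nu>])
qed

text \<open>The elements fill the closure of the domain, which may have more interior points than the domain
  itself. The condition on normals says that almost every boundary point is reached from the
  exterior; it keeps the boundary from spreading through the interior of the elements, where its
  surface measure could be infinite.\<close>

locale mesh =
  fixes \<Omega> :: "(real^'d) set" and T :: "(real^'d) set set"
  assumes dim2: "2 \<le> CARD('d)" and open_domain: "open \<Omega>" and bounded_domain: "bounded \<Omega>"
    and connected_domain: "connected \<Omega>" and domain_nonempty: "\<Omega> \<noteq> {}"
    and partition: "simplicial_partition \<Omega> T"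
    and normal_AE: "AE x in surface_on (frontier \<Omega>). \<exists>\<nu>. outward_unit_normal_at \<Omega> x \<nu>"
begin

lemma finite_T: "finite T"
  using partition by (simp add: simplicial_partition_def)

lemma Union_T: "\<Union>T = closure \<Omega>"
  using partition by (simp add: simplicial_partition_def)

lemma interiors_disjoint: "K \<in> T \<Longrightarrow> L \<in> T \<Longrightarrow> K \<noteq> L \<Longrightarrow> interior K \<inter> interior L = {}"
  using partition by (simp add: simplicial_partition_def)

lemma simplex: "K \<in> T \<Longrightarrow> int CARD('d) simplex K"
  using partition by (simp add: simplicial_partition_def)

lemma element_polytope: "K \<in> T \<Longrightarrow> polytope K"
  using simplex simplex_imp_polytope by blast

lemma element_convex: "K \<in> T \<Longrightarrow> convex K"
  using element_polytope polytope_imp_convex by blast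

lemma element_compact: "K \<in> T \<Longrightarrow> compact K"
  using element_polytope polytope_imp_compact by blast

lemma element_closed: "K \<in> T \<Longrightarrow> closed K"
  using element_compact compact_imp_closed by blast

lemma element_interior: "K \<in> T \<Longrightarrow> interior K \<noteq> {}"
proof -
  assume K: "K \<in> T"
  have "aff_dim K = int (DIM(real^'d))" using aff_dim_simplex[OF simplex[OF K]] by simp
  then have "affine hull K = UNIV" "K \<noteq> {}" by (simp only: aff_dim_eq_full, auto)
  then show ?thesis
    using rel_interior_interior[of K] rel_interior_eq_empty[OF element_convex[OF K]] by simp
qed

lemma closure_interior_element: "K \<in> T \<Longrightarrow> closure (interior K) = K"
  using convex_closure_interior[of K] element_convex[of K] element_interior[of K] element_closed[of K]
  by simp

lemma interior_meets_domain: "K \<in> T \<Longrightarrow> interior K \<inter> \<Omega> \<noteq> {}"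
proof -
  assume K: "K \<in> T"
  have "interior K \<subseteq> closure \<Omega>" using Union_T K interior_subset by blast
  then show ?thesis
    using element_interior[OF K] open_Int_closure_eq_empty[of "interior K" \<Omega>] by auto
qed

text \<open>Any two elements that contain the face have opposite normals on it, and three normals cannot be
  pairwise opposite. Hence there are no more than two such elements.\<close>

lemma interior_face_cases:
  assumes "e \<in> interior_faces T"
  obtains K L \<nu> c where "K \<in> T" "L \<in> T" "K \<noteq> L" "e = K \<inter> L" "aff_dim e = int CARD('d) - 1"
    "{M\<in>T. e \<subseteq> M} = {K, L}" "norm \<nu> = 1" "face_normal K e = \<nu>" "face_normal L e = - \<nu>"
    "\<And>x. x \<in> e \<Longrightarrow> \<nu> \<bullet> x = c"
proof -
  obtain K L where KL: "K \<in> T" "L \<in> T" "K \<noteq> L" "e = K \<inter> L" and dim: "aff_dim e = int CARD('d) - 1"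
    using assms unfolding interior_faces_def by auto
  have opp: "\<exists>\<nu> c. norm \<nu> = 1 \<and> face_normal K e = \<nu> \<and> face_normal L e = - \<nu> \<and> (\<forall>x\<in>e. \<nu> \<bullet> x = c)"
    if "K \<in> T" "L \<in> T" "K \<noteq> L" "e \<subseteq> K" "e \<subseteq> L" for K L
    by (rule face_normals_opposite[OF dim that(4,5) element_convex[OF that(1)]
          element_closed[OF that(1)] element_interior[OF that(1)] element_convex[OF that(2)]
          element_closed[OF that(2)] element_interior[OF that(2)] interiors_disjoint[OF that(1-3)]])
      blast
  obtain \<nu> c where \<nu>: "norm \<nu> = 1" "face_normal K e = \<nu>" "face_normal L e = - \<nu>" "\<forall>x\<in>e. \<nu> \<bullet> x = c"
    using opp[of K L] KL by auto
  have "M = K \<or> M = L" if M: "M \<in> T" "e \<subseteq> M" for M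
  proof (rule ccontr)
    assume "\<not> ?thesis"
    then have "face_normal M e = - \<nu>" "face_normal M e = \<nu>"
      using opp[of K M] opp[of L M] KL M \<nu> by auto
    then have "\<nu> + \<nu> = 0" by (metis add.right_inverse)
    then have "\<nu> = 0" by (metis scaleR_2 scaleR_eq_0_iff zero_neq_numeral)
    then show False using \<nu>(1) by simp
  qed
  then have two: "{M\<in>T. e \<subseteq> M} = {K, L}" using KL by auto
  show ?thesis by (rule that[OF KL dim two \<nu>(1-3)]) (use \<nu>(4) in blast)
qed

end

section \<open>Complex affine functions\<close>

definition affine_form :: "complex \<Rightarrow> complex^'d \<Rightarrow> real^'d \<Rightarrow> complex" where
  "affine_form a b x = a + (\<Sum>i\<in>UNIV. b $ i * complex_of_real (x $ i))"

lemma affine_form_lincomb: "affine_form (c * a + a') (c *s b + b') x = c * affine_form a b x + affine_form a' b' x"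
  by (simp add: affine_form_def algebra_simps sum.distrib sum_distrib_left)

lemma affine_form_diff: "affine_form (a - a') (b - b') x = affine_form a b x - affine_form a' b' x"
  by (simp add: affine_form_def algebra_simps sum_subtractf)

lemma affine_form_const [simp]: "affine_form a 0 x = a"
  by (simp add: affine_form_def)

lemma continuous_on_affine_form [continuous_intros]: "continuous_on S (affine_form a b)"
  unfolding affine_form_def by (intro continuous_intros)

lemma affine_form_cvec: "affine_form a (t *s cvec \<nu>) x = a + t * complex_of_real (\<nu> \<bullet> x)"
  by (simp add: affine_form_def cvec_def inner_vec_def sum_distrib_left mult.assoc)

lemma has_derivative_affine_form:
  fixes b :: "complex^'d"
  shows "(affine_form a b has_derivative (\<lambda>h. \<Sum>i\<in>UNIV. b $ i * complex_of_real (h $ i))) (at x)"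
proof -
  have "bounded_linear (\<lambda>h::real^'d. \<Sum>i\<in>UNIV. b $ i * complex_of_real (h $ i))"
    unfolding linear_conv_bounded_linear[symmetric]
    by (rule linearI) (simp_all add: algebra_simps sum.distrib scaleR_sum_right
        scaleR_conv_of_real[where 'a = complex] sum_distrib_left)
  from has_derivative_add[OF has_derivative_const[of a] bounded_linear_imp_has_derivative[OF this]]
  have "((\<lambda>h. a + (\<Sum>i\<in>UNIV. b $ i * complex_of_real (h $ i))) has_derivative
      (\<lambda>h. \<Sum>i\<in>UNIV. b $ i * complex_of_real (h $ i))) (at x)"
    by simp
  then show ?thesis by (simp add: affine_form_def[abs_def])
qed

lemma negligible_affine_form_zeros:
  fixes b :: "complex^'d"
  assumes "a \<noteq> 0 \<or> b \<noteq> 0"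
  shows "negligible {x. affine_form a b x = 0}"
proof -
  have Re: "Re (affine_form a b x) = Re a + (\<chi> i. Re (b $ i)) \<bullet> x"
    and Im: "Im (affine_form a b x) = Im a + (\<chi> i. Im (b $ i)) \<bullet> x" for x
    by (simp_all add: affine_form_def inner_vec_def)
  have sub: "{x. affine_form a b x = 0} \<subseteq> {x. (\<chi> i. Re (b $ i)) \<bullet> x = - Re a}"
    "{x. affine_form a b x = 0} \<subseteq> {x. (\<chi> i. Im (b $ i)) \<bullet> x = - Im a}"
    using Re Im by (auto simp: complex_eq_iff add_eq_0_iff)
  have "((\<chi> i. Re (b $ i)) :: real^'d) \<noteq> 0 \<or> - Re a \<noteq> 0 \<or>
      ((\<chi> i. Im (b $ i)) :: real^'d) \<noteq> 0 \<or> - Im a \<noteq> 0"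
    using assms by (auto simp: vec_eq_iff complex_eq_iff)
  then show ?thesis
    using negligible_subset[OF negligible_hyperplane sub(1)]
      negligible_subset[OF negligible_hyperplane sub(2)] by blast
qed

lemma affine_form_unique:
  assumes "\<not> negligible U" "\<And>x. x \<in> U \<Longrightarrow> affine_form a b x = affine_form a' b' x"
  shows "a = a' \<and> b = b'"
proof (rule ccontr)
  assume "\<not> ?thesis"
  then have "negligible {x. affine_form (a - a') (b - b') x = 0}" by (intro negligible_affine_form_zeros) auto
  then have "negligible U" by (rule negligible_subset) (use assms(2) in \<open>auto simp: affine_form_diff\<close>)
  then show False using assms(1) by blast
qed

lemma P1_on_Re_Im_iff_affine_form:
  "P1_on S (\<lambda>x. Re (v x)) \<and> P1_on S (\<lambda>x. Im (v x)) \<longleftrightarrow> (\<exists>a b. \<forall>x\<in>S. v x = affine_form a b x)"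
proof
  assume "P1_on S (\<lambda>x. Re (v x)) \<and> P1_on S (\<lambda>x. Im (v x))"
  then obtain a b a' b' where "\<forall>x\<in>S. Re (v x) = a + b \<bullet> x" "\<forall>x\<in>S. Im (v x) = a' + b' \<bullet> x"
    unfolding P1_on_def by blast
  then show "\<exists>a b. \<forall>x\<in>S. v x = affine_form a b x"
    by (intro exI[of _ "Complex a a'"] exI[of _ "\<chi> i. Complex (b $ i) (b' $ i)"])
      (auto simp: affine_form_def complex_eq_iff inner_vec_def)
next
  assume "\<exists>a b. \<forall>x\<in>S. v x = affine_form a b x"
  then obtain a b where ab: "\<forall>x\<in>S. v x = affine_form a b x" by blast
  show "P1_on S (\<lambda>x. Re (v x)) \<and> P1_on S (\<lambda>x. Im (v x))"
    unfolding P1_on_def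
    by (intro conjI exI[of _ "Re a"] exI[of _ "\<chi> i. Re (b $ i)"] exI[of _ "Im a"]
        exI[of _ "\<chi> i. Im (b $ i)"]) (auto simp: ab affine_form_def inner_vec_def)
qed

section \<open>Traces and gradients of piecewise affine functions\<close>

text \<open>A point in the closure of an open set in Euclidean space is a limit of other points of that set,
  so the limit that defines the trace is unique.\<close>

lemma trace_from_eqI:
  fixes v :: "'a::euclidean_space \<Rightarrow> 'b::t2_space"
  assumes "x \<in> closure (interior K)" "continuous_on UNIV g" "\<And>y. y \<in> interior K \<Longrightarrow> v y = g y"
  shows "trace_from K v x = g x"
  unfolding trace_from_def
proof (rule tendsto_Lim)
  show "\<not> trivial_limit (at x within interior K)"
    using assms(1) unfolding trivial_limit_within closure_def
    by (auto simp: interior_limit_point[of x "interior K"])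
  have "(g \<longlongrightarrow> g x) (at x within interior K)"
    using assms(2) by (auto simp: continuous_on_eq_continuous_at isCont_def intro: tendsto_within_subset)
  then show "(v \<longlongrightarrow> g x) (at x within interior K)"
    using assms(3) Lim_cong_within[of x x "g x" "g x" "interior K" "interior K" v g] by simp
qed

text \<open>The coefficients of the affine function that \<open>v\<close> agrees with on the interior of \<open>K\<close>. The choice is
  unique if \<open>K\<close> has interior points; the affine function itself extends \<open>v\<close> to all of \<open>K\<close> and
  gives its traces.\<close>

definition piece_const :: "(real^'d) set \<Rightarrow> (real^'d \<Rightarrow> complex) \<Rightarrow> complex" where
  "piece_const K v = fst (SOME p. \<forall>x\<in>interior K. v x = affine_form (fst p) (snd p) x)"

definition piece_grad :: "(real^'d) set \<Rightarrow> (real^'d \<Rightarrow> complex) \<Rightarrow> complex^'d" where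
  "piece_grad K v = snd (SOME p. \<forall>x\<in>interior K. v x = affine_form (fst p) (snd p) x)"

abbreviation piece :: "(real^'d) set \<Rightarrow> (real^'d \<Rightarrow> complex) \<Rightarrow> real^'d \<Rightarrow> complex" where
  "piece K v \<equiv> affine_form (piece_const K v) (piece_grad K v)"

context mesh
begin

abbreviation "V \<equiv> V_h T"
abbreviation "\<Sigma> \<equiv> Sigma_h T"

lemma V_iff: "v \<in> V \<longleftrightarrow> (\<forall>K\<in>T. \<exists>a b. \<forall>x\<in>interior K. v x = affine_form a b x) \<and>
    (\<forall>x. x \<notin> (\<Union>K\<in>T. interior K) \<longrightarrow> v x = 0)"
  unfolding V_h_def by (simp add: P1_on_Re_Im_iff_affine_form)

lemma V_piece: "v \<in> V \<Longrightarrow> K \<in> T \<Longrightarrow> x \<in> interior K \<Longrightarrow> v x = piece K v x"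
proof -
  assume "v \<in> V" "K \<in> T" and x: "x \<in> interior K"
  then obtain a b where "\<forall>x\<in>interior K. v x = affine_form a b x" unfolding V_iff by blast
  then have "\<exists>p. \<forall>x\<in>interior K. v x = affine_form (fst p) (snd p) x" by (intro exI[of _ "(a, b)"]) simp
  from someI_ex[OF this] show ?thesis
    unfolding piece_const_def piece_grad_def by (rule bspec[OF _ x])
qed

lemma V_outside: "v \<in> V \<Longrightarrow> x \<notin> (\<Union>K\<in>T. interior K) \<Longrightarrow> v x = 0"
  by (simp add: V_iff)

lemma piece_eqI:
  assumes "v \<in> V" "K \<in> T" "\<And>x. x \<in> interior K \<Longrightarrow> v x = affine_form a b x"
  shows "piece_const K v = a \<and> piece_grad K v = b"
proof (rule affine_form_unique)
  show "\<not> negligible (interior K)"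
    by (rule open_not_negligible[OF open_interior element_interior[OF assms(2)]])
  show "piece K v x = affine_form a b x" if "x \<in> interior K" for x
    using V_piece[OF assms(1,2) that] assms(3)[OF that] by simp
qed

lemma V_lincomb: "v \<in> V \<Longrightarrow> w \<in> V \<Longrightarrow> (\<lambda>x. c * v x + w x) \<in> V"
proof -
  assume v: "v \<in> V" and w: "w \<in> V"
  show ?thesis
    unfolding V_iff
  proof (intro conjI ballI allI impI)
    fix K assume K: "K \<in> T"
    have "c * v x + w x = affine_form (c * piece_const K v + piece_const K w)
        (c *s piece_grad K v + piece_grad K w) x" if "x \<in> interior K" for x
      by (simp only: affine_form_lincomb V_piece[OF v K that] V_piece[OF w K that])
    then show "\<exists>a b. \<forall>x\<in>interior K. c * v x + w x = affine_form a b x" by blast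
  qed (simp add: V_outside[OF v] V_outside[OF w])
qed

lemma piece_lincomb:
  assumes "v \<in> V" "w \<in> V" "K \<in> T"
  shows "piece_const K (\<lambda>x. c * v x + w x) = c * piece_const K v + piece_const K w"
    and "piece_grad K (\<lambda>x. c * v x + w x) = c *s piece_grad K v + piece_grad K w"
proof -
  have "c * v x + w x = affine_form (c * piece_const K v + piece_const K w)
      (c *s piece_grad K v + piece_grad K w) x" if "x \<in> interior K" for x
    by (simp only: affine_form_lincomb V_piece[OF assms(1,3) that] V_piece[OF assms(2,3) that])
  from piece_eqI[OF V_lincomb[OF assms(1,2)] assms(3) this]
  show "piece_const K (\<lambda>x. c * v x + w x) = c * piece_const K v + piece_const K w"
    and "piece_grad K (\<lambda>x. c * v x + w x) = c *s piece_grad K v + piece_grad K w" by blast+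
qed

lemma V_zero: "(\<lambda>x. 0) \<in> V"
  unfolding V_iff by (intro conjI ballI exI[of _ 0]) simp_all

lemma Sigma_iff: "\<tau> \<in> \<Sigma> \<longleftrightarrow> (\<forall>i. (\<lambda>x. \<tau> x $ i) \<in> V)"
  by (simp add: Sigma_h_def)

lemma Sigma_component: "\<tau> \<in> \<Sigma> \<Longrightarrow> (\<lambda>x. \<tau> x $ i) \<in> V"
  by (simp add: Sigma_iff)

lemma Sigma_lincomb: "\<tau> \<in> \<Sigma> \<Longrightarrow> \<tau>' \<in> \<Sigma> \<Longrightarrow> (\<lambda>x. c *s \<tau> x + \<tau>' x) \<in> \<Sigma>"
  unfolding Sigma_iff using V_lincomb by simp

lemma Sigma_zero: "(\<lambda>x. 0) \<in> \<Sigma>"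
  unfolding Sigma_iff using V_zero by simp

lemma trace_V: "v \<in> V \<Longrightarrow> K \<in> T \<Longrightarrow> x \<in> K \<Longrightarrow> trace_from K v x = piece K v x"
  by (rule trace_from_eqI[OF _ continuous_on_affine_form V_piece]) (simp_all add: closure_interior_element)

lemma trace_Sigma:
  "\<tau> \<in> \<Sigma> \<Longrightarrow> K \<in> T \<Longrightarrow> x \<in> K \<Longrightarrow> trace_from K \<tau> x = (\<chi> i. piece K (\<lambda>y. \<tau> y $ i) x)"
proof (rule trace_from_eqI)
  assume \<tau>: "\<tau> \<in> \<Sigma>" and K: "K \<in> T"
  show "\<tau> y = (\<chi> i. piece K (\<lambda>y. \<tau> y $ i) y)" if "y \<in> interior K" for y
    using V_piece[OF Sigma_component[OF \<tau>] K that] by (simp add: vec_eq_iff)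
  show "continuous_on UNIV (\<lambda>x. \<chi> i. piece K (\<lambda>y. \<tau> y $ i) x)"
    by (intro continuous_on_vec_lambda continuous_intros)
qed (simp add: closure_interior_element)

lemma grad_h_piece:
  assumes v: "v \<in> V" and K: "K \<in> T" and x: "x \<in> interior K"
  shows "grad_h T v x = piece_grad K v"
proof -
  have "(v has_derivative (\<lambda>h. \<Sum>i\<in>UNIV. piece_grad K v $ i * complex_of_real (h $ i))) (at x)"
    by (rule has_derivative_transform_within_open[OF has_derivative_affine_form open_interior x])
      (simp add: V_piece[OF v K])
  then have D: "frechet_derivative v (at x) = (\<lambda>h. \<Sum>i\<in>UNIV. piece_grad K v $ i * complex_of_real (h $ i))"
    by (rule frechet_derivative_at[symmetric])
  have "frechet_derivative v (at x) (axis i 1) = piece_grad K v $ i" for i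
  proof -
    have "(\<Sum>k\<in>UNIV. piece_grad K v $ k * complex_of_real (axis i 1 $ k))
        = (\<Sum>k\<in>UNIV. if k = i then piece_grad K v $ i else 0)"
      by (rule sum.cong) (auto simp: axis_def)
    then show ?thesis by (simp add: D)
  qed
  then show ?thesis using K x by (auto simp: grad_h_def vec_eq_iff)
qed

lemma grad_h_outside: "x \<notin> (\<Union>K\<in>T. interior K) \<Longrightarrow> grad_h T v x = 0"
  by (simp add: grad_h_def)

lemma grad_h_Sigma: "v \<in> V \<Longrightarrow> grad_h T v \<in> \<Sigma>"
proof -
  assume v: "v \<in> V"
  show ?thesis
    unfolding Sigma_iff V_iff
  proof (intro allI conjI ballI impI)
    fix i K assume "K \<in> T"
    then show "\<exists>a b. \<forall>x\<in>interior K. grad_h T v x $ i = affine_form a b x"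
      by (intro exI[of _ "piece_grad K v $ i"] exI[of _ 0]) (simp add: grad_h_piece[OF v])
  qed (simp add: grad_h_outside)
qed

lemma grad_h_lincomb:
  assumes "v \<in> V" "w \<in> V"
  shows "grad_h T (\<lambda>x. c * v x + w x) x = c *s grad_h T v x + grad_h T w x"
proof (cases "x \<in> (\<Union>K\<in>T. interior K)")
  case True
  then show ?thesis using assms by (auto simp: grad_h_piece V_lincomb piece_lincomb)
qed (simp add: grad_h_outside)

lemma trace_grad_h: "v \<in> V \<Longrightarrow> K \<in> T \<Longrightarrow> x \<in> K \<Longrightarrow> trace_from K (grad_h T v) x = piece_grad K v"
  by (rule trace_from_eqI[OF _ continuous_on_const grad_h_piece]) (simp_all add: closure_interior_element)

lemma V_sum_pieces:
  assumes v: "v \<in> V"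
  shows "v x = (\<Sum>K\<in>T. if x \<in> interior K then piece K v x else 0)"
proof (cases "x \<in> (\<Union>K\<in>T. interior K)")
  case True
  then obtain K where K: "K \<in> T" "x \<in> interior K" by blast
  have "(\<Sum>L\<in>T. if x \<in> interior L then piece L v x else 0) = (\<Sum>L\<in>T. if L = K then piece K v x else 0)"
    using K interiors_disjoint[of K] by (intro sum.cong) auto
  then show ?thesis using V_piece[OF v K] K finite_T by simp
next
  case False
  then show ?thesis by (auto simp: V_outside[OF v] intro!: sum.neutral[symmetric])
qed

end

section \<open>Inner products of bounded measurable functions\<close>

text \<open>The discrete functions, their gradients and their traces are of this kind, which is closed under
  sums and products, and products of such functions are integrable over any finite measure.\<close>

definition bdd_measurable :: "'a measure \<Rightarrow> ('a \<Rightarrow> complex) \<Rightarrow> bool" where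
  "bdd_measurable M f \<longleftrightarrow> f \<in> borel_measurable M \<and> (\<exists>B. \<forall>x\<in>space M. cmod (f x) \<le> B)"

definition bdd_measurable_vec :: "'a measure \<Rightarrow> ('a \<Rightarrow> complex^'d) \<Rightarrow> bool" where
  "bdd_measurable_vec M f \<longleftrightarrow> (\<forall>i. bdd_measurable M (\<lambda>x. f x $ i))"

lemma bdd_measurable_const: "bdd_measurable M (\<lambda>x. c)"
  unfolding bdd_measurable_def by auto

lemma bdd_measurable_add:
  assumes "bdd_measurable M f" "bdd_measurable M g" shows "bdd_measurable M (\<lambda>x. f x + g x)"
proof -
  obtain B C where "\<forall>x\<in>space M. cmod (f x) \<le> B" "\<forall>x\<in>space M. cmod (g x) \<le> C"
    using assms unfolding bdd_measurable_def by blast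
  then have "\<forall>x\<in>space M. cmod (f x + g x) \<le> B + C"
    using norm_triangle_mono by blast
  then show ?thesis using assms unfolding bdd_measurable_def by (auto intro: borel_measurable_add)
qed

lemma bdd_measurable_mult:
  assumes "bdd_measurable M f" "bdd_measurable M g" shows "bdd_measurable M (\<lambda>x. f x * g x)"
proof -
  obtain B C where B: "\<forall>x\<in>space M. cmod (f x) \<le> B" and C: "\<forall>x\<in>space M. cmod (g x) \<le> C"
    using assms unfolding bdd_measurable_def by blast
  have "cmod (f x * g x) \<le> B * C" if "x \<in> space M" for x
    unfolding norm_mult using B C that by (intro mult_mono) (auto intro: order_trans[OF norm_ge_zero])
  then show ?thesis using assms unfolding bdd_measurable_def by (auto intro: borel_measurable_times)
qed

lemma bdd_measurable_sum: "(\<And>i. i \<in> I \<Longrightarrow> bdd_measurable M (f i)) \<Longrightarrow> bdd_measurable M (\<lambda>x. \<Sum>i\<in>I. f i x)"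
  by (induction I rule: infinite_finite_induct) (auto intro: bdd_measurable_add bdd_measurable_const)

lemma bdd_measurable_cong: "(\<And>x. x \<in> space M \<Longrightarrow> f x = g x) \<Longrightarrow> bdd_measurable M f \<longleftrightarrow> bdd_measurable M g"
  unfolding bdd_measurable_def using measurable_cong[of M f g borel] by auto

lemma bdd_measurable_vec_lincomb: "bdd_measurable_vec M f \<Longrightarrow> bdd_measurable_vec M g \<Longrightarrow> bdd_measurable_vec M (\<lambda>x. c *s f x + g x)"
  unfolding bdd_measurable_vec_def by (simp add: bdd_measurable_add bdd_measurable_mult bdd_measurable_const)

lemma integrable_mult_cnj:
  assumes "finite_measure M" "bdd_measurable M f" "bdd_measurable M g"
  shows "integrable M (\<lambda>x. f x * cnj (g x))"
proof -
  interpret finite_measure M by fact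
  have "bdd_measurable M (\<lambda>x. cnj (g x))"
    using assms(3) measurable_compose[OF _ borel_measurable_continuous_onI[OF continuous_on_cnj[OF continuous_on_id]]]
    unfolding bdd_measurable_def by auto
  then have "bdd_measurable M (\<lambda>x. f x * cnj (g x))" by (rule bdd_measurable_mult[OF assms(2)])
  then show ?thesis
    unfolding bdd_measurable_def by (auto intro!: integrable_const_bound AE_I2)
qed

lemma ip_lincomb_left:
  assumes "finite_measure M" "bdd_measurable M f" "bdd_measurable M f'" "bdd_measurable M g"
  shows "ip M (\<lambda>x. c * f x + f' x) g = c * ip M f g + ip M f' g"
  using integrable_mult_cnj[OF assms(1,2,4)] integrable_mult_cnj[OF assms(1,3,4)]
  by (simp add: ip_def distrib_right mult.assoc)

lemma ip_sym: "ip M g f = cnj (ip M f g)"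
proof -
  have "cnj (ip M f g) = (LINT x|M. cnj (f x * cnj (g x)))"
    unfolding ip_def by (rule Bochner_Integration.integral_cnj[symmetric])
  then show ?thesis by (simp add: ip_def mult.commute)
qed

lemma ip_lincomb_right:
  assumes "finite_measure M" "bdd_measurable M f" "bdd_measurable M g" "bdd_measurable M g'"
  shows "ip M f (\<lambda>x. c * g x + g' x) = cnj c * ip M f g + ip M f g'"
  using ip_lincomb_left[OF assms(1,3,4,2), of c]
  by (simp add: ip_sym[of M f])

lemma ip_cong:
  "(\<And>x. x \<in> space M \<Longrightarrow> u x = u' x) \<Longrightarrow> (\<And>x. x \<in> space M \<Longrightarrow> v x = v' x) \<Longrightarrow> ip M u v = ip M u' v'"
  unfolding ip_def by (intro Bochner_Integration.integral_cong) auto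

lemma ipv_cong:
  "(\<And>x. x \<in> space M \<Longrightarrow> u x = u' x) \<Longrightarrow> (\<And>x. x \<in> space M \<Longrightarrow> v x = v' x) \<Longrightarrow> ipv M u v = ipv M u' v'"
  unfolding ipv_def by (intro Bochner_Integration.integral_cong) auto

lemma ipv_sum_components:
  assumes "finite_measure M" "bdd_measurable_vec M f" "bdd_measurable_vec M g"
  shows "ipv M f g = (\<Sum>i\<in>UNIV. ip M (\<lambda>x. f x $ i) (\<lambda>x. g x $ i))"
  unfolding ipv_def cdot_def ip_def
  using assms integrable_mult_cnj[OF assms(1)]
  by (intro Bochner_Integration.integral_sum) (auto simp: bdd_measurable_vec_def)

lemma ipv_lincomb_left:
  assumes "finite_measure M" "bdd_measurable_vec M f" "bdd_measurable_vec M f'" "bdd_measurable_vec M g"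
  shows "ipv M (\<lambda>x. c *s f x + f' x) g = c * ipv M f g + ipv M f' g"
  using assms bdd_measurable_vec_lincomb[OF assms(2,3), of c]
  by (simp add: ipv_sum_components ip_lincomb_left bdd_measurable_vec_def sum.distrib sum_distrib_left)

lemma ipv_sym: "ipv M g f = cnj (ipv M f g)"
proof -
  have "cnj (ipv M f g) = (LINT x|M. cnj (cdot (f x) (g x)))"
    unfolding ipv_def by (rule Bochner_Integration.integral_cnj[symmetric])
  then show ?thesis by (simp add: ipv_def cdot_def mult.commute)
qed

lemma ipv_lincomb_right:
  assumes "finite_measure M" "bdd_measurable_vec M f" "bdd_measurable_vec M g" "bdd_measurable_vec M g'"
  shows "ipv M f (\<lambda>x. c *s g x + g' x) = cnj c * ipv M f g + ipv M f g'"
  using ipv_lincomb_left[OF assms(1,3,4,2), of c]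
  by (simp add: ipv_sym[of M f])

lemma ip_self: "Im (ip M f f) = 0" "0 \<le> Re (ip M f f)"
proof -
  have "ip M f f = complex_of_real (LINT x|M. (cmod (f x))\<^sup>2)"
    unfolding ip_def integral_complex_of_real[symmetric]
    by (simp add: complex_norm_square del: of_real_power)
  then show "Im (ip M f f) = 0" "0 \<le> Re (ip M f f)" by simp_all
qed

lemma ip_self_eq_0:
  assumes "finite_measure M" "bdd_measurable M f" "Re (ip M f f) = 0"
  shows "AE x in M. f x = 0"
proof -
  have int: "integrable M (\<lambda>x. complex_of_real ((cmod (f x))\<^sup>2))"
    using integrable_mult_cnj[OF assms(1,2,2)] by (simp add: complex_norm_square del: of_real_power)
  have "ip M f f = complex_of_real (LINT x|M. (cmod (f x))\<^sup>2)"
    unfolding ip_def integral_complex_of_real[symmetric]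
    by (simp add: complex_norm_square del: of_real_power)
  then have "(LINT x|M. (cmod (f x))\<^sup>2) = 0" using assms(3) by simp
  moreover have "integrable M (\<lambda>x. (cmod (f x))\<^sup>2)" using int complex_of_real_integrable_eq by blast
  ultimately have "AE x in M. (cmod (f x))\<^sup>2 = 0"
    by (subst (asm) integral_nonneg_eq_0_iff_AE) auto
  then show ?thesis by auto
qed

lemma ipv_self:
  assumes "finite_measure M" "bdd_measurable_vec M f"
  shows "Im (ipv M f f) = 0" "0 \<le> Re (ipv M f f)"
  unfolding ipv_sum_components[OF assms(1,2,2)] by (simp_all add: ip_self sum_nonneg)

lemma ipv_self_eq_0:
  fixes f :: "'a \<Rightarrow> complex^'d"
  assumes "finite_measure M" "bdd_measurable_vec M f" "Re (ipv M f f) = 0"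
  shows "AE x in M. f x = 0"
proof -
  have "(\<Sum>i\<in>UNIV. Re (ip M (\<lambda>x. f x $ i) (\<lambda>x. f x $ i))) = 0"
    using assms(3) unfolding ipv_sum_components[OF assms(1,2,2)] by simp
  then have "Re (ip M (\<lambda>x. f x $ i) (\<lambda>x. f x $ i)) = 0" for i
    by (subst (asm) sum_nonneg_eq_0_iff) (auto simp: ip_self)
  then have "AE x in M. f x $ i = 0" for i
    using assms(1,2) unfolding bdd_measurable_vec_def by (intro ip_self_eq_0) auto
  then have "AE x in M. \<forall>i\<in>UNIV. f x $ i = 0" by (intro AE_finite_allI) auto
  then show ?thesis by (auto simp: vec_eq_iff)
qed

section \<open>Surface measures of faces and of the boundary\<close>

lemma finite_measure_surface_on:
  fixes A :: "(real^'d) set"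
  assumes "2 \<le> CARD('d)" "A \<in> sets borel" "hausdorff_outer (real CARD('d) - 1) A < top"
  shows "finite_measure (surface_on A)"
proof (rule finite_measureI)
  have "emeasure (surface_on A) (space (surface_on A)) = emeasure (hausdorff_measure (real CARD('d) - 1)) A"
    unfolding surface_on_def space_restrict_space using assms
    by (subst emeasure_restrict_space) auto
  then show "emeasure (surface_on A) (space (surface_on A)) \<noteq> \<infinity>"
    using assms by (simp add: emeasure_hausdorff_measure)
qed

lemma space_surface_on [simp]: "space (surface_on A) = A"
  by (simp add: surface_on_def space_restrict_space)

lemma AE_surface_on_iff:
  fixes A :: "(real^'d) set"
  assumes "A \<in> sets borel"
  shows "(AE x in surface_on A. P x) \<longleftrightarrow> (AE x in hausdorff_measure (real CARD('d) - 1). x \<in> A \<longrightarrow> P x)"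
  unfolding surface_on_def using assms by (intro AE_restrict_space_iff) simp

lemma AE_surface_onE:
  fixes A :: "(real^'d) set"
  assumes "2 \<le> CARD('d)" "A \<in> sets borel" "AE x in surface_on A. P x"
  obtains N where "hausdorff_outer (real CARD('d) - 1) N = 0" "\<And>x. x \<in> A \<Longrightarrow> x \<notin> N \<Longrightarrow> P x"
    "N \<in> sets borel"
proof -
  obtain N where "{x \<in> space (hausdorff_measure (real CARD('d) - 1)). \<not> (x \<in> A \<longrightarrow> P x)} \<subseteq> N"
    "emeasure (hausdorff_measure (real CARD('d) - 1)) N = 0" "N \<in> sets (hausdorff_measure (real CARD('d) - 1))"
    using assms(3) unfolding AE_surface_on_iff[OF assms(2)] by (rule AE_E)
  then show ?thesis using assms(1) by (intro that[of N]) (auto simp: emeasure_hausdorff_measure)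
qed

lemma bdd_measurable_surface_continuous:
  fixes A :: "(real^'d) set"
  assumes "continuous_on A f" "compact A"
  shows "bdd_measurable (surface_on A) f"
  unfolding bdd_measurable_def
proof
  have "sets (surface_on A) = sets (restrict_space borel A)"
    unfolding surface_on_def by (rule sets_restrict_space_cong) simp
  then show "f \<in> borel_measurable (surface_on A)"
    using borel_measurable_continuous_on_restrict[OF assms(1)] measurable_cong_sets by blast
  show "\<exists>B. \<forall>x\<in>space (surface_on A). cmod (f x) \<le> B"
    using compact_imp_bounded[OF compact_continuous_image[OF assms]] by (auto simp: bounded_iff)
qed

lemma hausdorff_outer_finite_subadditive:
  assumes "finite I"
  shows "hausdorff_outer s (\<Union>i\<in>I. A i) \<le> (\<Sum>i\<in>I. hausdorff_outer s (A i))"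
  using assms
proof (induction I rule: finite_induct)
  case (insert i I)
  define D where "D n = (if n = 0 then A i else if n = 1 then (\<Union>i\<in>I. A i) else {})" for n :: nat
  have "(\<Union>j\<in>insert i I. A j) \<subseteq> (\<Union>n. D n)" by (auto simp: D_def split: if_splits)
  then have "hausdorff_outer s (\<Union>j\<in>insert i I. A j) \<le> (\<Sum>n. hausdorff_outer s (D n))"
    using hausdorff_outer_mono hausdorff_outer_subadditive by (metis order_trans)
  also have "\<dots> = (\<Sum>n\<in>{0,1}. hausdorff_outer s (D n))"
    by (rule suminf_finite) (auto simp: D_def)
  also have "\<dots> \<le> (\<Sum>i\<in>insert i I. hausdorff_outer s (A i))"
    using insert by (simp add: D_def add_left_mono)
  finally show ?case .
qed simp

lemma hausdorff_outer_finite_Union: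
  assumes "finite I" "\<And>i. i \<in> I \<Longrightarrow> hausdorff_outer s (A i) < top"
  shows "hausdorff_outer s (\<Union>i\<in>I. A i) < top"
  by (rule le_less_trans[OF hausdorff_outer_finite_subadditive[OF assms(1)]]) (use assms in simp)

text \<open>Beyond \<open>x\<close> in the direction of the normal lies an open piece of the exterior.\<close>

lemma outward_unit_normal_not_interior_closure:
  assumes "outward_unit_normal_at S x \<nu>"
  shows "x \<notin> interior (closure S)"
proof
  assume "x \<in> interior (closure S)"
  then obtain r' where r': "r' > 0" "ball x r' \<subseteq> closure S" by (meson mem_interior)
  have \<nu>: "norm \<nu> = 1" using assms by (simp add: outward_unit_normal_at_def)
  obtain r where r: "r > 0" "\<forall>y\<in>ball x r. (y - x) \<bullet> \<nu> > 1/2 * norm (y - x) \<longrightarrow> y \<notin> S"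
    using assms unfolding outward_unit_normal_at_def by (meson half_gt_zero zero_less_one)
  define U where "U = ball x r \<inter> {y. 1/2 * norm (y - x) < (y - x) \<bullet> \<nu>}"
  have "open U" unfolding U_def by (intro open_Int open_ball open_Collect_less continuous_intros)
  define t where "t = min r r' / 2"
  have t: "0 < t" "t < r" "t < r'" using r r' by (auto simp: t_def)
  define y where "y = x + t *\<^sub>R \<nu>"
  have y: "y - x = t *\<^sub>R \<nu>" "dist x y = t" using t \<nu> by (simp_all add: y_def dist_norm)
  have "y \<in> U" using y t \<nu> by (auto simp: U_def dot_square_norm)
  moreover have "y \<in> closure S" using y t r' by auto
  ultimately have "U \<inter> S \<noteq> {}" using \<open>open U\<close> open_Int_closure_eq_empty[of U S] by blast
  then show False using r by (auto simp: U_def)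
qed

context mesh
begin

lemma face_compact: "e \<in> interior_faces T \<Longrightarrow> compact e"
  unfolding interior_faces_def using element_compact element_closed by (auto intro!: compact_Int_closed)

lemma face_in_hyperplane:
  assumes "e \<in> interior_faces T"
  obtains \<nu> c where "norm (\<nu> :: real^'d) = 1" "\<And>x. x \<in> e \<Longrightarrow> \<nu> \<bullet> x = c"
  by (rule interior_face_cases[OF assms]) (rule that)

lemma finite_measure_face: "e \<in> interior_faces T \<Longrightarrow> finite_measure (surface_on e)"
proof (rule finite_measure_surface_on[OF dim2])
  assume e: "e \<in> interior_faces T"
  show "e \<in> sets borel" using face_compact[OF e] by (simp add: compact_imp_closed)
  from e obtain \<nu> c where \<nu>: "norm (\<nu> :: real^'d) = 1" "\<And>x. x \<in> e \<Longrightarrow> \<nu> \<bullet> x = c"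
    by (rule face_in_hyperplane) (rule that)
  have "\<nu> \<noteq> 0" using \<nu>(1) by auto
  then show "hausdorff_outer (real CARD('d) - 1) e < top"
    using hausdorff_outer_bounded_hyperplane_finite[OF dim2 compact_imp_bounded[OF face_compact[OF e]] \<nu>(2)]
    by blast
qed

text \<open>The boundary of an element consists of finitely many facets, each a bounded part of a hyperplane.\<close>

lemma hausdorff_outer_frontier_element: "K \<in> T \<Longrightarrow> hausdorff_outer (real CARD('d) - 1) (frontier K) < top"
proof -
  assume K: "K \<in> T"
  have fr: "frontier K = (\<Union>F\<in>{F. F facet_of K}. F)"
    using rel_frontier_of_polyhedron[OF polytope_imp_polyhedron[OF element_polytope[OF K]]]
      rel_frontier_nonempty_interior[OF element_interior[OF K]] by simp
  have "hausdorff_outer (real CARD('d) - 1) F < top" if F: "F facet_of K" for F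
  proof -
    have "aff_dim K = int CARD('d)" by (rule aff_dim_simplex[OF simplex[OF K]])
    then have "aff_dim F = int (DIM(real^'d) - 1)" using F dim2 by (simp add: facet_of_def of_nat_diff)
    then have "\<exists>a b. a \<noteq> 0 \<and> affine hull F = {x. a \<bullet> x = b}"
      by (rule aff_dim_eq_hyperplane[THEN iffD1])
    then obtain a b where a: "a \<noteq> 0" "affine hull F = {x. a \<bullet> x = b}" by (elim exE conjE)
    have "bounded F"
      by (rule bounded_subset[OF compact_imp_bounded[OF element_compact[OF K]] facet_of_imp_subset[OF F]])
    moreover have "a \<bullet> x = b" if "x \<in> F" for x
      using hull_inc[OF that, of affine] unfolding a(2) by simp
    ultimately show ?thesis using a(1) by (rule hausdorff_outer_bounded_hyperplane_finite[OF dim2])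
  qed
  then show ?thesis
    unfolding fr
    by (intro hausdorff_outer_finite_Union finite_polytope_facets element_polytope[OF K]) (simp only: mem_Collect_eq)
qed

text \<open>The interior of an element lies in the interior of the closure of the domain, where no boundary
  point has an outward normal.\<close>

lemma frontier_interior_null:
  obtains N where "hausdorff_outer (real CARD('d) - 1) N = 0" "\<And>x K. x \<in> frontier \<Omega> \<Longrightarrow> K \<in> T \<Longrightarrow> x \<in> interior K \<Longrightarrow> x \<in> N"
proof -
  obtain N where N: "hausdorff_outer (real CARD('d) - 1) N = 0"
    "\<And>x. x \<in> frontier \<Omega> \<Longrightarrow> x \<notin> N \<Longrightarrow> \<exists>\<nu>. outward_unit_normal_at \<Omega> x \<nu>"
    using AE_surface_onE[OF dim2 _ normal_AE] by (metis borel_closed frontier_closed)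
  show ?thesis
  proof (rule that[OF N(1)])
    fix x K assume x: "x \<in> frontier \<Omega>" "K \<in> T" "x \<in> interior K"
    then have "x \<in> interior (closure \<Omega>)" using Union_T interior_mono[of K "closure \<Omega>"] by blast
    then show "x \<in> N" using N(2)[OF x(1)] outward_unit_normal_not_interior_closure by blast
  qed
qed

lemma bdry_part_compact: "K \<in> T \<Longrightarrow> compact (K \<inter> frontier \<Omega>)"
  using element_compact by (simp add: compact_Int_closed)

text \<open>Up to a null set, the part of the boundary in an element lies on the boundary of the element.\<close>

lemma finite_measure_bdry: "K \<in> T \<Longrightarrow> finite_measure (surface_on (K \<inter> frontier \<Omega>))"
proof (rule finite_measure_surface_on[OF dim2])
  assume K: "K \<in> T"
  show "K \<inter> frontier \<Omega> \<in> sets borel"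
    using bdry_part_compact[OF K] by (simp add: compact_imp_closed)
  obtain N where N: "hausdorff_outer (real CARD('d) - 1) N = 0"
    "\<And>x K. x \<in> frontier \<Omega> \<Longrightarrow> K \<in> T \<Longrightarrow> x \<in> interior K \<Longrightarrow> x \<in> N"
    by (rule frontier_interior_null) (rule that)
  have "K \<inter> frontier \<Omega> \<subseteq> (\<Union>A\<in>{frontier K, N}. A)"
    using N(2)[OF _ K] element_closed[OF K] by (auto simp: frontier_def)
  then have "hausdorff_outer (real CARD('d) - 1) (K \<inter> frontier \<Omega>) \<le> hausdorff_outer (real CARD('d) - 1) (\<Union>A\<in>{frontier K, N}. A)"
    by (rule hausdorff_outer_mono)
  also have "\<dots> < top"
    using hausdorff_outer_frontier_element[OF K] N(1) by (intro hausdorff_outer_finite_Union) auto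
  finally show "hausdorff_outer (real CARD('d) - 1) (K \<inter> frontier \<Omega>) < top" .
qed

lemma finite_measure_domain: "finite_measure (lebesgue_on \<Omega>)"
  using bounded_domain open_domain
  by (intro finite_measure_lebesgue_on lmeasurable_open)

lemma bdd_measurable_V: "v \<in> V \<Longrightarrow> bdd_measurable (lebesgue_on \<Omega>) v"
proof -
  assume v: "v \<in> V"
  have "bdd_measurable (lebesgue_on \<Omega>) (\<lambda>x. if x \<in> interior K then piece K v x else 0)" if K: "K \<in> T" for K
    unfolding bdd_measurable_def
  proof
    have "(\<lambda>x. if x \<in> interior K then piece K v x else 0) \<in> borel_measurable borel"
      by (rule measurable_If) (simp_all add: borel_measurable_continuous_onI continuous_on_affine_form)
    then have "(\<lambda>x. if x \<in> interior K then piece K v x else 0) \<in> borel_measurable lebesgue"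
      using measurable_completion[of _ lborel borel] by simp
    then show "(\<lambda>x. if x \<in> interior K then piece K v x else 0) \<in> borel_measurable (lebesgue_on \<Omega>)"
      by (rule measurable_restrict_space1)
    have "bounded (piece K v ` K)"
      by (intro compact_imp_bounded compact_continuous_image continuous_on_affine_form element_compact[OF K])
    then obtain B where "\<And>x. x \<in> K \<Longrightarrow> cmod (piece K v x) \<le> B" by (auto simp: bounded_iff)
    then have "cmod (if x \<in> interior K then piece K v x else 0) \<le> max 0 B" for x
      using interior_subset[of K] by (auto intro: max.coboundedI2)
    then show "\<exists>B. \<forall>x\<in>space (lebesgue_on \<Omega>). cmod (if x \<in> interior K then piece K v x else 0) \<le> B"
      by blast
  qed
  then have "bdd_measurable (lebesgue_on \<Omega>) (\<lambda>x. \<Sum>K\<in>T. if x \<in> interior K then piece K v x else 0)"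
    by (rule bdd_measurable_sum)
  moreover have "bdd_measurable (lebesgue_on \<Omega>) v
      \<longleftrightarrow> bdd_measurable (lebesgue_on \<Omega>) (\<lambda>x. \<Sum>K\<in>T. if x \<in> interior K then piece K v x else 0)"
    by (rule bdd_measurable_cong) (rule V_sum_pieces[OF v])
  ultimately show ?thesis by blast
qed

lemma bdd_measurable_vec_Sigma: "\<tau> \<in> \<Sigma> \<Longrightarrow> bdd_measurable_vec (lebesgue_on \<Omega>) \<tau>"
  unfolding bdd_measurable_vec_def using bdd_measurable_V Sigma_component by blast

lemma bdd_measurable_trace_V:
  assumes "v \<in> V" "K \<in> T" "A \<subseteq> K" "compact A"
  shows "bdd_measurable (surface_on A) (trace_from K v)"
proof -
  have "bdd_measurable (surface_on A) (piece K v)"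
    by (rule bdd_measurable_surface_continuous[OF continuous_on_affine_form assms(4)])
  then show ?thesis
    using bdd_measurable_cong[of "surface_on A" "trace_from K v" "piece K v"] trace_V[OF assms(1,2) subsetD[OF assms(3)]]
    by simp
qed

lemma bdd_measurable_vec_trace_Sigma:
  assumes "\<tau> \<in> \<Sigma>" "K \<in> T" "A \<subseteq> K" "compact A"
  shows "bdd_measurable_vec (surface_on A) (trace_from K \<tau>)"
  unfolding bdd_measurable_vec_def
proof
  fix i
  have "bdd_measurable (surface_on A) (piece K (\<lambda>y. \<tau> y $ i))"
    by (rule bdd_measurable_surface_continuous[OF continuous_on_affine_form assms(4)])
  moreover have "trace_from K \<tau> x $ i = piece K (\<lambda>y. \<tau> y $ i) x" if "x \<in> A" for x
    using trace_Sigma[OF assms(1,2), of x] assms(3) that by auto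
  ultimately show "bdd_measurable (surface_on A) (\<lambda>x. trace_from K \<tau> x $ i)"
    using bdd_measurable_cong[of "surface_on A" "\<lambda>x. trace_from K \<tau> x $ i" "piece K (\<lambda>y. \<tau> y $ i)"] by simp
qed

end

section \<open>Sesquilinearity of the method\<close>

lemma integrable_square_integrable_mult_cnj:
  assumes "finite_measure M" "square_integrable M f" "bdd_measurable M v"
  shows "integrable M (\<lambda>x. f x * cnj (v x))"
proof -
  interpret finite_measure M by fact
  obtain B where B: "\<And>x. x \<in> space M \<Longrightarrow> cmod (v x) \<le> B" and v: "v \<in> borel_measurable M"
    using assms(3) unfolding bdd_measurable_def by blast
  have [measurable]: "(\<lambda>x. cnj (v x)) \<in> borel_measurable M"
    using measurable_compose[OF v borel_measurable_continuous_onI[OF continuous_on_cnj[OF continuous_on_id]]] .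
  have [measurable]: "f \<in> borel_measurable M" using assms(2) by (simp add: square_integrable_def)
  have "integrable M (\<lambda>x. \<bar>B\<bar> * (1 + (cmod (f x))\<^sup>2))"
    using assms(2) unfolding square_integrable_def by (intro integrable_mult_right integrable_add) auto
  then show ?thesis
  proof (rule Bochner_Integration.integrable_bound)
    show "AE x in M. norm (f x * cnj (v x)) \<le> norm (\<bar>B\<bar> * (1 + (cmod (f x))\<^sup>2))"
    proof (rule AE_I2)
      fix x assume "x \<in> space M"
      have "cmod (f x) \<le> 1 + (cmod (f x))\<^sup>2"
      proof -
        have "0 \<le> (cmod (f x))\<^sup>2 - 2 * cmod (f x) + 1"
          using zero_le_power2[of "cmod (f x) - 1"] by (simp add: power2_diff)
        then show ?thesis using zero_le_power2[of "cmod (f x)"] by linarith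
      qed
      moreover have "cmod (v x) \<le> \<bar>B\<bar>" using B[OF \<open>x \<in> space M\<close>] by linarith
      ultimately have "cmod (f x) * cmod (v x) \<le> (1 + (cmod (f x))\<^sup>2) * \<bar>B\<bar>" by (intro mult_mono) auto
      then show "norm (f x * cnj (v x)) \<le> norm (\<bar>B\<bar> * (1 + (cmod (f x))\<^sup>2))"
        by (simp add: norm_mult abs_mult mult.commute)
    qed
  qed measurable
qed

lemma ip_square_integrable_lincomb_right:
  assumes "finite_measure M" "square_integrable M f" "bdd_measurable M v" "bdd_measurable M w"
  shows "ip M f (\<lambda>x. c * v x + w x) = cnj c * ip M f v + ip M f w"
  using integrable_square_integrable_mult_cnj[OF assms(1,2,3)]
    integrable_square_integrable_mult_cnj[OF assms(1,2,4)]
  by (simp add: ip_def distrib_left mult.left_commute)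

lemma square_integrable_surface_on_subset:
  fixes A B :: "(real^'d) set"
  assumes "A \<subseteq> B" "A \<in> sets borel" "B \<in> sets borel" "square_integrable (surface_on B) f"
  shows "square_integrable (surface_on A) f"
  unfolding square_integrable_def
proof
  let ?H = "hausdorff_measure (real CARD('d) - 1) :: (real^'d) measure"
  have "f \<in> borel_measurable (restrict_space ?H B)"
    using assms(4) by (simp add: square_integrable_def surface_on_def)
  then show "f \<in> borel_measurable (surface_on A)"
    unfolding surface_on_def by (rule measurable_restrict_mono) fact
  have "integrable ?H (\<lambda>x. indicator B x *\<^sub>R (cmod (f x))\<^sup>2)"
    using assms(3,4) by (simp add: square_integrable_def surface_on_def integrable_restrict_space)
  from integrable_mult_indicator[OF _ this, of A]
  have "integrable ?H (\<lambda>x. indicator A x *\<^sub>R indicator B x *\<^sub>R (cmod (f x))\<^sup>2)" using assms(2) by simp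
  also have "(\<lambda>x. indicator A x *\<^sub>R indicator B x *\<^sub>R (cmod (f x))\<^sup>2) = (\<lambda>x. indicator A x *\<^sub>R (cmod (f x))\<^sup>2)"
    using assms(1) by (auto simp: fun_eq_iff indicator_def)
  finally show "integrable (surface_on A) (\<lambda>x. (cmod (f x))\<^sup>2)"
    using assms(2) by (simp add: surface_on_def integrable_restrict_space)
qed

lemma cdot_lincomb_left: "cdot (c *s a + b) z = c * cdot a z + cdot b z"
  by (simp add: cdot_def distrib_right sum.distrib sum_distrib_left mult.assoc)

lemma cdot_diff_left: "cdot (a - b) z = cdot a z - cdot b z"
  by (simp add: cdot_def left_diff_distrib sum_subtractf)

lemma cdot_minus_right: "cdot a (- z) = - cdot a z"
  by (simp add: cdot_def sum_negf)

lemma cvec_minus: "cvec (- \<nu>) = - cvec \<nu>"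
  by (simp add: cvec_def vec_eq_iff)

context mesh
begin

lemma trace_V_lincomb:
  assumes "v \<in> V" "w \<in> V" "K \<in> T" "x \<in> K"
  shows "trace_from K (\<lambda>x. c * v x + w x) x = c * trace_from K v x + trace_from K w x"
  by (simp only: trace_V[OF assms(1,3,4)] trace_V[OF assms(2,3,4)]
      trace_V[OF V_lincomb[OF assms(1,2)] assms(3,4)] piece_lincomb[OF assms(1-3)] affine_form_lincomb)

lemma trace_Sigma_component:
  assumes "\<tau> \<in> \<Sigma>" "K \<in> T" "x \<in> K"
  shows "trace_from K \<tau> x $ i = trace_from K (\<lambda>y. \<tau> y $ i) x"
  using trace_Sigma[OF assms] trace_V[OF Sigma_component[OF assms(1), of i] assms(2,3)] by simp

lemma trace_Sigma_lincomb:
  assumes "\<tau> \<in> \<Sigma>" "\<tau>' \<in> \<Sigma>" "K \<in> T" "x \<in> K"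
  shows "trace_from K (\<lambda>x. c *s \<tau> x + \<tau>' x) x = c *s trace_from K \<tau> x + trace_from K \<tau>' x"
  unfolding vec_eq_iff
  using trace_V_lincomb[OF Sigma_component[OF assms(1)] Sigma_component[OF assms(2)] assms(3,4)]
  by (simp add: trace_Sigma_component assms Sigma_lincomb)

lemma jump_lincomb:
  assumes "v \<in> V" "w \<in> V" "x \<in> e"
  shows "jump T e (\<lambda>x. c * v x + w x) x = c *s jump T e v x + jump T e w x"
proof -
  have "jump T e (\<lambda>x. c * v x + w x) x
      = (\<Sum>K\<in>{K\<in>T. e \<subseteq> K}. c *s (trace_from K v x *s cvec (face_normal K e)) + trace_from K w x *s cvec (face_normal K e))"
    unfolding jump_def
  proof (rule sum.cong)
    fix K assume "K \<in> {K\<in>T. e \<subseteq> K}"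
    then have "K \<in> T" "x \<in> K" using assms(3) by auto
    then show "trace_from K (\<lambda>x. c * v x + w x) x *s cvec (face_normal K e)
        = c *s (trace_from K v x *s cvec (face_normal K e)) + trace_from K w x *s cvec (face_normal K e)"
      by (simp add: trace_V_lincomb[OF assms(1,2)] vec_eq_iff distrib_right)
  qed simp
  then show ?thesis
    by (simp add: jump_def vec_eq_iff sum.distrib sum_component sum_distrib_left mult.assoc)
qed

lemma avg_lincomb:
  assumes "\<tau> \<in> \<Sigma>" "\<tau>' \<in> \<Sigma>" "x \<in> e"
  shows "avg T e (\<lambda>x. c *s \<tau> x + \<tau>' x) x = c *s avg T e \<tau> x + avg T e \<tau>' x"
proof -
  have "(\<Sum>K\<in>{K\<in>T. e \<subseteq> K}. trace_from K (\<lambda>x. c *s \<tau> x + \<tau>' x) x)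
      = (\<Sum>K\<in>{K\<in>T. e \<subseteq> K}. c *s trace_from K \<tau> x + trace_from K \<tau>' x)"
    using assms(3) by (intro sum.cong trace_Sigma_lincomb[OF assms(1,2)]) auto
  then show ?thesis
    by (simp add: avg_def vec_eq_iff sum.distrib sum_component sum_distrib_left scaleR_right_distrib)
qed

lemma jumpv_lincomb:
  assumes "\<tau> \<in> \<Sigma>" "\<tau>' \<in> \<Sigma>" "x \<in> e"
  shows "jumpv T e (\<lambda>x. c *s \<tau> x + \<tau>' x) x = c * jumpv T e \<tau> x + jumpv T e \<tau>' x"
proof -
  have "jumpv T e (\<lambda>x. c *s \<tau> x + \<tau>' x) x = (\<Sum>K\<in>{K\<in>T. e \<subseteq> K}.
      c * cdot (trace_from K \<tau> x) (cvec (face_normal K e)) + cdot (trace_from K \<tau>' x) (cvec (face_normal K e)))"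
    unfolding jumpv_def
  proof (rule sum.cong)
    fix K assume "K \<in> {K\<in>T. e \<subseteq> K}"
    then have "K \<in> T" "x \<in> K" using assms(3) by auto
    then show "cdot (trace_from K (\<lambda>x. c *s \<tau> x + \<tau>' x) x) (cvec (face_normal K e))
        = c * cdot (trace_from K \<tau> x) (cvec (face_normal K e)) + cdot (trace_from K \<tau>' x) (cvec (face_normal K e))"
      by (simp add: trace_Sigma_lincomb[OF assms(1,2)] cdot_lincomb_left)
  qed simp
  then show ?thesis by (simp add: jumpv_def sum.distrib sum_distrib_left)
qed

lemma bdd_measurable_vec_jump: "v \<in> V \<Longrightarrow> e \<in> interior_faces T \<Longrightarrow> bdd_measurable_vec (surface_on e) (jump T e v)"
  unfolding bdd_measurable_vec_def jump_def sum_component vector_smult_component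
  by (auto intro!: bdd_measurable_sum bdd_measurable_mult bdd_measurable_const bdd_measurable_trace_V face_compact)

lemma bdd_measurable_vec_avg: "\<tau> \<in> \<Sigma> \<Longrightarrow> e \<in> interior_faces T \<Longrightarrow> bdd_measurable_vec (surface_on e) (avg T e \<tau>)"
  unfolding bdd_measurable_vec_def avg_def sum_component vector_scaleR_component scaleR_conv_of_real
  by (auto intro!: bdd_measurable_sum bdd_measurable_mult bdd_measurable_const bdd_measurable_vec_trace_Sigma[unfolded bdd_measurable_vec_def, rule_format] face_compact)

lemma bdd_measurable_jumpv: "\<tau> \<in> \<Sigma> \<Longrightarrow> e \<in> interior_faces T \<Longrightarrow> bdd_measurable (surface_on e) (jumpv T e \<tau>)"
  unfolding jumpv_def cdot_def
  by (auto intro!: bdd_measurable_sum bdd_measurable_mult bdd_measurable_const bdd_measurable_vec_trace_Sigma[unfolded bdd_measurable_vec_def, rule_format] face_compact)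

text \<open>The form splits into these three face terms, each linear in its first argument, and terms
  over the domain and its boundary. Sesquilinearity and the energy identity are read off from
  this decomposition.\<close>

definition jump_form :: "(real^'d \<Rightarrow> complex) \<Rightarrow> (real^'d \<Rightarrow> complex) \<Rightarrow> complex" where
  "jump_form w v = (\<Sum>e\<in>interior_faces T. ipv (surface_on e) (jump T e w) (jump T e v))"

definition avg_jump_form :: "(real^'d \<Rightarrow> complex^'d) \<Rightarrow> (real^'d \<Rightarrow> complex) \<Rightarrow> complex" where
  "avg_jump_form \<tau> v = (\<Sum>e\<in>interior_faces T. ipv (surface_on e) (avg T e \<tau>) (jump T e v))"

definition normal_jump_form :: "(real^'d \<Rightarrow> complex^'d) \<Rightarrow> (real^'d \<Rightarrow> complex^'d) \<Rightarrow> complex" where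
  "normal_jump_form s \<tau> = (\<Sum>e\<in>interior_faces T. ip (surface_on e) (jumpv T e s) (jumpv T e \<tau>))"

lemma A_h_eq:
  assumes "w \<in> V" "s \<in> \<Sigma>" "v \<in> V" "\<tau> \<in> \<Sigma>"
  shows "A_h \<Omega> T k \<beta> \<delta> w s v \<tau> =
     ipv (lebesgue_on \<Omega>) s (grad_h T v)
   - of_real (k\<^sup>2) * ip (lebesgue_on \<Omega>) w v
   + \<i> * of_real k * bdry_ip \<Omega> T w v
   - avg_jump_form (grad_h T w) v + \<i> * of_real \<beta> * jump_form w v
   - \<i> * of_real \<delta> * normal_jump_form (grad_h T w) \<tau> + cnj (avg_jump_form \<tau> w)
   + ipv (lebesgue_on \<Omega>) s \<tau>
   - ipv (lebesgue_on \<Omega>) (grad_h T w) \<tau>"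
proof -
  have flux: "ipv (surface_on e) (\<lambda>x. avg T e (grad_h T w) x - (\<i> * of_real \<beta>) *s jump T e w x) (jump T e v)
      = ipv (surface_on e) (avg T e (grad_h T w)) (jump T e v)
        - \<i> * of_real \<beta> * ipv (surface_on e) (jump T e w) (jump T e v)" if "e \<in> interior_faces T" for e
  proof -
    have "(\<lambda>x. avg T e (grad_h T w) x - (\<i> * of_real \<beta>) *s jump T e w x)
        = (\<lambda>x. (- (\<i> * of_real \<beta>)) *s jump T e w x + avg T e (grad_h T w) x)"
      by (simp add: fun_eq_iff vec_eq_iff)
    then show ?thesis
      using ipv_lincomb_left[OF finite_measure_face[OF that] bdd_measurable_vec_jump[OF assms(1) that]
          bdd_measurable_vec_avg[OF grad_h_Sigma[OF assms(1)] that] bdd_measurable_vec_jump[OF assms(3) that], of "- (\<i> * of_real \<beta>)"]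
      by simp
  qed
  have sym: "ipv (surface_on e) (jump T e w) (avg T e \<tau>)
      = cnj (ipv (surface_on e) (avg T e \<tau>) (jump T e w))" for e
    by (rule ipv_sym)
  show ?thesis
    unfolding A_h_def jump_form_def avg_jump_form_def normal_jump_form_def
    by (simp add: flux sym sum_subtractf sum_distrib_left)
qed

lemma jump_form_lincomb:
  assumes "w \<in> V" "w' \<in> V" "v \<in> V"
  shows "jump_form (\<lambda>x. c * w x + w' x) v = c * jump_form w v + jump_form w' v"
proof -
  have "ipv (surface_on e) (jump T e (\<lambda>x. c * w x + w' x)) (jump T e v)
      = c * ipv (surface_on e) (jump T e w) (jump T e v) + ipv (surface_on e) (jump T e w') (jump T e v)"
    if "e \<in> interior_faces T" for e
    using assms that
    by (subst ipv_lincomb_left[symmetric]; intro ipv_cong finite_measure_face bdd_measurable_vec_jump)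
      (auto simp: jump_lincomb)
  then show ?thesis by (simp add: jump_form_def sum.distrib sum_distrib_left)
qed

lemma jump_form_sym: "jump_form v w = cnj (jump_form w v)"
  unfolding jump_form_def cnj_sum by (intro sum.cong ipv_sym refl)

lemma avg_jump_form_lincomb_left:
  assumes "\<tau> \<in> \<Sigma>" "\<tau>' \<in> \<Sigma>" "v \<in> V"
  shows "avg_jump_form (\<lambda>x. c *s \<tau> x + \<tau>' x) v = c * avg_jump_form \<tau> v + avg_jump_form \<tau>' v"
proof -
  have "ipv (surface_on e) (avg T e (\<lambda>x. c *s \<tau> x + \<tau>' x)) (jump T e v)
      = c * ipv (surface_on e) (avg T e \<tau>) (jump T e v) + ipv (surface_on e) (avg T e \<tau>') (jump T e v)"
    if "e \<in> interior_faces T" for e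
    using assms that
    by (subst ipv_lincomb_left[symmetric]; intro ipv_cong finite_measure_face bdd_measurable_vec_jump bdd_measurable_vec_avg)
      (auto simp: avg_lincomb)
  then show ?thesis by (simp add: avg_jump_form_def sum.distrib sum_distrib_left)
qed

lemma avg_jump_form_lincomb_right:
  assumes "\<tau> \<in> \<Sigma>" "v \<in> V" "v' \<in> V"
  shows "avg_jump_form \<tau> (\<lambda>x. c * v x + v' x) = cnj c * avg_jump_form \<tau> v + avg_jump_form \<tau> v'"
proof -
  have "ipv (surface_on e) (avg T e \<tau>) (jump T e (\<lambda>x. c * v x + v' x))
      = cnj c * ipv (surface_on e) (avg T e \<tau>) (jump T e v) + ipv (surface_on e) (avg T e \<tau>) (jump T e v')"
    if "e \<in> interior_faces T" for e
    using assms that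
    by (subst ipv_lincomb_right[symmetric]; intro ipv_cong finite_measure_face bdd_measurable_vec_jump bdd_measurable_vec_avg)
      (auto simp: jump_lincomb)
  then show ?thesis by (simp add: avg_jump_form_def sum.distrib sum_distrib_left)
qed

lemma normal_jump_form_lincomb:
  assumes "s \<in> \<Sigma>" "s' \<in> \<Sigma>" "\<tau> \<in> \<Sigma>"
  shows "normal_jump_form (\<lambda>x. c *s s x + s' x) \<tau> = c * normal_jump_form s \<tau> + normal_jump_form s' \<tau>"
proof -
  have "ip (surface_on e) (jumpv T e (\<lambda>x. c *s s x + s' x)) (jumpv T e \<tau>)
      = c * ip (surface_on e) (jumpv T e s) (jumpv T e \<tau>) + ip (surface_on e) (jumpv T e s') (jumpv T e \<tau>)"
    if "e \<in> interior_faces T" for e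
    using assms that
    by (subst ip_lincomb_left[symmetric]; intro ip_cong finite_measure_face bdd_measurable_jumpv)
      (auto simp: jumpv_lincomb)
  then show ?thesis by (simp add: normal_jump_form_def sum.distrib sum_distrib_left)
qed

lemma normal_jump_form_sym: "normal_jump_form \<tau> s = cnj (normal_jump_form s \<tau>)"
  unfolding normal_jump_form_def cnj_sum by (intro sum.cong ip_sym refl)

lemma bdry_ip_lincomb:
  assumes "w \<in> V" "w' \<in> V" "v \<in> V"
  shows "bdry_ip \<Omega> T (\<lambda>x. c * w x + w' x) v = c * bdry_ip \<Omega> T w v + bdry_ip \<Omega> T w' v"
proof -
  have "ip (surface_on (K \<inter> frontier \<Omega>)) (trace_from K (\<lambda>x. c * w x + w' x)) (trace_from K v)
      = c * ip (surface_on (K \<inter> frontier \<Omega>)) (trace_from K w) (trace_from K v)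
        + ip (surface_on (K \<inter> frontier \<Omega>)) (trace_from K w') (trace_from K v)"
    if "K \<in> T" for K
    using assms that
    by (subst ip_lincomb_left[symmetric]; intro ip_cong finite_measure_bdry bdd_measurable_trace_V bdry_part_compact)
      (auto simp: trace_V_lincomb)
  then show ?thesis by (simp add: bdry_ip_def sum.distrib sum_distrib_left)
qed

lemma bdry_ip_sym: "bdry_ip \<Omega> T v w = cnj (bdry_ip \<Omega> T w v)"
  unfolding bdry_ip_def cnj_sum by (intro sum.cong ip_sym refl)

lemma grad_h_lincomb_fun:
  "v \<in> V \<Longrightarrow> w \<in> V \<Longrightarrow> grad_h T (\<lambda>x. c * v x + w x) = (\<lambda>x. c *s grad_h T v x + grad_h T w x)"
  by (rule ext) (rule grad_h_lincomb)

lemma A_h_lincomb_left: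
  assumes "w \<in> V" "w' \<in> V" "s \<in> \<Sigma>" "s' \<in> \<Sigma>" "v \<in> V" "\<tau> \<in> \<Sigma>"
  shows "A_h \<Omega> T k \<beta> \<delta> (\<lambda>x. c * w x + w' x) (\<lambda>x. c *s s x + s' x) v \<tau>
    = c * A_h \<Omega> T k \<beta> \<delta> w s v \<tau> + A_h \<Omega> T k \<beta> \<delta> w' s' v \<tau>"
  by (simp add: assms A_h_eq V_lincomb Sigma_lincomb grad_h_Sigma grad_h_lincomb_fun jump_form_lincomb
      avg_jump_form_lincomb_left avg_jump_form_lincomb_right normal_jump_form_lincomb bdry_ip_lincomb
      ipv_lincomb_left ip_lincomb_left finite_measure_domain bdd_measurable_V bdd_measurable_vec_Sigma)
    (simp add: algebra_simps)

lemma A_h_lincomb_right: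
  assumes "w \<in> V" "s \<in> \<Sigma>" "v \<in> V" "v' \<in> V" "\<tau> \<in> \<Sigma>" "\<tau>' \<in> \<Sigma>"
  shows "A_h \<Omega> T k \<beta> \<delta> w s (\<lambda>x. c * v x + v' x) (\<lambda>x. c *s \<tau> x + \<tau>' x)
    = cnj c * A_h \<Omega> T k \<beta> \<delta> w s v \<tau> + A_h \<Omega> T k \<beta> \<delta> w s v' \<tau>'"
proof -
  have jump: "jump_form w (\<lambda>x. c * v x + v' x) = cnj c * jump_form w v + jump_form w v'"
    using jump_form_lincomb[OF assms(3,4,1), of c] by (simp add: jump_form_sym[of w])
  have normal: "normal_jump_form (grad_h T w) (\<lambda>x. c *s \<tau> x + \<tau>' x)
      = cnj c * normal_jump_form (grad_h T w) \<tau> + normal_jump_form (grad_h T w) \<tau>'"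
    using normal_jump_form_lincomb[OF assms(5,6) grad_h_Sigma[OF assms(1)], of c]
    by (simp add: normal_jump_form_sym[of "grad_h T w"])
  have bdry: "bdry_ip \<Omega> T w (\<lambda>x. c * v x + v' x) = cnj c * bdry_ip \<Omega> T w v + bdry_ip \<Omega> T w v'"
    using bdry_ip_lincomb[OF assms(3,4,1), of c] by (simp add: bdry_ip_sym[of w])
  show ?thesis
    by (simp add: assms A_h_eq V_lincomb Sigma_lincomb grad_h_Sigma grad_h_lincomb_fun jump normal bdry
        avg_jump_form_lincomb_left avg_jump_form_lincomb_right
        ipv_lincomb_right ip_lincomb_right finite_measure_domain bdd_measurable_V bdd_measurable_vec_Sigma)
      (simp add: algebra_simps)
qed

lemma load_lincomb:
  assumes f: "square_integrable (lebesgue_on \<Omega>) f" and g: "square_integrable (surface_on (frontier \<Omega>)) g"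
    and v: "v \<in> V" "v' \<in> V"
  shows "load \<Omega> T f g (\<lambda>x. c * v x + v' x) = cnj c * load \<Omega> T f g v + load \<Omega> T f g v'"
proof -
  have "ip (surface_on (K \<inter> frontier \<Omega>)) g (trace_from K (\<lambda>x. c * v x + v' x))
      = cnj c * ip (surface_on (K \<inter> frontier \<Omega>)) g (trace_from K v)
        + ip (surface_on (K \<inter> frontier \<Omega>)) g (trace_from K v')" if K: "K \<in> T" for K
  proof -
    have g_K: "square_integrable (surface_on (K \<inter> frontier \<Omega>)) g"
      by (rule square_integrable_surface_on_subset[OF _ _ _ g])
        (use bdry_part_compact[OF K] in \<open>auto simp: compact_imp_closed\<close>)
    have bdd_measurable: "bdd_measurable (surface_on (K \<inter> frontier \<Omega>)) (trace_from K w)" if "w \<in> V" for w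
      by (rule bdd_measurable_trace_V[OF that K _ bdry_part_compact[OF K]]) simp
    show ?thesis
      unfolding ip_square_integrable_lincomb_right[OF finite_measure_bdry[OF K] g_K bdd_measurable[OF v(1)] bdd_measurable[OF v(2)], symmetric]
      by (rule ip_cong) (use trace_V_lincomb[OF v K] in auto)
  qed
  then show ?thesis
    using ip_square_integrable_lincomb_right[OF finite_measure_domain f bdd_measurable_V[OF v(1)] bdd_measurable_V[OF v(2)], of c]
    by (simp add: load_def sum.distrib sum_distrib_left algebra_simps)
qed

end

section \<open>Affine functions vanishing almost everywhere on faces or on the boundary\<close>

text \<open>Were the cylinder negligible, it would lie in a hyperplane. This would be the hyperplane of \<open>e\<close>,
  but it would also contain the direction \<open>j\<close>.\<close>

lemma affine_face_cylinder_not_negligible: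
  fixes e :: "(real^'d) set"
  assumes e: "aff_dim e = int CARD('d) - 1" "convex e" "e \<subseteq> {x. \<nu> \<bullet> x = c}" and \<nu>: "norm \<nu> = 1"
    and j: "\<nu> $ j \<noteq> 0"
  shows "\<not> negligible (cylinder j e)"
proof
  have convex: "convex (cylinder j e)"
    unfolding convex_def
  proof (intro ballI allI impI)
    fix x y u v assume "x \<in> cylinder j e" "y \<in> cylinder j e" and uv: "0 \<le> (u::real)" "0 \<le> v" "u + v = 1"
    then obtain p q where pq: "p \<in> e" "q \<in> e" "\<forall>i. i \<noteq> j \<longrightarrow> x $ i = p $ i" "\<forall>i. i \<noteq> j \<longrightarrow> y $ i = q $ i"
      by (auto simp: cylinder_def)
    have "u *\<^sub>R p + v *\<^sub>R q \<in> e" using e(2) pq uv by (auto simp: convex_def)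
    then show "u *\<^sub>R x + v *\<^sub>R y \<in> cylinder j e"
      using pq unfolding cylinder_def by (intro CollectI bexI[of _ "u *\<^sub>R p + v *\<^sub>R q"]) auto
  qed
  assume "negligible (cylinder j e)"
  then have "interior (cylinder j e) = {}" using negligible_convex_interior[OF convex] by blast
  from empty_interior_subset_hyperplane[OF convex this]
  obtain a b where a: "a \<noteq> 0" and ab: "cylinder j e \<subseteq> {x. a \<bullet> x = b}" by blast
  have "e \<subseteq> cylinder j e" by (auto simp: cylinder_def)
  then have "e \<subseteq> {x. a \<bullet> x = b}" using ab by blast
  moreover have "\<nu> \<noteq> 0" using \<nu> by auto
  ultimately have "{x. \<nu> \<bullet> x = c} \<subseteq> {x. a \<bullet> x = b}"
    using affine_hull_codim1_eq_hyperplane[OF e(1,3)] affine_hull_codim1_eq_hyperplane[OF e(1) _ a] by blast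
  from hyperplane_inclusion_parallel[OF this \<nu>] have par: "a = (a \<bullet> \<nu>) *\<^sub>R \<nu>" .
  have "e \<noteq> {}" using e(1) by auto
  then obtain y where y: "y \<in> e" by blast
  then have "y \<in> cylinder j e" "y + axis j 1 \<in> cylinder j e"
    unfolding cylinder_def by (auto simp: axis_def intro!: bexI[of _ y])
  then have "a \<bullet> y = b" "a \<bullet> (y + axis j 1) = b" using ab by blast+
  then have "a $ j = 0" by (simp add: inner_add_right inner_axis)
  then have "(a \<bullet> \<nu>) * \<nu> $ j = 0" using par by (metis vector_scaleR_component real_scaleR_def)
  then have "a = 0" using par j by simp
  then show False using a by blast
qed

text \<open>On the hyperplane, the function agrees with one that does not depend on the coordinate \<open>j\<close>.
  The latter vanishes on a cylinder that is not negligible, hence everywhere.\<close>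

lemma affine_zero_AE_on_face:
  fixes e :: "(real^'d) set"
  assumes d: "2 \<le> CARD('d)"
    and e: "aff_dim e = int CARD('d) - 1" "convex e" "e \<subseteq> {x. \<nu> \<bullet> x = c}" and \<nu>: "norm \<nu> = 1"
    and N: "hausdorff_outer (real CARD('d) - 1) N = 0"
    and zero: "\<And>x. x \<in> e \<Longrightarrow> x \<notin> N \<Longrightarrow> affine_form a b x = 0"
  obtains t where "b = t *s cvec \<nu>" "a = - t * complex_of_real c"
proof -
  have "\<nu> \<noteq> 0" using \<nu> by auto
  then obtain j where j: "\<nu> $ j \<noteq> 0" by (auto simp: vec_eq_iff)
  define t where "t = b $ j / complex_of_real (\<nu> $ j)"
  define a' b' where "a' = a + t * complex_of_real c" and "b' = b - t *s cvec \<nu>"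
  have b'j: "b' $ j = 0" using j by (simp add: b'_def t_def cvec_def)
  have on_e: "affine_form a' b' x = affine_form a b x" if "\<nu> \<bullet> x = c" for x
    using affine_form_diff[of a "- t * complex_of_real c" b "t *s cvec \<nu>" x] that
    by (simp add: a'_def b'_def affine_form_cvec)
  have "cylinder j e \<subseteq> cylinder j N \<union> {x. affine_form a' b' x = 0}"
  proof
    fix x assume "x \<in> cylinder j e"
    then obtain y where y: "y \<in> e" "\<forall>i. i \<noteq> j \<longrightarrow> x $ i = y $ i" by (auto simp: cylinder_def)
    show "x \<in> cylinder j N \<union> {x. affine_form a' b' x = 0}"
    proof (cases "y \<in> N")
      case True
      then show ?thesis using y by (auto simp: cylinder_def)
    next
      case False
      have "b' $ i * complex_of_real (x $ i) = b' $ i * complex_of_real (y $ i)" for i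
        using y(2) b'j by (cases "i = j") auto
      then have "affine_form a' b' x = affine_form a' b' y" by (simp only: affine_form_def)
      also have "\<dots> = 0" using on_e[of y] zero[OF y(1) False] y(1) e(3) by auto
      finally show ?thesis by blast
    qed
  qed
  then have "\<not> negligible (cylinder j N \<union> {x. affine_form a' b' x = 0})"
    using affine_face_cylinder_not_negligible[OF e \<nu> j] negligible_subset by blast
  then have "\<not> negligible {x. affine_form a' b' x = 0}" using negligible_cylinder[OF d N] by auto
  then have "a' = 0 \<and> b' = 0" using negligible_affine_form_zeros by blast
  then show ?thesis by (intro that[of t]) (auto simp: a'_def b'_def add_eq_0_iff)
qed

lemma face_not_null:
  fixes e :: "(real^'d) set"
  assumes d: "2 \<le> CARD('d)"
    and e: "aff_dim e = int CARD('d) - 1" "convex e" "e \<subseteq> {x. \<nu> \<bullet> x = c}" and \<nu>: "norm \<nu> = 1"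
    and N: "hausdorff_outer (real CARD('d) - 1) N = 0"
  obtains x where "x \<in> e" "x \<notin> N"
proof -
  have "\<nu> \<noteq> 0" using \<nu> by auto
  then obtain j where j: "\<nu> $ j \<noteq> 0" by (auto simp: vec_eq_iff)
  have "\<not> e \<subseteq> N"
  proof
    assume "e \<subseteq> N"
    then have "cylinder j e \<subseteq> cylinder j N" by (auto simp: cylinder_def)
    then show False
      using affine_face_cylinder_not_negligible[OF e \<nu> j] negligible_cylinder[OF d N] negligible_subset by blast
  qed
  then show ?thesis using that by blast
qed

lemma exits_through_frontier:
  fixes S :: "'a::euclidean_space set"
  assumes "open S" "bounded S" "x \<in> S" "v \<noteq> 0"
  obtains t where "t > 0" "x + t *\<^sub>R v \<in> frontier S"
proof -
  obtain B where B: "\<And>y. y \<in> S \<Longrightarrow> norm y \<le> B" using assms(2) by (auto simp: bounded_iff)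
  define M where "M = (B + norm x + 1) / norm v"
  have "0 \<le> B" using B[OF assms(3)] norm_ge_zero order_trans by blast
  then have M: "0 < M" using assms(4) by (auto simp: M_def intro!: divide_pos_pos add_nonneg_pos)
  have "x + M *\<^sub>R v \<notin> S"
  proof
    assume "x + M *\<^sub>R v \<in> S"
    then have "norm (M *\<^sub>R v) \<le> B + norm x"
      using B[of "x + M *\<^sub>R v"] norm_triangle_ineq4[of "x + M *\<^sub>R v" x] by simp
    moreover have "norm (M *\<^sub>R v) = B + norm x + 1" using assms(4) M \<open>0 \<le> B\<close> by (simp add: M_def)
    ultimately show False by simp
  qed
  then have "closed_segment x (x + M *\<^sub>R v) \<inter> frontier S \<noteq> {}"
    using assms(3) by (intro connected_Int_frontier) auto
  then obtain u where u: "0 \<le> u" "u \<le> 1" "(1 - u) *\<^sub>R x + u *\<^sub>R (x + M *\<^sub>R v) \<in> frontier S"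
    by (auto simp: closed_segment_def)
  have eq: "(1 - u) *\<^sub>R x + u *\<^sub>R (x + M *\<^sub>R v) = x + (u * M) *\<^sub>R v" by (simp add: algebra_simps)
  have "u \<noteq> 0" using u(3) assms(1,3) frontier_disjoint_eq[of S] by auto
  then show ?thesis using that[of "u * M"] u M eq by simp
qed

text \<open>Every line in a coordinate direction leaves the domain through two boundary points, and the
  affine function vanishes at both only if it is constant in that direction. For a suitable
  coordinate, one of the two points thus lies in the exceptional null set, whose cylinder would
  contain the domain.\<close>

lemma affine_zero_AE_on_frontier:
  fixes \<Omega> :: "(real^'d) set"
  assumes d: "2 \<le> CARD('d)" and \<Omega>: "open \<Omega>" "bounded \<Omega>" "\<Omega> \<noteq> {}"
    and N: "hausdorff_outer (real CARD('d) - 1) N = 0"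
    and zero: "\<And>x. x \<in> frontier \<Omega> \<Longrightarrow> x \<notin> N \<Longrightarrow> affine_form a b x = 0"
  shows "a = 0 \<and> b = 0"
proof (rule ccontr)
  assume nz: "\<not> (a = 0 \<and> b = 0)"
  obtain j where j: "b \<noteq> 0 \<Longrightarrow> b $ j \<noteq> 0"
    by (cases "b = 0") (auto simp: vec_eq_iff)
  have "\<Omega> \<subseteq> cylinder j N"
  proof
    fix x assume x: "x \<in> \<Omega>"
    have ax: "axis j 1 \<noteq> (0 :: real^'d)" by (simp add: axis_eq_0_iff)
    obtain s where s: "s > 0" "x + s *\<^sub>R axis j 1 \<in> frontier \<Omega>"
      using exits_through_frontier[OF \<Omega>(1,2) x ax] .
    obtain t where t: "t > 0" "x + t *\<^sub>R (- axis j 1) \<in> frontier \<Omega>"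
      using exits_through_frontier[OF \<Omega>(1,2) x, of "- axis j 1"] ax by auto
    have affine_form: "affine_form a b (x + r *\<^sub>R axis j 1) = affine_form a b x + complex_of_real r * b $ j" for r
    proof -
      have "(\<Sum>i\<in>UNIV. b $ i * complex_of_real (r * axis j 1 $ i))
          = (\<Sum>i\<in>UNIV. if i = j then complex_of_real r * b $ j else 0)"
        by (rule sum.cong) (auto simp: axis_def)
      then show ?thesis by (simp add: affine_form_def distrib_left sum.distrib)
    qed
    have in_cyl: "x \<in> cylinder j N" if "x + r *\<^sub>R axis j 1 \<in> N" for r
      using that unfolding cylinder_def by (intro CollectI bexI[of _ "x + r *\<^sub>R axis j 1"]) (auto simp: axis_def)
    show "x \<in> cylinder j N"
    proof (rule ccontr)
      assume "x \<notin> cylinder j N"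
      then have "affine_form a b (x + s *\<^sub>R axis j 1) = 0" "affine_form a b (x + (- t) *\<^sub>R axis j 1) = 0"
        using zero s t in_cyl[of s] in_cyl[of "- t"] by auto
      then have eqs: "affine_form a b x + complex_of_real s * b $ j = 0" "affine_form a b x - complex_of_real t * b $ j = 0"
        unfolding affine_form by auto
      have "complex_of_real (s + t) * b $ j
          = (affine_form a b x + complex_of_real s * b $ j) - (affine_form a b x - complex_of_real t * b $ j)"
        by (simp add: algebra_simps)
      then have "complex_of_real (s + t) * b $ j = 0" unfolding eqs by simp
      moreover have "complex_of_real (s + t) \<noteq> 0" using s t by (metis add_pos_pos of_real_eq_0_iff less_irrefl)
      ultimately have "b $ j = 0" by simp
      then have "b = 0" using j by blast
      then have "a = 0" using eqs by simp
      then show False using nz \<open>b = 0\<close> by blast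
    qed
  qed
  then have "negligible \<Omega>" using negligible_cylinder[OF d N] negligible_subset by blast
  then show False using open_not_negligible \<Omega> by blast
qed

lemma vector_smult_diff_opposite: "p *s z + q *s (- z) = (p - q) *s (z :: complex^'d)"
  by (simp add: vec_eq_iff left_diff_distrib)

context mesh
begin

section \<open>Connectedness of the mesh through faces\<close>

text \<open>If two classes of elements did not share a face, they would meet in dimension at most
  \<open>d - 2\<close> only. By connectedness of the domain they do meet inside it; but near a common point, a
  segment in general position joins the two classes without passing through their intersection.\<close>

lemma face_connected:
  assumes P: "P \<subseteq> T" "P \<noteq> {}"
    and step: "\<And>K L. K \<in> P \<Longrightarrow> L \<in> T \<Longrightarrow> aff_dim (K \<inter> L) = int CARD('d) - 1 \<Longrightarrow> L \<in> P"
  shows "P = T"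
proof (rule ccontr)
  assume "P \<noteq> T"
  define Q where "Q = T - P"
  have Q: "Q \<noteq> {}" "Q \<subseteq> T" using P \<open>P \<noteq> T\<close> by (auto simp: Q_def)
  have closed: "closed (\<Union>P)" "closed (\<Union>Q)"
    using P Q finite_T element_closed by (auto intro!: closed_Union intro: finite_subset)
  have cover: "\<Omega> \<subseteq> \<Union>P \<union> \<Union>Q"
    using Union_T closure_subset[of \<Omega>] P(1) unfolding Q_def by blast
  have meets: "K \<inter> \<Omega> \<noteq> {}" if "K \<in> T" for K
    using interior_meets_domain[OF that] interior_subset[of K] by blast
  have "\<Union>P \<inter> \<Omega> \<noteq> {}" "\<Union>Q \<inter> \<Omega> \<noteq> {}" using meets P Q by blast+
  then have "\<Union>P \<inter> \<Union>Q \<inter> \<Omega> \<noteq> {}"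
    using connected_closedD[OF connected_domain _ cover closed] by blast
  then obtain x K L where x: "x \<in> \<Omega>" "x \<in> K" "x \<in> L" and K: "K \<in> P" and L: "L \<in> Q" by blast
  have KT: "K \<in> T" and LT: "L \<in> T" using K L P Q by auto
  obtain r where r: "r > 0" "ball x r \<subseteq> \<Omega>" using open_domain x(1) by (meson openE)
  have xball: "x \<in> ball x r" using r by simp
  have meets_ball: "interior M \<inter> ball x r \<noteq> {}" if "M \<in> T" "x \<in> M" for M
    using open_Int_closure_eq_empty[OF open_ball[of x r], of "interior M"] that(2) xball
    unfolding closure_interior_element[OF that(1)] by blast
  obtain a where a: "a \<in> interior K" "a \<in> ball x r" using meets_ball[OF KT x(2)] by blast
  have "negligible (affine hull (insert a (K' \<inter> L')))" if "K' \<in> P" "L' \<in> Q" for K' L'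
  proof -
    have T: "K' \<in> T" "L' \<in> T" "K' \<noteq> L'" using that P Q by (auto simp: Q_def)
    have conv: "convex (K' \<inter> L')" using T element_convex by (simp add: convex_Int)
    have "aff_dim (K' \<inter> L') \<noteq> int CARD('d)"
    proof
      assume "aff_dim (K' \<inter> L') = int CARD('d)"
      then have dim: "aff_dim (K' \<inter> L') = int (DIM(real^'d))" by simp
      then have "affine hull (K' \<inter> L') = UNIV" "K' \<inter> L' \<noteq> {}" by (simp only: aff_dim_eq_full, auto)
      then have "interior (K' \<inter> L') \<noteq> {}"
        using rel_interior_interior[of "K' \<inter> L'"] rel_interior_eq_empty[OF conv] by simp
      then show False using interiors_disjoint[OF T] by (simp add: interior_Int)
    qed
    moreover have "aff_dim (K' \<inter> L') \<noteq> int CARD('d) - 1" using step[OF that(1) T(2)] that(2) by (auto simp: Q_def)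
    moreover have "aff_dim (K' \<inter> L') \<le> int CARD('d)" using aff_dim_le_DIM[of "K' \<inter> L'"] by simp
    ultimately have "aff_dim (affine hull (insert a (K' \<inter> L'))) < int (DIM(real^'d))"
      by (simp add: aff_dim_insert)
    then obtain n c where "n \<noteq> 0" "affine hull (insert a (K' \<inter> L')) \<subseteq> {y. n \<bullet> y = c}"
      by (rule aff_lowdim_subset_hyperplane)
    then show ?thesis using negligible_hyperplane negligible_subset by blast
  qed
  then have "negligible (\<Union>(K',L')\<in>P \<times> Q. affine hull (insert a (K' \<inter> L')))"
    by (intro negligible_Union finite_imageI finite_cartesian_product
        finite_subset[OF P(1) finite_T] finite_subset[OF Q(2) finite_T]) auto
  moreover have "\<not> negligible (interior L \<inter> ball x r)"
    by (rule open_not_negligible[OF _ meets_ball[OF LT x(3)]]) auto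
  ultimately obtain b where b: "b \<in> interior L" "b \<in> ball x r"
    "\<And>K' L'. K' \<in> P \<Longrightarrow> L' \<in> Q \<Longrightarrow> b \<notin> affine hull (insert a (K' \<inter> L'))"
    using negligible_subset[of "\<Union>(K',L')\<in>P \<times> Q. affine hull (insert a (K' \<inter> L'))" "interior L \<inter> ball x r"]
    by blast
  have "closed_segment a b \<subseteq> ball x r" using a b by (simp add: closed_segment_subset)
  then have "closed_segment a b \<subseteq> \<Union>P \<union> \<Union>Q" using r cover by blast
  moreover have "a \<in> K" "b \<in> L" using a(1) b(1) interior_subset by blast+
  then have "\<Union>P \<inter> closed_segment a b \<noteq> {}" "\<Union>Q \<inter> closed_segment a b \<noteq> {}"
    using K L ends_in_segment[of a b] by blast+
  ultimately have "\<Union>P \<inter> \<Union>Q \<inter> closed_segment a b \<noteq> {}"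
    using connected_closedD[OF connected_segment(1)[of a b] _ _ closed] by blast
  then obtain z K' L' where z: "z \<in> closed_segment a b" "z \<in> K'" "z \<in> L'" "K' \<in> P" "L' \<in> Q" by blast
  obtain u where u: "z = (1 - u) *\<^sub>R a + u *\<^sub>R b" using z(1) by (auto simp: closed_segment_def)
  show False
  proof (cases "u = 0")
    case True
    then have "a \<in> L'" using u z by simp
    moreover have LT': "L' \<in> T" "K \<noteq> L'" using z K P Q by (auto simp: Q_def)
    ultimately have "interior K \<inter> interior L' \<noteq> {}"
      using closure_interior_element[OF LT'(1)] a(1) open_Int_closure_eq_empty[OF open_interior[of K], of "interior L'"]
      by auto
    then show False using interiors_disjoint[OF KT LT'] by blast
  next
    case False
    have "(1 / u) *\<^sub>R z = (1 / u - 1) *\<^sub>R a + b"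
      using False by (simp add: u scaleR_right_distrib diff_divide_distrib)
    then have "b = (1 - 1 / u) *\<^sub>R a + (1 / u) *\<^sub>R z"
      by (simp add: scaleR_left_diff_distrib)
    moreover have "(1 - 1 / u) *\<^sub>R a + (1 / u) *\<^sub>R z \<in> affine hull (insert a (K' \<inter> L'))"
      by (rule mem_affine[OF affine_affine_hull]) (use z in \<open>auto intro: hull_inc\<close>)
    ultimately show False using b(3)[OF z(4,5)] by simp
  qed
qed

section \<open>Nondegeneracy of the method\<close>

lemma V_eq_zeroI:
  assumes v: "v \<in> V" and zero: "AE x in lebesgue_on \<Omega>. v x = 0"
  shows "v x = 0"
proof (cases "x \<in> (\<Union>K\<in>T. interior K)")
  case True
  then obtain K where K: "K \<in> T" "x \<in> interior K" by blast
  have "AE x in lebesgue. x \<in> \<Omega> \<longrightarrow> v x = 0"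
    using zero AE_restrict_space_iff[of \<Omega> lebesgue "\<lambda>x. v x = 0"] open_domain by (auto simp: borel_open)
  then obtain N where "{x \<in> space lebesgue. \<not> (x \<in> \<Omega> \<longrightarrow> v x = 0)} \<subseteq> N" "emeasure lebesgue N = 0"
    "N \<in> sets lebesgue" by (rule AE_E)
  then have N: "negligible N" "\<And>x. x \<in> \<Omega> \<Longrightarrow> x \<notin> N \<Longrightarrow> v x = 0"
    by (auto simp: negligible_iff_null_sets null_sets_def)
  have "interior K \<inter> \<Omega> \<subseteq> N \<union> {x. piece K v x = 0}"
    using N(2) V_piece[OF v K(1)] by force
  moreover have "\<not> negligible (interior K \<inter> \<Omega>)"
    using interior_meets_domain[OF K(1)] open_domain by (intro open_not_negligible) auto
  ultimately have "\<not> negligible {x. piece K v x = 0}"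
    using N(1) negligible_subset negligible_Un_eq by blast
  then have "piece_const K v = 0" "piece_grad K v = 0" using negligible_affine_form_zeros by blast+
  then show ?thesis using V_piece[OF v K] by simp
qed (rule V_outside[OF v])

text \<open>As \<open>u\<close> does not jump, the difference of the two pieces vanishes on the hyperplane of the face; it is
  thus a multiple \<open>t\<close> of \<open>\<nu> \<bullet> x - c\<close>. As the gradient does not jump in the normal direction,
  \<open>t = 0\<close>.\<close>

lemma pieces_agree_across_face:
  assumes u: "u \<in> V" and KL: "K \<in> T" "L \<in> T" "aff_dim (K \<inter> L) = int CARD('d) - 1"
    and jump0: "\<And>e. e \<in> interior_faces T \<Longrightarrow> AE x in surface_on e. jump T e u x = 0"
    and jumpv0: "\<And>e. e \<in> interior_faces T \<Longrightarrow> AE x in surface_on e. jumpv T e (grad_h T u) x = 0"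
  shows "piece_const K u = piece_const L u \<and> piece_grad K u = piece_grad L u"
proof (cases "K = L")
  case False
  define e where "e = K \<inter> L"
  have e: "e \<in> interior_faces T" using KL False unfolding interior_faces_def e_def by blast
  have dim: "aff_dim e = int CARD('d) - 1" using KL(3) by (simp add: e_def)
  have conv: "convex e" using KL element_convex by (simp add: e_def convex_Int)
  have borel: "e \<in> sets borel" using face_compact[OF e] by (simp add: compact_imp_closed)
  obtain K' L' \<nu> c where KL': "K' \<in> T" "L' \<in> T" "K' \<noteq> L'" "e = K' \<inter> L'"
    "{M\<in>T. e \<subseteq> M} = {K', L'}" and \<nu>: "norm \<nu> = 1" "face_normal K' e = \<nu>" "face_normal L' e = - \<nu>"
    and hyp: "\<And>x. x \<in> e \<Longrightarrow> \<nu> \<bullet> x = c"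
    by (rule interior_face_cases[OF e]) (rule that)
  have hyp': "e \<subseteq> {x. \<nu> \<bullet> x = c}" using hyp by blast
  have "K \<in> {M\<in>T. e \<subseteq> M}" "L \<in> {M\<in>T. e \<subseteq> M}" using KL by (auto simp: e_def)
  then have same: "K = K' \<or> K = L'" "L = K' \<or> L = L'" unfolding KL'(5) by simp_all
  obtain N where N: "hausdorff_outer (real CARD('d) - 1) N = 0" "\<And>x. x \<in> e \<Longrightarrow> x \<notin> N \<Longrightarrow> jump T e u x = 0"
    using AE_surface_onE[OF dim2 borel jump0[OF e]] by metis
  obtain M where M: "hausdorff_outer (real CARD('d) - 1) M = 0"
    "\<And>x. x \<in> e \<Longrightarrow> x \<notin> M \<Longrightarrow> jumpv T e (grad_h T u) x = 0"
    using AE_surface_onE[OF dim2 borel jumpv0[OF e]] by metis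
  define a b where "a = piece_const K' u - piece_const L' u" and "b = piece_grad K' u - piece_grad L' u"
  have "\<nu> \<noteq> 0" using \<nu> by auto
  then obtain j where j: "\<nu> $ j \<noteq> 0" by (auto simp: vec_eq_iff)
  have "affine_form a b x = 0" if x: "x \<in> e" "x \<notin> N" for x
  proof -
    have "x \<in> K'" "x \<in> L'" using x KL' by auto
    then have "jump T e u x = affine_form a b x *s cvec \<nu>"
      unfolding jump_def KL'(5) a_def b_def affine_form_diff using KL'(1-3) \<nu>
      by (simp add: trace_V[OF u] cvec_minus vector_smult_diff_opposite)
    then have "affine_form a b x * cvec \<nu> $ j = 0" using N(2)[OF x] by (metis vector_smult_component zero_index)
    then show ?thesis using j by (simp add: cvec_def)
  qed
  then obtain t where t: "b = t *s cvec \<nu>" "a = - t * complex_of_real c"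
    using affine_zero_AE_on_face[OF dim2 dim conv hyp' \<nu>(1) N(1)] by blast
  obtain x where x: "x \<in> e" "x \<notin> M" by (rule face_not_null[OF dim2 dim conv hyp' \<nu>(1) M(1)])
  have "x \<in> K'" "x \<in> L'" using x KL' by auto
  then have "jumpv T e (grad_h T u) x = cdot b (cvec \<nu>)"
    unfolding jumpv_def KL'(5) b_def cdot_diff_left using KL'(1-3) \<nu>
    by (simp add: trace_grad_h[OF u] cvec_minus cdot_minus_right)
  also have "\<dots> = t * complex_of_real (\<nu> \<bullet> \<nu>)"
    unfolding t by (simp add: cdot_def cvec_def inner_vec_def sum_distrib_left mult.assoc)
  also have "\<dots> = t" using \<nu>(1) by (simp add: dot_square_norm)
  finally have "t = 0" using M(2)[OF x] by simp
  then have "a = 0" "b = 0" using t by simp_all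
  then have "piece_const K' u = piece_const L' u \<and> piece_grad K' u = piece_grad L' u"
    by (simp add: a_def b_def)
  then show ?thesis using same by auto
qed simp

lemma avg_jump_form_zero: "v \<in> V \<Longrightarrow> avg_jump_form (\<lambda>x. 0) v = 0" "\<tau> \<in> \<Sigma> \<Longrightarrow> avg_jump_form \<tau> (\<lambda>x. 0) = 0"
  using avg_jump_form_lincomb_left[OF Sigma_zero Sigma_zero, of v 1]
    avg_jump_form_lincomb_right[OF _ V_zero V_zero, of \<tau> 1] by simp_all

lemma jump_form_zero: "v \<in> V \<Longrightarrow> jump_form (\<lambda>x. 0) v = 0" "v \<in> V \<Longrightarrow> jump_form v (\<lambda>x. 0) = 0"
  using jump_form_lincomb[OF V_zero V_zero, of v 1] by (simp_all add: jump_form_sym[of v])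

lemma normal_jump_form_zero: "\<tau> \<in> \<Sigma> \<Longrightarrow> normal_jump_form (\<lambda>x. 0) \<tau> = 0" "\<tau> \<in> \<Sigma> \<Longrightarrow> normal_jump_form \<tau> (\<lambda>x. 0) = 0"
  using normal_jump_form_lincomb[OF Sigma_zero Sigma_zero, of \<tau> 1] by (simp_all add: normal_jump_form_sym[of \<tau>])

lemma bdry_ip_zero: "v \<in> V \<Longrightarrow> bdry_ip \<Omega> T (\<lambda>x. 0) v = 0" "v \<in> V \<Longrightarrow> bdry_ip \<Omega> T v (\<lambda>x. 0) = 0"
  using bdry_ip_lincomb[OF V_zero V_zero, of v 1] by (simp_all add: bdry_ip_sym[of v])

lemma ip_zero: "ip M (\<lambda>x. 0) v = 0" "ip M v (\<lambda>x. 0) = 0"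
  by (simp_all add: ip_def)

lemma ipv_zero: "ipv M (\<lambda>x. 0) v = 0" "ipv M v (\<lambda>x. 0) = 0"
  by (simp_all add: ipv_def cdot_def)

lemma grad_h_zero: "grad_h T (\<lambda>x. 0) = (\<lambda>x. 0)"
  using grad_h_lincomb_fun[OF V_zero V_zero, of "-1"] by simp

lemmas form_zeros = avg_jump_form_zero jump_form_zero normal_jump_form_zero bdry_ip_zero ip_zero
  ipv_zero grad_h_zero

text \<open>In the difference of the tests with \<open>(u, 0)\<close> and with \<open>(0, grad u)\<close>, the two terms that pair \<open>\<sigma>\<close>
  with the gradient cancel. The volume terms that remain are real, and so is the sum of the pairings
  of the averaged gradient with the jump, which occur with their conjugates. Only the penalty and
  impedance terms contribute to the imaginary part, all with the same sign.\<close>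

lemma energy_identity:
  assumes u: "u \<in> V" and \<sigma>: "\<sigma> \<in> \<Sigma>"
  shows "Im (A_h \<Omega> T k \<beta> \<delta> u \<sigma> u (\<lambda>x. 0) - A_h \<Omega> T k \<beta> \<delta> u \<sigma> (\<lambda>x. 0) (grad_h T u))
    = k * Re (bdry_ip \<Omega> T u u) + \<beta> * Re (jump_form u u)
      + \<delta> * Re (normal_jump_form (grad_h T u) (grad_h T u))"
proof -
  have "Im (ipv (lebesgue_on \<Omega>) (grad_h T u) (grad_h T u)) = 0" "Im (ip (lebesgue_on \<Omega>) u u) = 0"
    using ipv_self(1)[OF finite_measure_domain bdd_measurable_vec_Sigma[OF grad_h_Sigma[OF u]]] ip_self(1) by auto
  moreover have "of_real (k\<^sup>2) * ip (lebesgue_on \<Omega>) u u = k\<^sup>2 *\<^sub>R ip (lebesgue_on \<Omega>) u u"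
    by (simp add: scaleR_conv_of_real)
  ultimately show ?thesis
    using u \<sigma> by (simp add: A_h_eq V_zero Sigma_zero grad_h_Sigma form_zeros)
qed

text \<open>The energy identity makes the jumps of \<open>u\<close>, the normal jumps of its gradient and its boundary values
  vanish. By the first two, all pieces of \<open>u\<close> are the same affine function, which by the third is 0.
  Then \<open>\<sigma>\<close> is orthogonal to itself.\<close>

lemma A_h_nondegenerate:
  assumes pos: "0 < k" "0 < \<beta>" "0 < \<delta>" and u: "u \<in> V" and \<sigma>: "\<sigma> \<in> \<Sigma>"
    and zero: "\<And>v \<tau>. v \<in> V \<Longrightarrow> \<tau> \<in> \<Sigma> \<Longrightarrow> A_h \<Omega> T k \<beta> \<delta> u \<sigma> v \<tau> = 0"
  shows "u = (\<lambda>x. 0) \<and> \<sigma> = (\<lambda>x. 0)"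
proof -
  let ?G = "grad_h T u"
  let ?B = "\<lambda>K. Re (ip (surface_on (K \<inter> frontier \<Omega>)) (trace_from K u) (trace_from K u))"
  let ?J = "\<lambda>e. Re (ipv (surface_on e) (jump T e u) (jump T e u))"
  let ?N = "\<lambda>e. Re (ip (surface_on e) (jumpv T e ?G) (jumpv T e ?G))"
  have G: "?G \<in> \<Sigma>" by (rule grad_h_Sigma[OF u])
  have fin: "finite (interior_faces T)"
  proof -
    have "interior_faces T \<subseteq> (\<lambda>(K, L). K \<inter> L) ` (T \<times> T)" by (auto simp: interior_faces_def)
    then show ?thesis using finite_T by (meson finite_SigmaI finite_imageI finite_subset)
  qed
  have B0: "0 \<le> ?B K" for K by (rule ip_self)
  have N0: "0 \<le> ?N e" for e by (rule ip_self)
  have J0: "0 \<le> ?J e" if "e \<in> interior_faces T" for e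
    by (rule ipv_self[OF finite_measure_face[OF that] bdd_measurable_vec_jump[OF u that]])
  have sums: "0 \<le> (\<Sum>K\<in>T. ?B K)" "0 \<le> (\<Sum>e\<in>interior_faces T. ?J e)" "0 \<le> (\<Sum>e\<in>interior_faces T. ?N e)"
    using B0 J0 N0 by (auto intro: sum_nonneg)
  have "0 = k * (\<Sum>K\<in>T. ?B K) + \<beta> * (\<Sum>e\<in>interior_faces T. ?J e) + \<delta> * (\<Sum>e\<in>interior_faces T. ?N e)"
    using energy_identity[OF u \<sigma>, of k \<beta> \<delta>] zero[OF u Sigma_zero] zero[OF V_zero G]
    by (simp add: bdry_ip_def jump_form_def normal_jump_form_def)
  moreover have "0 \<le> k * (\<Sum>K\<in>T. ?B K)" "0 \<le> \<beta> * (\<Sum>e\<in>interior_faces T. ?J e)"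
    "0 \<le> \<delta> * (\<Sum>e\<in>interior_faces T. ?N e)" using sums pos by auto
  ultimately have "k * (\<Sum>K\<in>T. ?B K) = 0" "\<beta> * (\<Sum>e\<in>interior_faces T. ?J e) = 0"
    "\<delta> * (\<Sum>e\<in>interior_faces T. ?N e) = 0" by linarith+
  then have sum0: "(\<Sum>K\<in>T. ?B K) = 0" "(\<Sum>e\<in>interior_faces T. ?J e) = 0" "(\<Sum>e\<in>interior_faces T. ?N e) = 0"
    using pos by auto
  have "?B K = 0" if "K \<in> T" for K using sum0(1) B0 finite_T that by (simp add: sum_nonneg_eq_0_iff)
  then have bdry0: "AE x in surface_on (K \<inter> frontier \<Omega>). trace_from K u x = 0" if "K \<in> T" for K
    using that by (intro ip_self_eq_0 finite_measure_bdry bdd_measurable_trace_V[OF u] bdry_part_compact) auto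
  have "?J e = 0" if "e \<in> interior_faces T" for e using sum0(2) J0 fin that by (simp add: sum_nonneg_eq_0_iff)
  then have jump0: "AE x in surface_on e. jump T e u x = 0" if "e \<in> interior_faces T" for e
    using that by (intro ipv_self_eq_0 finite_measure_face bdd_measurable_vec_jump u) auto
  have "?N e = 0" if "e \<in> interior_faces T" for e using sum0(3) N0 fin that by (simp add: sum_nonneg_eq_0_iff)
  then have jumpv0: "AE x in surface_on e. jumpv T e ?G x = 0" if "e \<in> interior_faces T" for e
    using that by (intro ip_self_eq_0 finite_measure_face bdd_measurable_jumpv G) auto
  have "T \<noteq> {}"
  proof
    assume "T = {}"
    then have "closure \<Omega> = {}" using Union_T by simp
    then show False using domain_nonempty by simp
  qed
  then obtain K0 where K0: "K0 \<in> T" by blast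
  define a b where "a = piece_const K0 u" and "b = piece_grad K0 u"
  have "{K\<in>T. piece_const K u = a \<and> piece_grad K u = b} = T"
  proof (rule face_connected)
    show "{K\<in>T. piece_const K u = a \<and> piece_grad K u = b} \<noteq> {}" using K0 a_def b_def by blast
    show "L \<in> {K\<in>T. piece_const K u = a \<and> piece_grad K u = b}"
      if "K \<in> {K\<in>T. piece_const K u = a \<and> piece_grad K u = b}" "L \<in> T"
        "aff_dim (K \<inter> L) = int CARD('d) - 1" for K L
      using pieces_agree_across_face[OF u _ that(2,3) jump0 jumpv0] that by auto
  qed blast
  then have pieces: "piece_const K u = a" "piece_grad K u = b" if "K \<in> T" for K using that by blast+
  have "\<exists>N. hausdorff_outer (real CARD('d) - 1) N = 0 \<and> (\<forall>x\<in>K \<inter> frontier \<Omega>. x \<notin> N \<longrightarrow> affine_form a b x = 0)"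
    if K: "K \<in> T" for K
  proof -
    have "K \<inter> frontier \<Omega> \<in> sets borel" using bdry_part_compact[OF K] by (simp add: compact_imp_closed)
    from AE_surface_onE[OF dim2 this bdry0[OF K]] obtain N where N: "hausdorff_outer (real CARD('d) - 1) N = 0"
      "\<And>x. x \<in> K \<inter> frontier \<Omega> \<Longrightarrow> x \<notin> N \<Longrightarrow> trace_from K u x = 0" by metis
    have "trace_from K u x = affine_form a b x" if "x \<in> K" for x
      using trace_V[OF u K that] pieces[OF K] by simp
    then show ?thesis using N by (intro exI[of _ N]) auto
  qed
  then obtain N where N: "\<And>K. K \<in> T \<Longrightarrow> hausdorff_outer (real CARD('d) - 1) (N K) = 0"
    "\<And>K x. K \<in> T \<Longrightarrow> x \<in> K \<inter> frontier \<Omega> \<Longrightarrow> x \<notin> N K \<Longrightarrow> affine_form a b x = 0" by metis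
  have "hausdorff_outer (real CARD('d) - 1) (\<Union>K\<in>T. N K) \<le> 0"
    using hausdorff_outer_finite_subadditive[OF finite_T, of "real CARD('d) - 1" N] N(1) by simp
  then have N0: "hausdorff_outer (real CARD('d) - 1) (\<Union>K\<in>T. N K) = 0" by simp
  have "affine_form a b x = 0" if "x \<in> frontier \<Omega>" "x \<notin> (\<Union>K\<in>T. N K)" for x
  proof -
    have "x \<in> \<Union>T" using that(1) Union_T by (auto simp: frontier_def)
    then show ?thesis using N(2) that by blast
  qed
  from affine_zero_AE_on_frontier[OF dim2 open_domain bounded_domain domain_nonempty N0 this]
  have ab: "a = 0" "b = 0" by simp_all
  have u0: "u = (\<lambda>x. 0)"
  proof
    fix x show "u x = 0"
    proof (cases "x \<in> (\<Union>K\<in>T. interior K)")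
      case True
      then obtain K where K: "K \<in> T" "x \<in> interior K" by blast
      show ?thesis using V_piece[OF u K] pieces[OF K(1)] ab by simp
    qed (rule V_outside[OF u])
  qed
  have "ipv (lebesgue_on \<Omega>) \<sigma> \<sigma> = 0"
    using zero[OF V_zero \<sigma>] \<sigma> unfolding u0 by (simp add: A_h_eq V_zero form_zeros)
  then have AE0: "AE x in lebesgue_on \<Omega>. \<sigma> x = 0"
    by (intro ipv_self_eq_0 finite_measure_domain bdd_measurable_vec_Sigma \<sigma>) simp
  have "AE x in lebesgue_on \<Omega>. \<sigma> x $ i = 0" for i using AE0 by eventually_elim simp
  then have "\<sigma> x $ i = 0" for x i by (rule V_eq_zeroI[OF Sigma_component[OF \<sigma>]])
  then have "\<sigma> = (\<lambda>x. 0)" by (simp add: fun_eq_iff vec_eq_iff)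
  then show ?thesis using u0 by blast
qed

end

section \<open>Existence from uniqueness\<close>

lemma underdetermined_homogeneous_system:
  fixes m :: "'i \<Rightarrow> 'j \<Rightarrow> 'k::field"
  assumes "finite I" "finite J" "card I < card J"
  shows "\<exists>c. (\<exists>j\<in>J. c j \<noteq> 0) \<and> (\<forall>i\<in>I. (\<Sum>j\<in>J. c j * m i j) = 0)"
  using assms
proof (induction I arbitrary: J m rule: finite_induct)
  case empty
  then have "J \<noteq> {}" by auto
  then show ?case by (intro exI[of _ "\<lambda>_. 1"]) auto
next
  case (insert i I)
  show ?case
  proof (cases "\<forall>j\<in>J. m i j = 0")
    case True
    obtain c where "\<exists>j\<in>J. c j \<noteq> 0" "\<forall>k\<in>I. (\<Sum>j\<in>J. c j * m k j) = 0"
      using insert.IH[OF insert.prems(1), of m] insert.prems insert.hyps by auto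
    then show ?thesis using True by (intro exI[of _ c]) auto
  next
    case False
    then obtain p where p: "p \<in> J" "m i p \<noteq> 0" by blast
    \<comment> \<open>One step of Gaussian elimination, with pivot \<open>p\<close>.\<close>
    let ?m = "\<lambda>k j. m k j - m k p * m i j / m i p"
    have "card I < card (J - {p})" using insert p by simp
    then obtain c where c: "\<exists>j\<in>J-{p}. c j \<noteq> 0" "\<forall>k\<in>I. (\<Sum>j\<in>J-{p}. c j * ?m k j) = 0"
      using insert.IH[of "J - {p}" ?m] insert.prems(1) by auto
    define s where "s = (\<Sum>j\<in>J-{p}. c j * m i j)"
    define c' where "c' = c(p := - s / m i p)"
    have split: "(\<Sum>j\<in>J. c' j * m k j) = - s / m i p * m k p + (\<Sum>j\<in>J-{p}. c j * m k j)" for k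
    proof -
      have "(\<Sum>j\<in>J-{p}. c' j * m k j) = (\<Sum>j\<in>J-{p}. c j * m k j)"
        by (rule sum.cong) (auto simp: c'_def)
      then show ?thesis
        using sum.remove[OF insert.prems(1) p(1), of "\<lambda>j. c' j * m k j"] by (simp add: c'_def)
    qed
    have "(\<Sum>j\<in>J. c' j * m k j) = 0" if "k \<in> I" for k
    proof -
      have "c j * ?m k j = c j * m k j - m k p / m i p * (c j * m i j)" for j
        by (simp add: algebra_simps)
      then have "0 = (\<Sum>j\<in>J-{p}. c j * m k j - m k p / m i p * (c j * m i j))"
        using c(2) that by (metis (no_types, lifting) sum.cong)
      also have "\<dots> = (\<Sum>j\<in>J-{p}. c j * m k j) - m k p / m i p * s"
        by (simp add: sum_subtractf s_def sum_distrib_left)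
      finally show ?thesis unfolding split by simp
    qed
    moreover have "(\<Sum>j\<in>J. c' j * m i j) = 0" unfolding split using p by (simp add: s_def)
    moreover have "\<exists>j\<in>J. c' j \<noteq> 0" using c(1) by (auto simp: c'_def)
    ultimately show ?thesis by blast
  qed
qed

text \<open>Uniqueness implies existence on a finite-dimensional space. In the unknown coefficients of
  \<open>u\<close> and one more unknown \<open>t\<close>, the equation \<open>F u v = t * l v\<close> for basis vectors \<open>v\<close> is a
  homogeneous system with fewer equations than unknowns; a nontrivial solution has \<open>t \<noteq> 0\<close> by
  nondegeneracy, and can be divided by \<open>t\<close>.\<close>

lemma nondegenerate_sesquilinear_unique_solution:
  fixes scale :: "complex \<Rightarrow> 'v::ab_group_add \<Rightarrow> 'v" and F :: "'v \<Rightarrow> 'v \<Rightarrow> complex"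
  assumes "vector_space scale"
    and W: "module.subspace scale W" and fin: "finite S" "W \<subseteq> module.span scale S"
    and left: "\<And>a u u' v. u \<in> W \<Longrightarrow> u' \<in> W \<Longrightarrow> v \<in> W \<Longrightarrow> F (scale a u + u') v = a * F u v + F u' v"
    and right: "\<And>a u v v'. u \<in> W \<Longrightarrow> v \<in> W \<Longrightarrow> v' \<in> W \<Longrightarrow> F u (scale a v + v') = cnj a * F u v + F u v'"
    and functional: "\<And>a v v'. v \<in> W \<Longrightarrow> v' \<in> W \<Longrightarrow> l (scale a v + v') = cnj a * l v + l v'"
    and nondegenerate: "\<And>u. u \<in> W \<Longrightarrow> (\<And>v. v \<in> W \<Longrightarrow> F u v = 0) \<Longrightarrow> u = 0"
  shows "\<exists>!u. u \<in> W \<and> (\<forall>v\<in>W. F u v = l v)"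
proof -
  interpret vector_space scale by fact
  obtain B where B: "B \<subseteq> W" "independent B" "W \<subseteq> span B"
    using maximal_independent_subset[of W] by blast
  have finB: "finite B" using independent_span_bound[OF fin(1) B(2)] B(1) fin(2) by blast
  have W0: "0 \<in> W" using W by (rule subspace_0)
  have combo: "(\<Sum>b\<in>A. scale (c b) b) \<in> W" if "A \<subseteq> B" for A c
    using W B(1) that by (intro subspace_sum subspace_scale) auto
  have left0: "F 0 v = 0" if "v \<in> W" for v using left[OF W0 W0 that, of 1] by simp
  have right0: "F u 0 = 0" if "u \<in> W" for u using right[OF that W0 W0, of 1] by simp
  have l0: "l 0 = 0" using functional[OF W0 W0, of 1] by simp
  have left_sum: "F (\<Sum>b\<in>A. scale (c b) b) v = (\<Sum>b\<in>A. c b * F b v)" if "A \<subseteq> B" "v \<in> W" for A c v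
    using finite_subset[OF that(1) finB] that(1)
  proof (induction A rule: finite_induct)
    case (insert b A)
    then show ?case using left[of b "\<Sum>b\<in>A. scale (c b) b" v "c b"] B(1) combo[of A c] that(2) by auto
  qed (simp add: left0 that)
  have right_sum: "F u (\<Sum>b\<in>A. scale (c b) b) = (\<Sum>b\<in>A. cnj (c b) * F u b)" if "A \<subseteq> B" "u \<in> W" for A c u
    using finite_subset[OF that(1) finB] that(1)
  proof (induction A rule: finite_induct)
    case (insert b A)
    then show ?case using right[of u b "\<Sum>b\<in>A. scale (c b) b" "c b"] B(1) combo[of A c] that(2) by auto
  qed (simp add: right0 that)
  have l_sum: "l (\<Sum>b\<in>A. scale (c b) b) = (\<Sum>b\<in>A. cnj (c b) * l b)" if "A \<subseteq> B" for A c
    using finite_subset[OF that finB] that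
  proof (induction A rule: finite_induct)
    case (insert b A)
    then show ?case using functional[of b "\<Sum>b\<in>A. scale (c b) b" "c b"] B(1) combo[of A c] by auto
  qed (simp add: l0)
  have expand: "\<exists>c. v = (\<Sum>b\<in>B. scale (c b) b)" if "v \<in> W" for v
    using B(3) that unfolding span_finite[OF finB] by blast
  define m where "m v j = (case j of None \<Rightarrow> - l v | Some b \<Rightarrow> F b v)" for v j
  let ?J = "insert None (Some ` B)"
  have J: "finite ?J" "card B < card ?J" using finB by (auto simp: card_image)
  obtain c where c: "\<exists>j\<in>?J. c j \<noteq> 0" "\<forall>v\<in>B. (\<Sum>j\<in>?J. c j * m v j) = 0"
    using underdetermined_homogeneous_system[OF finB J, of m] by blast
  define t where "t = c None"
  define u where "u = (\<Sum>b\<in>B. scale (c (Some b)) b)"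
  have u: "u \<in> W" unfolding u_def by (rule combo) simp
  have u_basis: "F u v = t * l v" if "v \<in> B" for v
  proof -
    have "(\<Sum>j\<in>?J. c j * m v j) = - t * l v + (\<Sum>b\<in>B. c (Some b) * F b v)"
      using finB by (simp add: sum.reindex m_def t_def)
    moreover have "F u v = (\<Sum>b\<in>B. c (Some b) * F b v)"
      unfolding u_def using that B(1) by (intro left_sum) auto
    ultimately show ?thesis using c(2) that by auto
  qed
  have Fu: "F u v = t * l v" if "v \<in> W" for v
  proof -
    obtain d where d: "v = (\<Sum>b\<in>B. scale (d b) b)" using expand[OF \<open>v \<in> W\<close>] by blast
    have "F u v = (\<Sum>b\<in>B. cnj (d b) * F u b)" unfolding d by (rule right_sum) (use u in auto)
    also have "\<dots> = t * (\<Sum>b\<in>B. cnj (d b) * l b)"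
      by (simp add: u_basis sum_distrib_left mult.left_commute)
    also have "(\<Sum>b\<in>B. cnj (d b) * l b) = l v" unfolding d by (rule l_sum[symmetric]) simp
    finally show ?thesis .
  qed
  have t: "t \<noteq> 0"
  proof
    assume "t = 0"
    then have "u = 0" using nondegenerate[OF u] Fu by simp
    then have "c (Some b) = 0" if "b \<in> B" for b
      using B(2) finB that unfolding u_def independent_explicit_finite_subsets by fastforce
    then show False using c(1) \<open>t = 0\<close> by (auto simp: t_def)
  qed
  have tu: "scale (1 / t) u \<in> W" using W u by (rule subspace_scale)
  have sol: "F (scale (1 / t) u) v = l v" if "v \<in> W" for v
    using left[OF u W0 that, of "1 / t"] left0[OF that] Fu[OF that] t by simp
  show ?thesis
  proof (rule ex1I[of _ "scale (1 / t) u"])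
    show "scale (1 / t) u \<in> W \<and> (\<forall>v\<in>W. F (scale (1 / t) u) v = l v)" using tu sol by blast
    fix u' assume u': "u' \<in> W \<and> (\<forall>v\<in>W. F u' v = l v)"
    have "scale (-1) u' + scale (1 / t) u = 0"
    proof (rule nondegenerate)
      show "scale (-1) u' + scale (1 / t) u \<in> W"
        by (rule subspace_add[OF W subspace_scale[OF W] tu]) (use u' in blast)
      show "F (scale (-1) u' + scale (1 / t) u) v = 0" if "v \<in> W" for v
        using left[of u' "scale (1 / t) u" v "-1"] u' tu that sol[OF that] by simp
    qed
    then show "u' = scale (1 / t) u" by (simp add: scale_minus_left)
  qed
qed

context mesh
begin

text \<open>The discrete space is spanned by the functions that are, on a single element, 1 or a coordinate.
  In this form, the fact transfers to any linear embedding: \<open>U\<close> is the preimage of a subspace.\<close>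

lemma V_span_induct:
  assumes v: "v \<in> V" and zero: "(\<lambda>x. 0) \<in> U"
    and lincomb: "\<And>c f g. f \<in> U \<Longrightarrow> g \<in> U \<Longrightarrow> (\<lambda>x. c * f x + g x) \<in> U"
    and const: "\<And>K. K \<in> T \<Longrightarrow> (\<lambda>x. if x \<in> interior K then 1 else 0) \<in> U"
    and coord: "\<And>K i. K \<in> T \<Longrightarrow> (\<lambda>x. if x \<in> interior K then complex_of_real (x $ i) else 0) \<in> U"
  shows "v \<in> U"
proof -
  have sum: "(\<lambda>x. \<Sum>i\<in>A. f i x) \<in> U" if "finite A" "\<And>i. i \<in> A \<Longrightarrow> f i \<in> U"
    for A :: "'i set" and f :: "'i \<Rightarrow> real^'d \<Rightarrow> complex"
    using that
  proof (induction A rule: finite_induct)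
    case (insert i A)
    then show ?case using lincomb[of "f i" "\<lambda>x. \<Sum>i\<in>A. f i x" 1] by simp
  qed (simp add: zero)
  have scaled: "(\<lambda>x. c * f x) \<in> U" if "f \<in> U" for c f using lincomb[OF that zero, of c] by simp
  have sum_coord: "(\<lambda>x. \<Sum>i\<in>UNIV. piece_grad K v $ i * (if x \<in> interior K then complex_of_real (x $ i) else 0)) \<in> U"
    if "K \<in> T" for K by (intro sum scaled coord that finite)
  have piece: "(\<lambda>x. if x \<in> interior K then piece K v x else 0) \<in> U" if K: "K \<in> T" for K
  proof -
    have "(\<lambda>x. if x \<in> interior K then piece K v x else 0)
        = (\<lambda>x. piece_const K v * (if x \<in> interior K then 1 else 0)
          + (\<Sum>i\<in>UNIV. piece_grad K v $ i * (if x \<in> interior K then complex_of_real (x $ i) else 0)))"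
      by (auto simp: fun_eq_iff affine_form_def)
    then show ?thesis using lincomb[OF const[OF K] sum_coord[OF K]] by simp
  qed
  have "(\<lambda>x. \<Sum>K\<in>T. if x \<in> interior K then piece K v x else 0) \<in> U"
    by (rule sum[OF finite_T piece])
  moreover have "v = (\<lambda>x. \<Sum>K\<in>T. if x \<in> interior K then piece K v x else 0)"
    by (rule ext) (rule V_sum_pieces[OF v])
  ultimately show ?thesis by (rule back_subst[of "\<lambda>f. f \<in> U", OF _ sym])
qed

lemma unique_solution:
  assumes pos: "0 < k" "0 < \<beta>" "0 < \<delta>"
    and f: "square_integrable (lebesgue_on \<Omega>) f" and g: "square_integrable (surface_on (frontier \<Omega>)) g"
  shows "\<exists>!p. p \<in> V \<times> \<Sigma> \<and>
    (\<forall>q\<in>V \<times> \<Sigma>. A_h \<Omega> T k \<beta> \<delta> (fst p) (snd p) (fst q) (snd q) = load \<Omega> T f g (fst q))"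
proof -
  define scale :: "complex \<Rightarrow> (real^'d \<Rightarrow> complex) \<times> (real^'d \<Rightarrow> complex^'d) \<Rightarrow> _"
    where "scale c p = (\<lambda>x. c * fst p x, \<lambda>x. c *s snd p x)" for c p
  have vs: "vector_space scale"
    by unfold_locales
      (auto simp: scale_def plus_prod_def plus_fun_def fun_eq_iff vec_eq_iff distrib_left distrib_right)
  interpret vs: vector_space scale by (rule vs)
  have pair_lincomb: "scale c p + q = (\<lambda>x. c * fst p x + fst q x, \<lambda>x. c *s snd p x + snd q x)" for c p q
    by (simp add: scale_def plus_prod_def plus_fun_def)
  have pair_zero: "0 = (\<lambda>x::real^'d. 0::complex, \<lambda>x::real^'d. 0::complex^'d)"
    by (simp add: zero_prod_def zero_fun_def)
  define X where "X = (\<lambda>K x. if x \<in> interior K then 1 else 0) ` T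
    \<union> (\<lambda>(K, i) x. if x \<in> interior K then complex_of_real (x $ i) else 0) ` (T \<times> UNIV)"
  define S where "S = (\<lambda>\<phi>. (\<phi>, \<lambda>x. 0 :: complex^'d)) ` X
    \<union> (\<lambda>(\<phi>, i). (\<lambda>x. 0, \<lambda>x. \<phi> x *s axis i 1)) ` (X \<times> UNIV)"
  have X: "finite X" unfolding X_def using finite_T by simp
  have const_X: "(\<lambda>x. if x \<in> interior K then 1 else 0) \<in> X" if "K \<in> T" for K
    unfolding X_def using that by blast
  have coord_X: "(\<lambda>x. if x \<in> interior K then complex_of_real (x $ i) else 0) \<in> X" if "K \<in> T" for K i
    unfolding X_def using that by (intro UnI2 image_eqI[of _ _ "(K, i)"]) auto
  have scalar_S: "(\<phi>, \<lambda>x. 0) \<in> S" if "\<phi> \<in> X" for \<phi>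
    unfolding S_def using that by blast
  have vector_S: "(\<lambda>x. 0, \<lambda>x. \<phi> x *s axis i 1) \<in> S" if "\<phi> \<in> X" for \<phi> i
    unfolding S_def using that by (intro UnI2 image_eqI[of _ _ "(\<phi>, i)"]) auto
  have S: "finite S" unfolding S_def using X by simp
  have scalar: "(v, \<lambda>x. 0) \<in> vs.span S" if "v \<in> V" for v
  proof -
    have "v \<in> {v. (v, \<lambda>x. 0) \<in> vs.span S}"
    proof (rule V_span_induct[OF that])
      show "(\<lambda>x. 0) \<in> {v. (v, \<lambda>x. 0) \<in> vs.span S}"
        using vs.span_zero[of S] by (simp add: pair_zero)
      show "(\<lambda>x. c * f x + g x) \<in> {v. (v, \<lambda>x. 0) \<in> vs.span S}"
        if "f \<in> {v. (v, \<lambda>x. 0) \<in> vs.span S}" "g \<in> {v. (v, \<lambda>x. 0) \<in> vs.span S}" for c f g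
        using vs.span_add[OF vs.span_scale[of "(f, \<lambda>x. 0)" S c] , of "(g, \<lambda>x. 0)"] that
        by (simp add: pair_lincomb)
    qed (simp_all only: mem_Collect_eq vs.span_base scalar_S const_X coord_X)
    then show ?thesis by simp
  qed
  have vector: "(\<lambda>x. 0, \<lambda>x. v x *s axis i 1) \<in> vs.span S" if "v \<in> V" for v i
  proof -
    let ?U = "{v. (\<lambda>x. 0, \<lambda>x. v x *s axis i 1) \<in> vs.span S}"
    have "v \<in> ?U"
    proof (rule V_span_induct[OF that])
      show "(\<lambda>x. 0) \<in> ?U"
        using vs.span_zero[of S] by (simp add: pair_zero)
      show "(\<lambda>x. c * f x + g x) \<in> ?U" if "f \<in> ?U" "g \<in> ?U" for c f g
      proof -
        have "scale c (\<lambda>x. 0, \<lambda>x. f x *s axis i 1) + (\<lambda>x. 0, \<lambda>x. g x *s axis i 1) \<in> vs.span S"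
          using that by (intro vs.span_add vs.span_scale) auto
        then show ?thesis by (simp add: pair_lincomb vector_sadd_rdistrib)
      qed
    qed (simp_all only: mem_Collect_eq vs.span_base vector_S const_X coord_X)
    then show ?thesis by simp
  qed
  have span: "V \<times> \<Sigma> \<subseteq> vs.span S"
  proof clarify
    fix v \<tau> assume v: "v \<in> V" and \<tau>: "\<tau> \<in> \<Sigma>"
    have "(\<lambda>x. 0, \<lambda>x. \<Sum>i\<in>A. \<tau> x $ i *s axis i 1) \<in> vs.span S" for A :: "'d set"
      using finite[of A]
    proof (induction A rule: finite_induct)
      case empty
      then show ?case using vs.span_zero[of S] by (simp add: pair_zero)
    next
      case (insert i A)
      then show ?case
        using vs.span_add[OF vector[OF Sigma_component[OF \<tau>], of i i] insert.IH]
        by (simp add: plus_prod_def plus_fun_def)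
    qed
    from vs.span_add[OF scalar[OF v] this[of UNIV]]
    show "(v, \<tau>) \<in> vs.span S" by (simp add: plus_prod_def plus_fun_def basis_expansion)
  qed
  have W: "vs.subspace (V \<times> \<Sigma>)"
  proof (rule vs.subspaceI)
    show "0 \<in> V \<times> \<Sigma>" using V_zero Sigma_zero by (simp add: pair_zero)
    show "p + q \<in> V \<times> \<Sigma>" if "p \<in> V \<times> \<Sigma>" "q \<in> V \<times> \<Sigma>" for p q
      using that V_lincomb[of "fst p" "fst q" 1] Sigma_lincomb[of "snd p" "snd q" 1]
      by (auto simp: plus_prod_def plus_fun_def)
    show "scale c p \<in> V \<times> \<Sigma>" if "p \<in> V \<times> \<Sigma>" for c p
      using that V_lincomb[OF _ V_zero, of "fst p" c] Sigma_lincomb[OF _ Sigma_zero, of "snd p" c]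
      by (auto simp: scale_def)
  qed
  show ?thesis
  proof (rule nondegenerate_sesquilinear_unique_solution[OF vs W S span])
    show "A_h \<Omega> T k \<beta> \<delta> (fst (scale c p + p')) (snd (scale c p + p')) (fst q) (snd q)
        = c * A_h \<Omega> T k \<beta> \<delta> (fst p) (snd p) (fst q) (snd q) + A_h \<Omega> T k \<beta> \<delta> (fst p') (snd p') (fst q) (snd q)"
      if "p \<in> V \<times> \<Sigma>" "p' \<in> V \<times> \<Sigma>" "q \<in> V \<times> \<Sigma>" for c p p' q
      unfolding pair_lincomb fst_conv snd_conv using that by (intro A_h_lincomb_left) auto
    show "A_h \<Omega> T k \<beta> \<delta> (fst p) (snd p) (fst (scale c q + q')) (snd (scale c q + q'))
        = cnj c * A_h \<Omega> T k \<beta> \<delta> (fst p) (snd p) (fst q) (snd q) + A_h \<Omega> T k \<beta> \<delta> (fst p) (snd p) (fst q') (snd q')"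
      if "p \<in> V \<times> \<Sigma>" "q \<in> V \<times> \<Sigma>" "q' \<in> V \<times> \<Sigma>" for c p q q'
      unfolding pair_lincomb fst_conv snd_conv using that by (intro A_h_lincomb_right) auto
    show "load \<Omega> T f g (fst (scale c q + q')) = cnj c * load \<Omega> T f g (fst q) + load \<Omega> T f g (fst q')"
      if "q \<in> V \<times> \<Sigma>" "q' \<in> V \<times> \<Sigma>" for c q q'
      unfolding pair_lincomb fst_conv using that by (intro load_lincomb f g) auto
    show "p = 0" if "p \<in> V \<times> \<Sigma>"
      and "\<And>q. q \<in> V \<times> \<Sigma> \<Longrightarrow> A_h \<Omega> T k \<beta> \<delta> (fst p) (snd p) (fst q) (snd q) = 0" for p
      using A_h_nondegenerate[OF pos, of "fst p" "snd p"] that by (force simp: pair_zero prod_eq_iff)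
  qed
qed

end

theorem theorem3p2:
  fixes \<Omega> :: "(real^'d) set" and x\<^sub>\<Omega> :: "real^'d" and c\<^sub>\<Omega> \<theta> :: real
    and H :: "real set" and \<T> :: "real \<Rightarrow> (real^'d) set set"
    and f g :: "real^'d \<Rightarrow> complex"
  assumes dim: "CARD('d) = 2 \<or> CARD('d) = 3"
    and domain: "open \<Omega>" "connected \<Omega>" "bounded \<Omega>"
    and star: "strictly_star_shaped \<Omega> x\<^sub>\<Omega> c\<^sub>\<Omega>"
    and mesh: "\<And>h. h \<in> H \<Longrightarrow> h > 0 \<and> simplicial_partition \<Omega> (\<T> h) \<and> mesh_size (\<T> h) = h"
    and min_angle: "\<theta> > 0" "\<And>h K. h \<in> H \<Longrightarrow> K \<in> \<T> h \<Longrightarrow> min_angle_ge \<theta> K"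
    and f: "square_integrable (lebesgue_on \<Omega>) f"
    and g: "square_integrable (surface_on (frontier \<Omega>)) g"
  shows "\<forall>k>0. \<forall>h\<in>H. \<forall>\<delta>>0. \<forall>\<beta>>0.
    \<exists>!(u, \<sigma>). u \<in> V_h (\<T> h) \<and> \<sigma> \<in> Sigma_h (\<T> h) \<and>
      (\<forall>v\<in>V_h (\<T> h). \<forall>\<tau>\<in>Sigma_h (\<T> h).
        A_h \<Omega> (\<T> h) k \<beta> \<delta> u \<sigma> v \<tau> = load \<Omega> (\<T> h) f g v)"
proof (intro allI impI ballI)
  fix k h \<delta> \<beta> :: real assume pos: "0 < k" "0 < \<delta>" "0 < \<beta>" and h: "h \<in> H"
  interpret mesh \<Omega> "\<T> h"
  proof
    show "2 \<le> CARD('d)" using dim by auto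
    show "\<Omega> \<noteq> {}" using star by (auto simp: strictly_star_shaped_def)
    show "AE x in surface_on (frontier \<Omega>). \<exists>\<nu>. outward_unit_normal_at \<Omega> x \<nu>"
      using star unfolding strictly_star_shaped_def by (elim conjE, elim eventually_mono) blast
  qed (use domain mesh[OF h] in auto)
  have "(p \<in> V_h (\<T> h) \<times> Sigma_h (\<T> h) \<and> (\<forall>q\<in>V_h (\<T> h) \<times> Sigma_h (\<T> h).
        A_h \<Omega> (\<T> h) k \<beta> \<delta> (fst p) (snd p) (fst q) (snd q) = load \<Omega> (\<T> h) f g (fst q)))
      = (case p of (u, \<sigma>) \<Rightarrow> u \<in> V_h (\<T> h) \<and> \<sigma> \<in> Sigma_h (\<T> h) \<and>
      (\<forall>v\<in>V_h (\<T> h). \<forall>\<tau>\<in>Sigma_h (\<T> h). A_h \<Omega> (\<T> h) k \<beta> \<delta> u \<sigma> v \<tau> = load \<Omega> (\<T> h) f g v))" for p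
    by (cases p) auto
  with unique_solution[OF pos(1,3,2) f g]
  show "\<exists>!(u, \<sigma>). u \<in> V_h (\<T> h) \<and> \<sigma> \<in> Sigma_h (\<T> h) \<and>
      (\<forall>v\<in>V_h (\<T> h). \<forall>\<tau>\<in>Sigma_h (\<T> h).
        A_h \<Omega> (\<T> h) k \<beta> \<delta> u \<sigma> v \<tau> = load \<Omega> (\<T> h) f g v)"
    by simp
qed

end
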